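(* Let $(R,\mathfrak m)$ be a regular local ring with quotient field $F$ and $\dim R\ge 2$, let $\{(R_i,\mathfrak m_i)\}_{i\ge 0}$ be an infinite sequence of local quadratic transforms with $R_0=R$, let $S=\bigcup_{i\ge0}R_i$ with maximal ideal $N=\bigcup_i\mathfrak m_i$, let $x\in S$ be such that $xS$ is $N$-primary, let $T$ be the Noetherian hull of $S$ and assume $T$ is a localization of $R$. Let $S^*$ be the complete integral closure of $S$, $V$ the boundary valuation ring of $S$, and $W$ the rank one valuation overring of $V$. Assume $S$ is archimedean and not a DVR. If there exists $\theta\in S^*\setminus S$ such that $S[\theta]_N=W$, then (1) $S^*=S[\theta]$; (2) $\theta^{-1}S[\theta^{-1}]$ is a maximal ideal of $S[\theta^{-1}]$; and (3) $V=S[\theta^{-1}]_{\theta^{-1}S[\theta^{-1}]}$.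
   Context: A local quadratic transform of a regular local ring $(A,\mathfrak n)$ is a local ring $A[\mathfrak n/y]_{\mathfrak q}$ with $y\in\mathfrak n\setminus\mathfrak n^2$ and $\mathfrak q$ a prime ideal of $A[\mathfrak n/y]$ containing $\mathfrak n$. The sequence satisfies: for each $i\ge 0$, $R_{i+1}$ is a local quadratic transform of $R_i$, $R_i\subsetneq R_{i+1}$, and each $R_i$ is a regular local ring of dimension at least $2$ with maximal ideal $\mathfrak m_i$. $\mathrm{ord}_i$ is the order valuation of $R_i$ ($\mathrm{ord}_i(a)=\max\{n:a\in\mathfrak m_i^n\}$ for $0\ne a\in R_i$, extended to $F$ by $\mathrm{ord}_i(a/b)=\mathrm{ord}_i(a)-\mathrm{ord}_i(b)$), with valuation ring $V_i$. The boundary valuation ring of $S$ is the unique valuation ring $V$ with $R\subseteq V\subseteq F$ that is a limit point of $\{V_i\}$ in the patch topology (basic open sets $\{U: G\subseteq U, H\subseteq\mathfrak M_U\}$, $G,H\subseteq F$ finite); equivalently $V=\{q\in F:\mathrm{ord}_i(q)\ge 0\text{ for } i\gg0\}$. $W$ is the localization of $V$ at its height one prime ideal. The Noetherian hull $T$ is the intersection of all DVRs with quotient field $F$ properly containing $S$ (empty intersection $=F$). A domain $A$ is archimedean if $\bigcap_{n>0}a^nA=0$ for every nonunit $a\in A$. The complete integral closure of $S$ is the ring of $\theta\in F$ with $S[\theta]$ a fractional ideal of $S$. For $\theta\in S^*$ as in the claim, $N$ is an ideal of $S[\theta]$ and $S[\theta]_N$ denotes the localization of $S[\theta]$ at the multiplicative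 set $S[\theta]\setminus N$. *)

theory Defs
  imports Main "HOL-Library.Extended_Nat"
begin

text \<open>All rings are subrings of a fixed field F, represented by the type 'a :: field.
  An "ideal" etc. is always relative to a given subring.\<close>

definition subring :: "'a::field set \<Rightarrow> bool" where
  "subring A \<longleftrightarrow> 0 \<in> A \<and> 1 \<in> A \<and> (\<forall>x\<in>A. \<forall>y\<in>A. x + y \<in> A \<and> x - y \<in> A \<and> x * y \<in> A)"

definition has_quotient_field :: "'a::field set \<Rightarrow> bool" where
  "has_quotient_field A \<longleftrightarrow> (\<forall>z. \<exists>a\<in>A. \<exists>b\<in>A. b \<noteq> 0 \<and> z = a / b)"

definition sr_ideal :: "'a::field set \<Rightarrow> 'a set \<Rightarrow> bool" where
  "sr_ideal A I \<longleftrightarrow> I \<subseteq> A \<and> 0 \<in> I \<and> (\<forall>x\<in>I. \<forall>y\<in>I. x + y \<in> I) \<and> (\<forall>a\<in>A. \<forall>x\<in>I. a * x \<in> I)"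

definition sr_prime :: "'a::field set \<Rightarrow> 'a set \<Rightarrow> bool" where
  "sr_prime A P \<longleftrightarrow> sr_ideal A P \<and> P \<noteq> A \<and> (\<forall>a\<in>A. \<forall>b\<in>A. a * b \<in> P \<longrightarrow> a \<in> P \<or> b \<in> P)"

definition sr_maximal :: "'a::field set \<Rightarrow> 'a set \<Rightarrow> bool" where
  "sr_maximal A M \<longleftrightarrow> sr_ideal A M \<and> M \<noteq> A \<and>
     (\<forall>J. sr_ideal A J \<and> M \<subseteq> J \<longrightarrow> J = M \<or> J = A)"

definition gen_ideal :: "'a::field set \<Rightarrow> 'a set \<Rightarrow> 'a set" where
  "gen_ideal A X = {(\<Sum>x\<in>Y. c x * x) | Y c. finite Y \<and> Y \<subseteq> X \<and> (\<forall>x\<in>Y. c x \<in> A)}"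

definition noetherian :: "'a::field set \<Rightarrow> bool" where
  "noetherian A \<longleftrightarrow> subring A \<and> (\<forall>I. sr_ideal A I \<longrightarrow> (\<exists>X. finite X \<and> X \<subseteq> A \<and> I = gen_ideal A X))"

definition max_ideal :: "'a::field set \<Rightarrow> 'a set" where
  "max_ideal A = {a \<in> A. a = 0 \<or> inverse a \<notin> A}"

definition local_ring :: "'a::field set \<Rightarrow> bool" where
  "local_ring A \<longleftrightarrow> subring A \<and> sr_ideal A (max_ideal A)"

definition has_prime_chain :: "'a::field set \<Rightarrow> nat \<Rightarrow> bool" where
  "has_prime_chain A n \<longleftrightarrow> (\<exists>P :: nat \<Rightarrow> 'a set.
      (\<forall>i\<le>n. sr_prime A (P i)) \<and> (\<forall>i<n. P i \<subset> P (Suc i)))"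

definition krull_dim_eq :: "'a::field set \<Rightarrow> nat \<Rightarrow> bool" where
  "krull_dim_eq A d \<longleftrightarrow> has_prime_chain A d \<and> \<not> has_prime_chain A (Suc d)"

definition regular_local :: "'a::field set \<Rightarrow> bool" where
  "regular_local A \<longleftrightarrow> noetherian A \<and> local_ring A \<and>
     (\<exists>d. krull_dim_eq A d \<and> (\<exists>X. finite X \<and> X \<subseteq> A \<and> card X \<le> d \<and> gen_ideal A X = max_ideal A))"

primrec ideal_pow :: "'a::field set \<Rightarrow> 'a set \<Rightarrow> nat \<Rightarrow> 'a set" where
  "ideal_pow A I 0 = A"
| "ideal_pow A I (Suc n) = gen_ideal A {x * y | x y. x \<in> ideal_pow A I n \<and> y \<in> I}"

definition ring_adj :: "'a::field set \<Rightarrow> 'a set \<Rightarrow> 'a set" where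
  "ring_adj A X = \<Inter> {B. subring B \<and> A \<union> X \<subseteq> B}"

definition frac_loc :: "'a::field set \<Rightarrow> 'a set \<Rightarrow> 'a set" where
  "frac_loc A M = {a / b | a b. a \<in> A \<and> b \<in> M}"

definition mult_closed :: "'a::field set \<Rightarrow> 'a set \<Rightarrow> bool" where
  "mult_closed A M \<longleftrightarrow> M \<subseteq> A \<and> 1 \<in> M \<and> 0 \<notin> M \<and> (\<forall>x\<in>M. \<forall>y\<in>M. x * y \<in> M)"

definition loc_at :: "'a::field set \<Rightarrow> 'a set \<Rightarrow> 'a set" where
  "loc_at A P = frac_loc A (A - P)"

definition quad_transform :: "'a::field set \<Rightarrow> 'a set \<Rightarrow> bool" where
  "quad_transform A B \<longleftrightarrow> (\<exists>y. y \<in> max_ideal A \<and> y \<notin> ideal_pow A (max_ideal A) 2 \<and>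
     (\<exists>q. sr_prime (ring_adj A {a / y | a. a \<in> max_ideal A}) q \<and> max_ideal A \<subseteq> q \<and>
          B = loc_at (ring_adj A {a / y | a. a \<in> max_ideal A}) q))"

definition ord :: "'a::field set \<Rightarrow> 'a \<Rightarrow> enat" where
  "ord A a = (if a = 0 then \<infinity> else Sup (enat ` {n. a \<in> ideal_pow A (max_ideal A) n}))"

definition ord_valring :: "'a::field set \<Rightarrow> 'a set" where
  "ord_valring A = {a / b | a b. a \<in> A \<and> b \<in> A \<and> b \<noteq> 0 \<and> ord A b \<le> ord A a}"

definition boundary_valring :: "(nat \<Rightarrow> 'a::field set) \<Rightarrow> 'a set" where
  "boundary_valring R = {q. \<exists>i0. \<forall>i\<ge>i0. q \<in> ord_valring (R i)}"

definition valuation_ring :: "'a::field set \<Rightarrow> bool" where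
  "valuation_ring V \<longleftrightarrow> subring V \<and> (\<forall>x. x \<noteq> 0 \<longrightarrow> x \<in> V \<or> inverse x \<in> V)"

definition DVR :: "'a::field set \<Rightarrow> bool" where
  "DVR V \<longleftrightarrow> valuation_ring V \<and> noetherian V \<and> V \<noteq> UNIV"

definition height_one_prime :: "'a::field set \<Rightarrow> 'a set \<Rightarrow> bool" where
  "height_one_prime A P \<longleftrightarrow> sr_prime A P \<and> P \<noteq> {0} \<and>
     \<not> (\<exists>Q. sr_prime A Q \<and> {0} \<subset> Q \<and> Q \<subset> P)"

definition noetherian_hull :: "'a::field set \<Rightarrow> 'a set" where
  "noetherian_hull S = {q. \<forall>D. DVR D \<and> S \<subset> D \<longrightarrow> q \<in> D}"

definition archimedean_dom :: "'a::field set \<Rightarrow> bool" where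
  "archimedean_dom A \<longleftrightarrow> (\<forall>a\<in>max_ideal A. (\<Inter>n\<in>{0<..}. {a ^ n * s | s. s \<in> A}) = {0})"

definition complete_int_closure :: "'a::field set \<Rightarrow> 'a set" where
  "complete_int_closure A = {\<theta>. \<exists>d\<in>A. d \<noteq> 0 \<and> (\<forall>z\<in>ring_adj A {\<theta>}. d * z \<in> A)}"

definition primary_ideal :: "'a::field set \<Rightarrow> 'a set \<Rightarrow> bool" where
  "primary_ideal A I \<longleftrightarrow> sr_ideal A I \<and> I \<noteq> A \<and>
     (\<forall>a\<in>A. \<forall>b\<in>A. a * b \<in> I \<and> a \<notin> I \<longrightarrow> (\<exists>n. b ^ n \<in> I))"

definition radical :: "'a::field set \<Rightarrow> 'a set \<Rightarrow> 'a set" where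
  "radical A I = {a \<in> A. \<exists>n. a ^ n \<in> I}"

end

theory Submission
  imports Defs "HOL-Computational_Algebra.Polynomial"
begin

text \<open>
  The order valuations \<open>ord\<^sub>i\<close> have eventually constant sign on every element \<open>z\<close> of \<open>F\<close>: write \<open>z = a / b\<close> and
  divide \<open>a\<close> and \<open>b\<close> at each stage by the largest common power of the exceptional parameter. The order
  of a proper transform is at most the original order (a polynomial of degree \<open>s\<close> has order at most \<open>s\<close> at every
  prime of a polynomial ring, by Hasse derivatives), so the minimum of the two orders becomes stationary.
  Hence \<open>V\<close> is a valuation ring. As \<open>x\<close> divides powers of the exceptional parameters, its proper transforms become
  units, and so \<open>V \<inter> S[1/x] = S\<close>; as \<open>S[1/x]\<close> is a localization of a regular local ring, \<open>S\<^sup>* \<subseteq> S[1/x]\<close>.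

  Since \<open>S\<close> is archimedean, \<open>N\<close> lies in the height one prime \<open>P\<close> of \<open>V\<close>, whence \<open>S\<^sup>* \<subseteq> W\<close> and \<open>N S\<^sup>* \<subseteq> N\<close>. In
  \<open>W / P = k(\<theta>)\<close>, with \<open>k = S / N\<close>, the ring \<open>V / P\<close> is the valuation ring at infinity because \<open>\<theta> \<notin> V\<close>. This gives (2)
  and (3), and an element of \<open>S\<^sup>*\<close> with a pole of order \<open>r\<close> at infinity is reduced to one with a smaller pole by
  subtracting a multiple of \<open>\<theta> ^ r\<close>, which gives (1).
\<close>

section \<open>Ideals in subrings of a field\<close>

text \<open>All rings are subsets of one field, so no quotient ring is at hand: statements about
  \<open>A / I\<close> use representatives in \<open>A\<close>, and divisibility by the class of
  \<open>a\<close> becomes membership in \<open>isum I (prin A a)\<close>. The bound on the order of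
  a proper transform is the main obstacle. Symbolic orders modulo \<open>yE\<close> and Hasse
  derivatives work in every characteristic. They rest on \<open>E / yE\<close> being a polynomial
  ring, which goes back to Krull's height theorem: prefixes of a regular system of parameters
  generate primes. For the unit property, an exceptional parameter is kept factored into prime
  elements along the sequence. None of them divides the proper transform of \<open>x\<close>, which
  nevertheless divides a power of that parameter. An element of the complete integral closure
  becomes integral over some \<open>R n0\<close> after multiplication by a denominator that is
  invertible in \<open>S[1/x]\<close>. Regular local rings are completely integrally closed by
  descending induction along the parameters, starting from the residue field.\<close>

definition isum :: "'a::field set \<Rightarrow> 'a set \<Rightarrow> 'a set" where
  "isum I J = {i + j | i j. i \<in> I \<and> j \<in> J}"

definition prin :: "'a::field set \<Rightarrow> 'a \<Rightarrow> 'a set" where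
  "prin A a = {a * s | s. s \<in> A}"

text \<open>This is the right-hand side of the successor clause of \<open>ideal_pow\<close>, so
  facts about products of ideals apply to powers.\<close>

definition iprod :: "'a::field set \<Rightarrow> 'a set \<Rightarrow> 'a set \<Rightarrow> 'a set" where
  "iprod A I J = gen_ideal A {x * y | x y. x \<in> I \<and> y \<in> J}"

definition colon :: "'a::field set \<Rightarrow> 'a set \<Rightarrow> 'a \<Rightarrow> 'a set" where
  "colon A K z = {f \<in> A. f * z \<in> K}"

lemma subring_0: "subring A \<Longrightarrow> 0 \<in> A" by (simp add: subring_def)
lemma subring_1: "subring A \<Longrightarrow> 1 \<in> A" by (simp add: subring_def)
lemma subring_add: "subring A \<Longrightarrow> x \<in> A \<Longrightarrow> y \<in> A \<Longrightarrow> x + y \<in> A" by (simp add: subring_def)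
lemma subring_diff: "subring A \<Longrightarrow> x \<in> A \<Longrightarrow> y \<in> A \<Longrightarrow> x - y \<in> A" by (simp add: subring_def)
lemma subring_mult: "subring A \<Longrightarrow> x \<in> A \<Longrightarrow> y \<in> A \<Longrightarrow> x * y \<in> A" by (simp add: subring_def)
lemma subring_uminus: "subring A \<Longrightarrow> x \<in> A \<Longrightarrow> - x \<in> A" using subring_diff[of A 0 x] subring_0 by auto
lemma subring_power: "subring A \<Longrightarrow> x \<in> A \<Longrightarrow> x ^ n \<in> A" by (induction n) (auto intro: subring_1 subring_mult)
lemma subring_sum: "subring A \<Longrightarrow> (\<And>i. i \<in> I \<Longrightarrow> f i \<in> A) \<Longrightarrow> sum f I \<in> A"
  by (induction I rule: infinite_finite_induct) (auto intro: subring_0 subring_add)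
lemma subring_prod: "subring A \<Longrightarrow> (\<And>i. i \<in> I \<Longrightarrow> f i \<in> A) \<Longrightarrow> prod f I \<in> A"
  by (induction I rule: infinite_finite_induct) (auto intro: subring_1 subring_mult)
lemmas subring_intros = subring_0 subring_1 subring_add subring_diff subring_mult subring_uminus subring_power

lemma ideal_memD: "sr_ideal A I \<Longrightarrow> x \<in> I \<Longrightarrow> x \<in> A" by (auto simp: sr_ideal_def)
lemma ideal_0: "sr_ideal A I \<Longrightarrow> 0 \<in> I" by (auto simp: sr_ideal_def)
lemma ideal_add: "sr_ideal A I \<Longrightarrow> x \<in> I \<Longrightarrow> y \<in> I \<Longrightarrow> x + y \<in> I" by (auto simp: sr_ideal_def)
lemma ideal_mult: "sr_ideal A I \<Longrightarrow> a \<in> A \<Longrightarrow> x \<in> I \<Longrightarrow> a * x \<in> I" by (auto simp: sr_ideal_def)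
lemma ideal_multr: "sr_ideal A I \<Longrightarrow> a \<in> A \<Longrightarrow> x \<in> I \<Longrightarrow> x * a \<in> I" by (metis ideal_mult mult.commute)
lemma ideal_uminus: "subring A \<Longrightarrow> sr_ideal A I \<Longrightarrow> x \<in> I \<Longrightarrow> - x \<in> I"
  using ideal_mult[of A I "-1" x] by (auto intro: subring_intros)
lemma ideal_diff: "subring A \<Longrightarrow> sr_ideal A I \<Longrightarrow> x \<in> I \<Longrightarrow> y \<in> I \<Longrightarrow> x - y \<in> I"
  using ideal_add[of A I x "-y"] ideal_uminus[of A I y] by auto
lemma ideal_sum: "sr_ideal A I \<Longrightarrow> (\<And>i. i \<in> K \<Longrightarrow> f i \<in> I) \<Longrightarrow> sum f K \<in> I"
  by (induction K rule: infinite_finite_induct) (auto intro: ideal_0 ideal_add)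
lemma ideal_power: "subring A \<Longrightarrow> sr_ideal A I \<Longrightarrow> x \<in> I \<Longrightarrow> n > 0 \<Longrightarrow> x ^ n \<in> I"
  using ideal_multr[of A I "x ^ (n - 1)" x] ideal_memD[of A I x] subring_power[of A x "n - 1"] by (cases n) auto

lemma ideal_self: "subring A \<Longrightarrow> sr_ideal A A"
  by (auto simp: sr_ideal_def intro: subring_intros)
lemma ideal_zero: "subring A \<Longrightarrow> sr_ideal A {0}"
  by (auto simp: sr_ideal_def intro: subring_intros)
lemma ideal_one: "sr_ideal A I \<Longrightarrow> 1 \<in> I \<Longrightarrow> I = A"
  using ideal_mult[of A I _ 1] by (auto simp: sr_ideal_def)
lemma ideal_isum: assumes "subring A" "sr_ideal A I" "sr_ideal A J" shows "sr_ideal A (isum I J)"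
  unfolding sr_ideal_def
proof (intro conjI ballI)
  show "isum I J \<subseteq> A" using assms by (auto simp: isum_def intro!: subring_add dest: ideal_memD)
  show "0 \<in> isum I J" using ideal_0[OF assms(2)] ideal_0[OF assms(3)] by (force simp: isum_def)
next
  fix x y assume "x \<in> isum I J" "y \<in> isum I J"
  then obtain a b c d where "x = a + b" "y = c + d" "a \<in> I" "b \<in> J" "c \<in> I" "d \<in> J"
    by (auto simp: isum_def)
  then have "x + y = (a + c) + (b + d)" "a + c \<in> I" "b + d \<in> J"
    using ideal_add[OF assms(2)] ideal_add[OF assms(3)] by auto
  then show "x + y \<in> isum I J" unfolding isum_def by blast
next
  fix a x assume a: "a \<in> A" "x \<in> isum I J"
  then obtain i j where "x = i + j" "i \<in> I" "j \<in> J" by (auto simp: isum_def)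
  then have "a * x = a * i + a * j" "a * i \<in> I" "a * j \<in> J"
    using ideal_mult[OF assms(2)] ideal_mult[OF assms(3)] a by (auto simp: algebra_simps)
  then show "a * x \<in> isum I J" unfolding isum_def by blast
qed

lemma isum_left: "0 \<in> J \<Longrightarrow> I \<subseteq> isum I J" by (force simp: isum_def)
lemma isum_right: "0 \<in> I \<Longrightarrow> J \<subseteq> isum I J" by (force simp: isum_def)
lemma isumI: "i \<in> I \<Longrightarrow> j \<in> J \<Longrightarrow> i + j \<in> isum I J" by (auto simp: isum_def)
lemma isum_least: "sr_ideal A K \<Longrightarrow> I \<subseteq> K \<Longrightarrow> J \<subseteq> K \<Longrightarrow> isum I J \<subseteq> K"
  by (auto simp: isum_def intro: ideal_add)

lemma ideal_prin: "subring A \<Longrightarrow> a \<in> A \<Longrightarrow> sr_ideal A (prin A a)"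
  unfolding sr_ideal_def
proof (intro conjI ballI)
  assume A: "subring A" and a: "a \<in> A"
  show "prin A a \<subseteq> A" using A a by (auto simp: prin_def intro: subring_intros)
  show "0 \<in> prin A a" using A by (auto simp: prin_def intro: subring_intros exI[of _ 0])
  fix x assume x: "x \<in> prin A a"
  then obtain s where s: "x = a * s" "s \<in> A" by (auto simp: prin_def)
  { fix y assume "y \<in> prin A a"
    then obtain t where t: "y = a * t" "t \<in> A" by (auto simp: prin_def)
    show "x + y \<in> prin A a" using A s t by (auto simp: prin_def algebra_simps intro!: exI[of _ "s+t"] intro: subring_intros) }
  { fix b assume "b \<in> A"
    then show "b * x \<in> prin A a" using A s by (auto simp: prin_def algebra_simps intro!: exI[of _ "b*s"] intro: subring_intros) }
qed

lemma prin_self: "subring A \<Longrightarrow> a \<in> prin A a"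
  by (auto simp: prin_def intro!: exI[of _ 1] intro: subring_intros)
lemma prin_mult: "s \<in> A \<Longrightarrow> a * s \<in> prin A a" "s \<in> A \<Longrightarrow> s * a \<in> prin A a"
  by (auto simp: prin_def mult.commute intro: exI[of _ s])
lemma prin_least: "sr_ideal A I \<Longrightarrow> a \<in> I \<Longrightarrow> prin A a \<subseteq> I"
  by (auto simp: prin_def intro: ideal_multr)

lemma isum_prinD: "z \<in> isum I (prin A a) \<Longrightarrow> \<exists>i\<in>I. \<exists>s\<in>A. z = i + a * s"
  by (auto simp: isum_def prin_def)
lemma isum_prinI: "i \<in> I \<Longrightarrow> s \<in> A \<Longrightarrow> i + a * s \<in> isum I (prin A a)"
  by (auto simp: isum_def prin_def)

lemma ideal_colon: "subring A \<Longrightarrow> sr_ideal A K \<Longrightarrow> z \<in> A \<Longrightarrow> sr_ideal A (colon A K z)"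
  by (auto simp: sr_ideal_def colon_def algebra_simps intro: subring_intros)

lemma gen_ideal_incl: assumes "subring A" shows "X \<subseteq> gen_ideal A X"
proof
  fix x assume "x \<in> X"
  then show "x \<in> gen_ideal A X" unfolding gen_ideal_def using subring_1[OF assms]
    by (intro CollectI exI[of _ "{x}"] exI[of _ "\<lambda>_. 1"]) auto
qed

lemma gen_ideal_least: assumes "sr_ideal A I" "X \<subseteq> I" shows "gen_ideal A X \<subseteq> I"
  using assms by (auto simp: gen_ideal_def intro!: ideal_sum ideal_mult)

lemma ideal_gen: assumes A: "subring A" and X: "X \<subseteq> A" shows "sr_ideal A (gen_ideal A X)"
  unfolding sr_ideal_def
proof (intro conjI ballI)
  show "gen_ideal A X \<subseteq> A" by (rule gen_ideal_least[OF ideal_self[OF A] X])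
  show "0 \<in> gen_ideal A X" unfolding gen_ideal_def by (intro CollectI exI[of _ "{}"]) auto
next
  fix x y assume "x \<in> gen_ideal A X" "y \<in> gen_ideal A X"
  then obtain Y c Z d where 1: "x = (\<Sum>x\<in>Y. c x * x)" "finite Y" "Y \<subseteq> X" "\<forall>x\<in>Y. c x \<in> A"
    and 2: "y = (\<Sum>x\<in>Z. d x * x)" "finite Z" "Z \<subseteq> X" "\<forall>x\<in>Z. d x \<in> A"
    unfolding gen_ideal_def by blast
  define c' where "c' x = (if x \<in> Y then c x else 0)" for x
  define d' where "d' x = (if x \<in> Z then d x else 0)" for x
  have x: "x = (\<Sum>x\<in>Y\<union>Z. c' x * x)" unfolding 1(1)
    by (rule sum.mono_neutral_cong_left) (use 1 2 in \<open>auto simp: c'_def\<close>)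
  have y: "y = (\<Sum>x\<in>Y\<union>Z. d' x * x)" unfolding 2(1)
    by (rule sum.mono_neutral_cong_left) (use 1 2 in \<open>auto simp: d'_def\<close>)
  have "x + y = (\<Sum>x\<in>Y\<union>Z. (c' x + d' x) * x)" unfolding x y by (simp add: sum.distrib algebra_simps)
  moreover have "\<forall>x\<in>Y\<union>Z. c' x + d' x \<in> A" using 1 2 A by (auto simp: c'_def d'_def intro: subring_intros)
  ultimately show "x + y \<in> gen_ideal A X" unfolding gen_ideal_def using 1 2
    by (intro CollectI exI[of _ "Y \<union> Z"] exI[of _ "\<lambda>x. c' x + d' x"]) auto
next
  fix a x assume a: "a \<in> A" and "x \<in> gen_ideal A X"
  then obtain Y c where 1: "x = (\<Sum>x\<in>Y. c x * x)" "finite Y" "Y \<subseteq> X" "\<forall>x\<in>Y. c x \<in> A"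
    unfolding gen_ideal_def by blast
  have "a * x = (\<Sum>x\<in>Y. (a * c x) * x)" by (simp add: 1(1) sum_distrib_left mult.assoc)
  then show "a * x \<in> gen_ideal A X" unfolding gen_ideal_def using 1 a A
    by (intro CollectI exI[of _ Y] exI[of _ "\<lambda>x. a * c x"]) (auto intro: subring_intros)
qed

lemma gen_ideal_mono: "subring A \<Longrightarrow> Y \<subseteq> A \<Longrightarrow> X \<subseteq> Y \<Longrightarrow> gen_ideal A X \<subseteq> gen_ideal A Y"
  by (rule gen_ideal_least) (auto intro: ideal_gen dest: gen_ideal_incl)

lemma gen_ideal_empty: "gen_ideal A {} = {0}" by (auto simp: gen_ideal_def)

lemma gen_ideal_Un: assumes A: "subring A" and X: "X \<subseteq> A" "Y \<subseteq> A"
  shows "gen_ideal A (X \<union> Y) = isum (gen_ideal A X) (gen_ideal A Y)"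
proof
  have iX: "sr_ideal A (gen_ideal A X)" and iY: "sr_ideal A (gen_ideal A Y)" and iXY: "sr_ideal A (gen_ideal A (X \<union> Y))"
    using A X by (auto intro: ideal_gen)
  show "gen_ideal A (X \<union> Y) \<subseteq> isum (gen_ideal A X) (gen_ideal A Y)"
    using gen_ideal_incl[OF A, of X] gen_ideal_incl[OF A, of Y]
      isum_left[OF ideal_0[OF iY]] isum_right[OF ideal_0[OF iX]]
    by (intro gen_ideal_least ideal_isum[OF A iX iY]) blast
  show "isum (gen_ideal A X) (gen_ideal A Y) \<subseteq> gen_ideal A (X \<union> Y)"
    by (rule isum_least[OF iXY]; rule gen_ideal_mono) (use A X in auto)
qed

lemma gen_ideal_single: assumes "subring A" "z \<in> A" shows "gen_ideal A {z} = prin A z"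
  using gen_ideal_least[OF ideal_prin[OF assms], of "{z}"] prin_self[OF assms(1)]
    prin_least[OF ideal_gen[OF assms(1), of "{z}"]] gen_ideal_incl[OF assms(1), of "{z}"] assms(2)
  by blast

lemma gen_ideal_insert: assumes "subring A" "z \<in> A" "X \<subseteq> A"
  shows "gen_ideal A (insert z X) = isum (gen_ideal A X) (prin A z)"
  using gen_ideal_Un[OF assms(1), of X "{z}"] gen_ideal_single[OF assms(1,2)] assms by simp

lemma ideal_iprod: assumes "subring A" "sr_ideal A I" "sr_ideal A J" shows "sr_ideal A (iprod A I J)"
  unfolding iprod_def using assms by (intro ideal_gen) (auto intro!: subring_mult dest: ideal_memD)

lemma iprodI: "subring A \<Longrightarrow> x \<in> I \<Longrightarrow> y \<in> J \<Longrightarrow> x * y \<in> iprod A I J"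
  unfolding iprod_def by (rule set_mp[OF gen_ideal_incl]) auto

lemma iprod_least: "sr_ideal A K \<Longrightarrow> (\<And>x y. x \<in> I \<Longrightarrow> y \<in> J \<Longrightarrow> x * y \<in> K) \<Longrightarrow> iprod A I J \<subseteq> K"
  unfolding iprod_def by (rule gen_ideal_least) auto

lemma ideal_pow_Suc_iprod: "ideal_pow A I (Suc n) = iprod A (ideal_pow A I n) I"
  by (simp add: iprod_def)

lemma ideal_ideal_pow: "subring A \<Longrightarrow> sr_ideal A I \<Longrightarrow> sr_ideal A (ideal_pow A I n)"
proof (induction n)
  case 0 then show ?case by (simp add: ideal_self)
next
  case (Suc n) then show ?case unfolding ideal_pow_Suc_iprod by (intro ideal_iprod) auto
qed

declare ideal_pow.simps(2) [simp del]

lemma ideal_pow_1: assumes "subring A" "sr_ideal A I" shows "ideal_pow A I (Suc 0) = I"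
  unfolding ideal_pow_Suc_iprod ideal_pow.simps(1)
  using iprod_least[OF assms(2), of A I] iprodI[OF assms(1) subring_1[OF assms(1)], of _ I] assms
  by (auto intro: ideal_mult)

lemma ideal_pow_dec: assumes "subring A" "sr_ideal A I" shows "ideal_pow A I (Suc n) \<subseteq> ideal_pow A I n"
  unfolding ideal_pow_Suc_iprod
  by (rule iprod_least[OF ideal_ideal_pow[OF assms]])
     (metis assms ideal_ideal_pow ideal_multr ideal_memD)

lemma ideal_pow_antimono: assumes "subring A" "sr_ideal A I" "m \<le> n" shows "ideal_pow A I n \<subseteq> ideal_pow A I m"
  using assms(3)
proof (induction n rule: dec_induct)
  case (step n) then show ?case using ideal_pow_dec[OF assms(1,2), of n] by auto
qed auto

text \<open>Products \<open>u * v\<close> only generate the next power, so the claim is tested on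
  them through the colon ideal of \<open>x\<close>.\<close>

lemma ideal_pow_mult: assumes A: "subring A" "sr_ideal A I" and "x \<in> ideal_pow A I m" "y \<in> ideal_pow A I n"
  shows "x * y \<in> ideal_pow A I (m + n)"
  using assms(4)
proof (induction n arbitrary: y)
  case 0 then show ?case using assms(3) ideal_ideal_pow[OF A, of m] by (auto intro: ideal_multr)
next
  case (Suc n)
  have x: "x \<in> A" using assms(3) ideal_ideal_pow[OF A] ideal_memD by blast
  have c: "sr_ideal A (colon A (ideal_pow A I (m + Suc n)) x)"
    by (intro ideal_colon ideal_ideal_pow A x)
  have "ideal_pow A I (Suc n) \<subseteq> colon A (ideal_pow A I (m + Suc n)) x"
    unfolding ideal_pow_Suc_iprod[of A I n]
  proof (rule iprod_least[OF c])
    fix u v assume u: "u \<in> ideal_pow A I n" and v: "v \<in> I"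
    have "x * u * v \<in> ideal_pow A I (Suc (m + n))"
      unfolding ideal_pow_Suc_iprod by (rule iprodI[OF A(1) Suc.IH[OF u] v])
    moreover have "u * v \<in> A" using u v A ideal_ideal_pow[OF A] by (meson ideal_memD subring_mult)
    ultimately show "u * v \<in> colon A (ideal_pow A I (m + Suc n)) x"
      by (simp add: colon_def algebra_simps)
  qed
  then show ?case using Suc.prems by (auto simp: colon_def mult.commute)
qed

lemma ideal_pow_elem: assumes "subring A" "sr_ideal A I" "x \<in> I" shows "x ^ n \<in> ideal_pow A I n"
proof (induction n)
  case 0 then show ?case using assms by (auto intro: subring_intros)
next
  case (Suc n)
  have "x ^ n * x \<in> ideal_pow A I (Suc n)" unfolding ideal_pow_Suc_iprod
    by (rule iprodI) (use assms Suc in auto)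
  then show ?case by (simp add: mult.commute)
qed

section \<open>Noetherian induction and stationary chains\<close>

lemma noeth_subring: "noetherian A \<Longrightarrow> subring A" by (simp add: noetherian_def)

text \<open>Otherwise repeated enlargement gives a strictly increasing sequence, yet the finitely
  many generators of its union all lie in one term.\<close>

lemma noeth_max:
  assumes A: "noetherian A" and I: "\<And>I. I \<in> \<I> \<Longrightarrow> sr_ideal A I" and ne: "\<I> \<noteq> {}"
  shows "\<exists>M\<in>\<I>. \<forall>I\<in>\<I>. M \<subseteq> I \<longrightarrow> I = M"
proof (rule ccontr)
  assume "\<not> ?thesis"
  then have "\<forall>M\<in>\<I>. \<exists>I\<in>\<I>. M \<subset> I" by blast
  then obtain g where g: "\<And>M. M \<in> \<I> \<Longrightarrow> g M \<in> \<I> \<and> M \<subset> g M" by metis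
  obtain M0 where M0: "M0 \<in> \<I>" using ne by auto
  define f where "f n = (g ^^ n) M0" for n
  have f: "f n \<in> \<I>" for n by (induction n) (auto simp: f_def M0 g)
  have fs: "f n \<subset> f (Suc n)" for n using g[OF f[of n]] by (simp add: f_def)
  have mono: "m \<le> n \<Longrightarrow> f m \<subseteq> f n" for m n
    by (rule lift_Suc_mono_le[of f]) (use fs in auto)
  have U: "sr_ideal A (\<Union>n. f n)"
    unfolding sr_ideal_def
  proof (intro conjI ballI)
    show "(\<Union>n. f n) \<subseteq> A" using I[OF f] ideal_memD by blast
    show "0 \<in> (\<Union>n. f n)" using ideal_0[OF I[OF f[of 0]]] by blast
    fix x assume x: "x \<in> (\<Union>n. f n)"
    then obtain m where m: "x \<in> f m" by auto
    { fix y assume "y \<in> (\<Union>n. f n)"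
      then obtain n where n: "y \<in> f n" by auto
      have "x \<in> f (max m n)" "y \<in> f (max m n)" using mono m n by (meson max.cobounded1 max.cobounded2 subsetD)+
      then show "x + y \<in> (\<Union>n. f n)" using ideal_add[OF I[OF f]] by blast }
    { fix a assume "a \<in> A" then show "a * x \<in> (\<Union>n. f n)" using ideal_mult[OF I[OF f]] m by blast }
  qed
  then obtain X where X: "finite X" "X \<subseteq> A" "(\<Union>n. f n) = gen_ideal A X"
    using A unfolding noetherian_def by blast
  have "X \<subseteq> (\<Union>n. f n)" using gen_ideal_incl[OF noeth_subring[OF A]] X by auto
  then have "\<forall>x\<in>X. \<exists>n. x \<in> f n" by auto
  then obtain h where h: "\<And>x. x \<in> X \<Longrightarrow> x \<in> f (h x)" by metis
  define N where "N = Max (insert 0 (h ` X))"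
  have "X \<subseteq> f N"
  proof
    fix x assume "x \<in> X"
    then have "h x \<le> N" unfolding N_def using X(1) by (intro Max_ge) auto
    then show "x \<in> f N" using mono h[OF \<open>x \<in> X\<close>] by blast
  qed
  then have "(\<Union>n. f n) \<subseteq> f N" unfolding X(3) by (rule gen_ideal_least[OF I[OF f]])
  then show False using fs[of N] by blast
qed

lemma noeth_induct:
  assumes A: "noetherian A" and J: "sr_ideal A J"
    and step: "\<And>K. sr_ideal A K \<Longrightarrow> (\<And>K'. sr_ideal A K' \<Longrightarrow> K \<subset> K' \<Longrightarrow> P K') \<Longrightarrow> P K"
  shows "P J"
proof (rule ccontr)
  assume "\<not> P J"
  then have "{I. sr_ideal A I \<and> \<not> P I} \<noteq> {}" using J by auto
  from noeth_max[OF A _ this] obtain M where M: "sr_ideal A M" "\<not> P M"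
    "\<forall>I. sr_ideal A I \<and> \<not> P I \<longrightarrow> M \<subseteq> I \<longrightarrow> I = M" by auto
  show False using step[OF M(1)] M by blast
qed

lemma noeth_chain:
  assumes A: "noetherian A" and I: "\<And>n. sr_ideal A (f n)" and m: "\<And>n. f n \<subseteq> f (Suc n)"
  shows "\<exists>N. \<forall>n\<ge>N. f n = f N"
proof -
  from noeth_max[OF A, of "range f"] I obtain N where N: "\<And>n. f N \<subseteq> f n \<Longrightarrow> f n = f N" by auto
  show ?thesis using N lift_Suc_mono_le[of f, OF m] by blast
qed

lemma noeth_fg: "noetherian A \<Longrightarrow> sr_ideal A I \<Longrightarrow> \<exists>X. finite X \<and> X \<subseteq> A \<and> I = gen_ideal A X"
  by (auto simp: noetherian_def)

section \<open>Prime ideals and minimal primes\<close>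

lemma prime_ideal: "sr_prime A P \<Longrightarrow> sr_ideal A P" by (simp add: sr_prime_def)
lemma primeD: "sr_prime A P \<Longrightarrow> a \<in> A \<Longrightarrow> b \<in> A \<Longrightarrow> a * b \<in> P \<Longrightarrow> a \<in> P \<or> b \<in> P"
  by (simp add: sr_prime_def)
lemma prime_one: "sr_prime A P \<Longrightarrow> 1 \<notin> P" using ideal_one by (auto simp: sr_prime_def)
lemma prime_powD: "subring A \<Longrightarrow> sr_prime A P \<Longrightarrow> a \<in> A \<Longrightarrow> a ^ n \<in> P \<Longrightarrow> a \<in> P"
proof (induction n)
  case 0 then show ?case using prime_one by auto
next
  case (Suc n) then show ?case using primeD[of A P a "a^n"] by (auto intro: subring_intros)
qed
lemma primeI: "subring A \<Longrightarrow> sr_ideal A P \<Longrightarrow> 1 \<notin> P \<Longrightarrow>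
  (\<And>a b. a \<in> A \<Longrightarrow> b \<in> A \<Longrightarrow> a * b \<in> P \<Longrightarrow> a \<in> P \<or> b \<in> P) \<Longrightarrow> sr_prime A P"
  by (auto simp: sr_prime_def intro: subring_intros)
lemma prime_mult_notin: "sr_prime A P \<Longrightarrow> a \<in> A - P \<Longrightarrow> b \<in> A - P \<Longrightarrow> subring A \<Longrightarrow> a * b \<in> A - P"
  using primeD by (auto intro: subring_intros)

text \<open>An ideal maximal among those that contain \<open>K\<close> and no power of
  \<open>u\<close> is prime: if \<open>a\<close> and \<open>b\<close> are outside it, both enlarged
  ideals contain powers of \<open>u\<close>, and with \<open>a * b\<close> inside, the product of
  these powers falls into the ideal.\<close>

lemma prime_avoiding:
  assumes A: "noetherian A" and K: "sr_ideal A K" and u: "u \<in> A" "\<And>n. u ^ n \<notin> K"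
  shows "\<exists>P. sr_prime A P \<and> K \<subseteq> P \<and> u \<notin> P"
proof -
  note sA = noeth_subring[OF A]
  define \<I> where "\<I> = {I. sr_ideal A I \<and> K \<subseteq> I \<and> (\<forall>n. u ^ n \<notin> I)}"
  have "\<I> \<noteq> {}" using K u by (auto simp: \<I>_def)
  from noeth_max[OF A _ this] obtain M where M: "sr_ideal A M" "K \<subseteq> M" "\<And>n. u ^ n \<notin> M"
    and max: "\<And>I. I \<in> \<I> \<Longrightarrow> M \<subseteq> I \<Longrightarrow> I = M" by (auto simp: \<I>_def)
  have big: "\<exists>n. \<exists>i\<in>M. \<exists>s\<in>A. u ^ n = i + a * s" if a: "a \<in> A" "a \<notin> M" for a
  proof (rule ccontr)
    assume no: "\<not> ?thesis"
    have id: "sr_ideal A (isum M (prin A a))" by (intro ideal_isum sA M ideal_prin a)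
    have "isum M (prin A a) \<in> \<I>" unfolding \<I>_def
      using id M isum_left[OF ideal_0[OF ideal_prin[OF sA a(1)]], of M] no isum_prinD[of _ M A a] by blast
    then have "isum M (prin A a) = M" using max isum_left[OF ideal_0[OF ideal_prin[OF sA a(1)]], of M] by blast
    then show False using a isum_right[OF ideal_0[OF M(1)], of "prin A a"] prin_self[OF sA, of a] by blast
  qed
  have "sr_prime A M"
  proof (rule primeI[OF sA M(1)])
    show "1 \<notin> M" using M(3)[of 0] by simp
    fix a b assume ab: "a \<in> A" "b \<in> A" "a * b \<in> M"
    show "a \<in> M \<or> b \<in> M"
    proof (rule ccontr)
      assume "\<not> ?thesis"
      then obtain n i s m j t where n: "u ^ n = i + a * s" "i \<in> M" "s \<in> A" and m: "u ^ m = j + b * t" "j \<in> M" "t \<in> A"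
        using big ab by meson
      have "u ^ (n + m) = i * (j + b * t) + (a * s) * j + (a * b) * (s * t)"
        unfolding power_add n m by (simp add: algebra_simps)
      also have "\<dots> \<in> M" by (intro ideal_add[OF M(1)] ideal_multr[OF M(1)] ideal_mult[OF M(1)] subring_intros sA n m ab ideal_memD[OF M(1)])
      finally show False using M(3) by blast
    qed
  qed
  then show ?thesis using M(2) M(3)[of 1] by auto
qed

text \<open>Noetherian induction on \<open>K\<close>: if \<open>a * b\<close> lies in
  \<open>K\<close> but neither factor does, a prime above \<open>K\<close> lies above
  \<open>K + aA\<close> or \<open>K + bA\<close>, so the finite sets found for these two larger
  ideals together serve \<open>K\<close>.\<close>

lemma finite_minimal_primes:
  assumes A: "noetherian A" and K: "sr_ideal A K"
  shows "\<exists>\<P>. finite \<P> \<and> (\<forall>p\<in>\<P>. sr_prime A p \<and> K \<subseteq> p) \<and> (\<forall>Q. sr_prime A Q \<and> K \<subseteq> Q \<longrightarrow> (\<exists>p\<in>\<P>. p \<subseteq> Q))"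
proof (induction rule: noeth_induct[OF A K])
  case (1 K)
  note sA = noeth_subring[OF A]
  show ?case
  proof (cases "sr_prime A K \<or> 1 \<in> K")
    case True
    then show ?thesis
    proof
      assume "sr_prime A K" then show ?thesis by (intro exI[of _ "{K}"]) auto
    next
      assume "1 \<in> K" then show ?thesis using prime_one by (intro exI[of _ "{}"]) auto
    qed
  next
    case False
    then obtain a b where ab: "a \<in> A" "b \<in> A" "a * b \<in> K" "a \<notin> K" "b \<notin> K"
      using primeI[OF sA 1(1)] by metis
    have g: "\<exists>\<P>. finite \<P> \<and> (\<forall>p\<in>\<P>. sr_prime A p \<and> K \<subseteq> p) \<and> (\<forall>Q. sr_prime A Q \<and> K \<subseteq> Q \<and> a \<in> Q \<longrightarrow> (\<exists>p\<in>\<P>. p \<subseteq> Q))"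
      if a: "a \<in> A" "a \<notin> K" for a
    proof -
      have id: "sr_ideal A (isum K (prin A a))" by (intro ideal_isum sA 1 ideal_prin a)
      have sub: "K \<subseteq> isum K (prin A a)" by (rule isum_left) (rule ideal_0[OF ideal_prin[OF sA a(1)]])
      have "a \<in> isum K (prin A a)" using isum_right[OF ideal_0[OF 1(1)], of "prin A a"] prin_self[OF sA, of a] by blast
      then have "K \<subset> isum K (prin A a)" using sub a by blast
      from 1(2)[OF id this] obtain \<P> where P: "finite \<P>" "\<And>p. p\<in>\<P> \<Longrightarrow> sr_prime A p \<and> isum K (prin A a) \<subseteq> p"
        "\<And>Q. sr_prime A Q \<Longrightarrow> isum K (prin A a) \<subseteq> Q \<Longrightarrow> (\<exists>p\<in>\<P>. p \<subseteq> Q)" by (elim exE conjE) metis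
      have "isum K (prin A a) \<subseteq> Q" if "sr_prime A Q" "K \<subseteq> Q" "a \<in> Q" for Q
        by (rule isum_least[OF prime_ideal[OF that(1)] that(2) prin_least[OF prime_ideal[OF that(1)] that(3)]])
      then have "\<forall>Q. sr_prime A Q \<and> K \<subseteq> Q \<and> a \<in> Q \<longrightarrow> (\<exists>p\<in>\<P>. p \<subseteq> Q)" using P(3) by simp
      moreover have "\<forall>p\<in>\<P>. sr_prime A p \<and> K \<subseteq> p" using P(2) sub by blast
      ultimately show ?thesis using P(1) by (intro exI[of _ \<P>] conjI)
    qed
    obtain \<P>1 where 1: "finite \<P>1" "\<forall>p\<in>\<P>1. sr_prime A p \<and> K \<subseteq> p" "\<forall>Q. sr_prime A Q \<and> K \<subseteq> Q \<and> a \<in> Q \<longrightarrow> (\<exists>p\<in>\<P>1. p \<subseteq> Q)"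
      using g[OF ab(1,4)] by blast
    obtain \<P>2 where 2: "finite \<P>2" "\<forall>p\<in>\<P>2. sr_prime A p \<and> K \<subseteq> p" "\<forall>Q. sr_prime A Q \<and> K \<subseteq> Q \<and> b \<in> Q \<longrightarrow> (\<exists>p\<in>\<P>2. p \<subseteq> Q)"
      using g[OF ab(2,5)] by blast
    have "\<exists>p\<in>\<P>1 \<union> \<P>2. p \<subseteq> Q" if Q: "sr_prime A Q" "K \<subseteq> Q" for Q
    proof -
      have "a \<in> Q \<or> b \<in> Q" using primeD[OF Q(1) ab(1,2)] ab(3) Q by auto
      then show ?thesis using 1(3) 2(3) Q by (metis UnI1 UnI2)
    qed
    then show ?thesis using 1(1,2) 2(1,2) by (intro exI[of _ "\<P>1 \<union> \<P>2"]) auto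
  qed
qed

lemma minimal_primes:
  assumes A: "noetherian A" and K: "sr_ideal A K"
  obtains \<P> where "finite \<P>" "\<And>p. p \<in> \<P> \<Longrightarrow> sr_prime A p \<and> K \<subseteq> p"
    "\<And>Q. sr_prime A Q \<Longrightarrow> K \<subseteq> Q \<Longrightarrow> \<exists>p\<in>\<P>. p \<subseteq> Q"
    "\<And>p Q. p \<in> \<P> \<Longrightarrow> sr_prime A Q \<Longrightarrow> K \<subseteq> Q \<Longrightarrow> Q \<subseteq> p \<Longrightarrow> Q = p"
proof -
  obtain \<P> where P: "finite \<P>" "\<And>p. p \<in> \<P> \<Longrightarrow> sr_prime A p \<and> K \<subseteq> p"
    "\<And>Q. sr_prime A Q \<Longrightarrow> K \<subseteq> Q \<Longrightarrow> \<exists>p\<in>\<P>. p \<subseteq> Q"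
    using finite_minimal_primes[OF A K] by (elim exE conjE) metis
  define \<M> where "\<M> = {p \<in> \<P>. \<forall>p'\<in>\<P>. p' \<subseteq> p \<longrightarrow> p' = p}"
  have below: "\<exists>p\<in>\<M>. p \<subseteq> q" if q: "q \<in> \<P>" for q
  proof -
    obtain p where "p \<in> \<P>" "p \<subseteq> q" "\<forall>r\<in>\<P>. r \<subseteq> p \<longrightarrow> p = r"
      using finite_has_minimal2[OF P(1) q] by metis
    then show ?thesis unfolding \<M>_def by auto
  qed
  show ?thesis
  proof (rule that[of \<M>])
    show "finite \<M>" using P(1) by (simp add: \<M>_def)
    show "sr_prime A p \<and> K \<subseteq> p" if "p \<in> \<M>" for p using that P(2) by (simp add: \<M>_def)
    show ex: "\<exists>p\<in>\<M>. p \<subseteq> Q" if "sr_prime A Q" "K \<subseteq> Q" for Q using P(3)[OF that] below by (meson subset_trans)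
    show "Q = p" if pQ: "p \<in> \<M>" "sr_prime A Q" "K \<subseteq> Q" "Q \<subseteq> p" for p Q
    proof -
      obtain p' where p': "p' \<in> \<M>" "p' \<subseteq> Q" using ex[OF pQ(2,3)] by auto
      have "p' \<subseteq> p" using p'(2) pQ(4) by (rule subset_trans)
      moreover have "p' \<in> \<P>" using p'(1) unfolding \<M>_def by simp
      ultimately have "p' = p" using pQ(1) unfolding \<M>_def by simp
      then show ?thesis using p'(2) pQ(4) by (simp add: subset_antisym)
    qed
  qed
qed

section \<open>Local rings\<close>

lemma local_subring: "local_ring A \<Longrightarrow> subring A" by (simp add: local_ring_def)
lemma local_max: "local_ring A \<Longrightarrow> sr_ideal A (max_ideal A)" by (simp add: local_ring_def)
lemma max_sub: "a \<in> max_ideal A \<Longrightarrow> a \<in> A" by (simp add: max_ideal_def)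
lemma nonmax_unit: "a \<in> A \<Longrightarrow> a \<notin> max_ideal A \<Longrightarrow> a \<noteq> 0 \<and> inverse a \<in> A" by (auto simp: max_ideal_def)
lemma one_notin_max: "subring A \<Longrightarrow> 1 \<notin> max_ideal A" by (auto simp: max_ideal_def subring_1)
lemma max_prime: assumes "local_ring A" shows "sr_prime A (max_ideal A)"
proof (rule primeI[OF local_subring[OF assms] local_max[OF assms] one_notin_max[OF local_subring[OF assms]]])
  fix a b assume ab: "a \<in> A" "b \<in> A" "a * b \<in> max_ideal A"
  show "a \<in> max_ideal A \<or> b \<in> max_ideal A"
  proof (rule ccontr)
    assume "\<not> ?thesis"
    then have "a \<noteq> 0" "inverse a \<in> A" "b \<notin> max_ideal A" using nonmax_unit ab by auto
    then have "inverse a * (a * b) \<in> max_ideal A" using ideal_mult[OF local_max[OF assms]] ab by blast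
    then show False using \<open>a \<noteq> 0\<close> \<open>b \<notin> _\<close> by (simp add: field_simps)
  qed
qed
lemma proper_sub_max: assumes "sr_ideal A I" "1 \<notin> I" shows "I \<subseteq> max_ideal A"
proof
  fix a assume a: "a \<in> I"
  show "a \<in> max_ideal A"
  proof (rule ccontr)
    assume "a \<notin> max_ideal A"
    then have "a \<noteq> 0" "inverse a \<in> A" using nonmax_unit ideal_memD[OF assms(1) a] by auto
    then show False using ideal_mult[OF assms(1) \<open>inverse a \<in> A\<close> a] assms(2) by simp
  qed
qed
lemma prime_sub_max: "sr_prime A P \<Longrightarrow> P \<subseteq> max_ideal A"
  using proper_sub_max prime_ideal prime_one by blast
lemma one_minus_unit: assumes "local_ring A" "a \<in> max_ideal A" shows "1 - a \<noteq> 0" "inverse (1 - a) \<in> A"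
proof -
  have "1 - a \<notin> max_ideal A"
  proof
    assume "1 - a \<in> max_ideal A"
    then have "1 - a + a \<in> max_ideal A" using ideal_add[OF local_max[OF assms(1)]] assms(2) by blast
    then show False using one_notin_max[OF local_subring[OF assms(1)]] by simp
  qed
  moreover have "1 - a \<in> A" using local_subring[OF assms(1)] max_sub[OF assms(2)] by (intro subring_intros)
  ultimately show "1 - a \<noteq> 0" "inverse (1 - a) \<in> A" using nonmax_unit[of "1 - a" A] by auto
qed

text \<open>The generators are discarded one at a time.\<close>
lemma nakayama_gen:
  assumes A: "local_ring A" and N: "sr_ideal A N" and M: "sr_ideal A M"
    and MN: "M \<subseteq> isum N (iprod A (max_ideal A) M)"
    and Y: "finite Y" "Y \<subseteq> M" "M \<subseteq> isum N (gen_ideal A Y)"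
  shows "M \<subseteq> N"
  using Y
proof (induction Y rule: finite_induct)
  case empty
  then show ?case using ideal_0[OF N] by (auto simp: isum_def gen_ideal_empty)
next
  case (insert z Y)
  let ?m = "max_ideal A"
  note sA = local_subring[OF A]
  have MA: "M \<subseteq> A" using ideal_memD[OF M] by auto
  have zA: "z \<in> A" and YA: "Y \<subseteq> A" using insert.prems MA by auto
  define H where "H = isum N (gen_ideal A Y)"
  have H: "sr_ideal A H" unfolding H_def by (intro ideal_isum sA N ideal_gen YA)
  have NH: "N \<subseteq> H" unfolding H_def by (rule isum_left[OF ideal_0[OF ideal_gen[OF sA YA]]])
  have MH: "M \<subseteq> isum H (prin A z)"
  proof
    fix f assume "f \<in> M"
    then obtain n g where 1: "f = n + g" "n \<in> N" "g \<in> gen_ideal A (insert z Y)"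
      using insert.prems(2) by (auto simp: isum_def)
    then obtain h s where 2: "g = h + z * s" "h \<in> gen_ideal A Y" "s \<in> A"
      using gen_ideal_insert[OF sA zA YA] isum_prinD[of g] by blast
    have "f = (n + h) + z * s" using 1 2 by simp
    moreover have "n + h \<in> H" unfolding H_def by (rule isumI[OF 1(2) 2(2)])
    ultimately show "f \<in> isum H (prin A z)" using isum_prinI[of "n + h" H s A z] 2 by auto
  qed
  \<comment> \<open>\<open>?K\<close> collects the elements whose coefficient at \<open>z\<close>
    modulo \<open>H\<close> can be taken in the maximal ideal. It contains the product of that ideal
    with \<open>M\<close>, which leads to \<open>z * (1 - \<mu>) \<in> H\<close> with
    \<open>1 - \<mu>\<close> a unit.\<close>
  have K: "sr_ideal A {f \<in> A. \<exists>h\<in>H. \<exists>\<mu>\<in>?m. f = h + z * \<mu>}" (is "sr_ideal A ?K")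
    unfolding sr_ideal_def
  proof (intro conjI ballI)
    show "0 \<in> ?K" using ideal_0[OF H] ideal_0[OF local_max[OF A]] subring_0[OF sA] by force
    fix x assume "x \<in> ?K"
    then obtain h \<mu> where 1: "x \<in> A" "h \<in> H" "\<mu> \<in> ?m" "x = h + z * \<mu>" by blast
    { fix y assume "y \<in> ?K"
      then obtain h' \<mu>' where 2: "y \<in> A" "h' \<in> H" "\<mu>' \<in> ?m" "y = h' + z * \<mu>'" by blast
      have "x + y = (h + h') + z * (\<mu> + \<mu>')" using 1 2 by (simp add: algebra_simps)
      moreover have "h + h' \<in> H" "\<mu> + \<mu>' \<in> ?m" "x + y \<in> A" using 1 2 by (auto intro: ideal_add[OF H] ideal_add[OF local_max[OF A]] subring_intros sA)
      ultimately show "x + y \<in> ?K" by blast }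
    { fix a assume a: "a \<in> A"
      have "a * x = a * h + z * (a * \<mu>)" using 1 by (simp add: algebra_simps)
      moreover have "a * h \<in> H" "a * \<mu> \<in> ?m" "a * x \<in> A" using 1 a by (auto intro: ideal_mult[OF H] ideal_mult[OF local_max[OF A]] subring_mult[OF sA])
      ultimately show "a * x \<in> ?K" by blast }
  qed auto
  have "iprod A ?m M \<subseteq> ?K"
  proof (rule iprod_least[OF K])
    fix \<mu> f assume mf: "\<mu> \<in> ?m" "f \<in> M"
    then obtain h s where hs: "f = h + z * s" "h \<in> H" "s \<in> A" using MH isum_prinD[of f] by blast
    have "\<mu> * f = \<mu> * h + z * (\<mu> * s)" using hs by (simp add: algebra_simps)
    moreover have "\<mu> * h \<in> H" "\<mu> * s \<in> ?m" "\<mu> * f \<in> A"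
      using hs mf MA by (auto intro!: ideal_mult[OF H] ideal_multr[OF local_max[OF A]] subring_mult[OF sA] dest: max_sub)
    ultimately show "\<mu> * f \<in> ?K" by blast
  qed
  moreover have "z \<in> isum N (iprod A ?m M)" using insert.prems(1) MN by blast
  moreover obtain n k where "z = n + k" "n \<in> N" "k \<in> iprod A ?m M" using calculation(2) unfolding isum_def by blast
  ultimately obtain h \<mu> where zh: "z = (n + h) + z * \<mu>" "n \<in> N" "h \<in> H" "\<mu> \<in> ?m" by (smt (verit) add.assoc mem_Collect_eq subset_iff)
  have "z * (1 - \<mu>) = n + h" using zh(1) by (simp add: algebra_simps)
  then have "z = inverse (1 - \<mu>) * (n + h)" using one_minus_unit[OF A zh(4)] by (simp add: field_simps)
  then have zH: "z \<in> H" using ideal_mult[OF H one_minus_unit(2)[OF A zh(4)], of "n + h"] ideal_add[OF H, of n h] zh NH by auto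
  have "isum H (prin A z) \<subseteq> H" by (rule isum_least[OF H subset_refl prin_least[OF H zH]])
  then show ?case using insert.IH insert.prems(1) MH unfolding H_def by auto
qed

lemma nakayama:
  assumes A: "local_ring A" "noetherian A" and N: "sr_ideal A N" and M: "sr_ideal A M"
    and MN: "M \<subseteq> isum N (iprod A (max_ideal A) M)"
  shows "M \<subseteq> N"
proof -
  obtain X where X: "finite X" "M = gen_ideal A X" using noeth_fg[OF A(2) M] by blast
  have "X \<subseteq> M" using gen_ideal_incl[OF local_subring[OF A(1)]] X by blast
  moreover have "M \<subseteq> isum N (gen_ideal A X)" using isum_right[OF ideal_0[OF N]] X by blast
  ultimately show ?thesis using nakayama_gen[OF A(1) N M MN X(1)] by blast
qed

lemma nakayama_prin:
  assumes A: "local_ring A" "noetherian A" and N: "sr_ideal A N" and M: "sr_ideal A M"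
    and a: "a \<in> max_ideal A" and MN: "\<And>f. f \<in> M \<Longrightarrow> \<exists>n\<in>N. \<exists>g\<in>M. f = n + a * g"
  shows "M \<subseteq> N"
proof (rule nakayama[OF A N M], rule subsetI)
  fix f assume "f \<in> M"
  then obtain n g where "n \<in> N" "g \<in> M" "f = n + a * g" using MN by blast
  then show "f \<in> isum N (iprod A (max_ideal A) M)"
    using isumI[of n N "a * g"] iprodI[OF local_subring[OF A(1)] a, of g M] by auto
qed

text \<open>Noetherian induction on \<open>K\<close>. The last power \<open>z\<close> of some
  \<open>w\<close> outside \<open>K\<close> satisfies \<open>z * z \<in> K\<close>, so both
  \<open>K + zA\<close> and the colon ideal of \<open>z\<close> are strictly larger than
  \<open>K\<close>, while their product lies in \<open>K\<close>. The exponents found for the two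
  add up.\<close>

lemma max_pow_sub_primary:
  assumes A: "local_ring A" "noetherian A" and K: "sr_ideal A K"
    and prim: "\<And>u. u \<in> max_ideal A \<Longrightarrow> \<exists>k. u ^ k \<in> K"
  shows "\<exists>N. ideal_pow A (max_ideal A) N \<subseteq> K"
  using prim
proof (induction rule: noeth_induct[OF A(2) K])
  case (1 K)
  note sA = local_subring[OF A(1)] and im = local_max[OF A(1)]
  note K = 1(1)
  show ?case
  proof (cases "max_ideal A \<subseteq> K")
    case True
    then show ?thesis using ideal_pow_1[OF sA im] by (intro exI[of _ "Suc 0"]) auto
  next
    case False
    then obtain w where w: "w \<in> max_ideal A" "w \<notin> K" by auto
    define k where "k = (LEAST k. w ^ k \<in> K)"
    have k: "w ^ k \<in> K" unfolding k_def using LeastI_ex[OF 1(3)[OF w(1)]] .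
    show ?thesis
    proof (cases "1 \<in> K")
      case True then have "K = A" by (rule ideal_one[OF K])
      then show ?thesis by (intro exI[of _ 0]) auto
    next
      case False
      have k2: "k \<ge> 2" using k w False by (cases k; cases "k - 1") (auto simp: numeral_2_eq_2)
      define z where "z = w ^ (k - 1)"
      have z: "z \<notin> K" unfolding z_def using not_less_Least[of "k - 1" "\<lambda>k. w ^ k \<in> K"] k2 by (simp add: k_def)
      have zm: "z \<in> max_ideal A" unfolding z_def using ideal_power[OF sA im w(1)] k2 by auto
      have zA: "z \<in> A" using zm max_sub by auto
      have "z * z = w ^ k * w ^ (k - 2)" unfolding z_def power_add[symmetric] using k2 by (auto intro!: arg_cong[of _ _ "power w"])
      then have zz: "z * z \<in> K" using ideal_multr[OF K _ k] subring_power[OF sA max_sub[OF w(1)]] by auto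
      have id1: "sr_ideal A (isum K (prin A z))" by (intro ideal_isum sA K ideal_prin zA)
      have sub_1: "K \<subseteq> isum K (prin A z)" by (rule isum_left[OF ideal_0[OF ideal_prin[OF sA zA]]])
      have "z \<in> isum K (prin A z)" using isum_right[OF ideal_0[OF K], of "prin A z"] prin_self[OF sA, of z] by blast
      then have "K \<subset> isum K (prin A z)" using sub_1 z by blast
      from 1(2)[OF id1 this] sub_1 1(3) obtain N where N: "ideal_pow A (max_ideal A) N \<subseteq> isum K (prin A z)" by blast
      have id2: "sr_ideal A (colon A K z)" by (rule ideal_colon[OF sA K zA])
      have sub2: "K \<subseteq> colon A K z" using ideal_memD[OF K] ideal_multr[OF K zA] by (auto simp: colon_def)
      have "z \<in> colon A K z" using zz zA by (simp add: colon_def)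
      then have "K \<subset> colon A K z" using sub2 z by blast
      from 1(2)[OF id2 this] sub2 1(3) obtain M where M: "ideal_pow A (max_ideal A) M \<subseteq> colon A K z" by blast
      have "ideal_pow A (max_ideal A) (N + M) \<subseteq> K"
        using M
      proof (induction M)
        case 0
        then have "1 \<in> colon A K z" using subring_1[OF sA] by auto
        then show ?case using z by (simp add: colon_def)
      next
        case (Suc M)
        have key: "f * g \<in> K" if f: "f \<in> ideal_pow A (max_ideal A) N" and g: "g \<in> colon A K z" for f g
        proof -
          obtain i s where ik: "f = i + z * s" "i \<in> K" "s \<in> A" using N f isum_prinD[of f] by blast
          have "f * g = i * g + (g * z) * s" using ik by (simp add: algebra_simps)
          then show ?thesis using g ik by (auto simp: colon_def intro!: ideal_add[OF K] ideal_multr[OF K])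
        qed
        \<comment> \<open>The inclusion converse to \<open>ideal_pow_mult\<close>. Powers grow by
          single factors, so it takes its own induction.\<close>
        have split: "ideal_pow A (max_ideal A) (N + n) \<subseteq> iprod A (ideal_pow A (max_ideal A) N) (ideal_pow A (max_ideal A) n)" for n
        proof (induction n)
          case 0
          show ?case using iprodI[OF sA _ subring_1[OF sA], of _ "ideal_pow A (max_ideal A) N"] by auto
        next
          case (Suc n)
          have "ideal_pow A (max_ideal A) (Suc (N + n)) \<subseteq> iprod A (ideal_pow A (max_ideal A) N) (ideal_pow A (max_ideal A) (Suc n))"
            unfolding ideal_pow_Suc_iprod[of _ _ "N + n"]
          proof (rule iprod_least)
            show id: "sr_ideal A (iprod A (ideal_pow A (max_ideal A) N) (ideal_pow A (max_ideal A) (Suc n)))"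
              by (intro ideal_iprod ideal_ideal_pow sA im)
            fix f g assume f: "f \<in> ideal_pow A (max_ideal A) (N + n)" and g: "g \<in> max_ideal A"
            have "iprod A (ideal_pow A (max_ideal A) N) (ideal_pow A (max_ideal A) n) \<subseteq>
               colon A (iprod A (ideal_pow A (max_ideal A) N) (ideal_pow A (max_ideal A) (Suc n))) g"
            proof (rule iprod_least[OF ideal_colon[OF sA id max_sub[OF g]]])
              fix a b assume a: "a \<in> ideal_pow A (max_ideal A) N" and b: "b \<in> ideal_pow A (max_ideal A) n"
              have "b * g \<in> ideal_pow A (max_ideal A) (Suc n)" unfolding ideal_pow_Suc_iprod by (rule iprodI[OF sA b g])
              then have "a * (b * g) \<in> iprod A (ideal_pow A (max_ideal A) N) (ideal_pow A (max_ideal A) (Suc n))" by (rule iprodI[OF sA a])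
              moreover have "a * b \<in> A" using a b ideal_memD[OF ideal_ideal_pow[OF sA im]] subring_mult[OF sA] by blast
              ultimately show "a * b \<in> colon A (iprod A (ideal_pow A (max_ideal A) N) (ideal_pow A (max_ideal A) (Suc n))) g"
                by (simp add: colon_def mult.assoc)
            qed
            then show "f * g \<in> iprod A (ideal_pow A (max_ideal A) N) (ideal_pow A (max_ideal A) (Suc n))"
              using Suc f by (auto simp: colon_def)
          qed
          then show ?case by simp
        qed
        have "iprod A (ideal_pow A (max_ideal A) N) (ideal_pow A (max_ideal A) (Suc M)) \<subseteq> K"
          by (rule iprod_least[OF K]) (use key Suc.prems in auto)
        then show ?case using split[of "Suc M"] by blast
      qed
      then show ?thesis by blast
    qed
  qed
qed

text \<open>Take \<open>K\<close> maximal among the ideals that contain the product \<open>H\<close>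
  of the maximal ideal with the intersection \<open>I\<close> and meet \<open>I\<close> only inside
  \<open>H\<close>. Such a \<open>K\<close> contains a power of the maximal ideal, hence
  \<open>I\<close>, so \<open>I \<subseteq> H\<close> and Nakayama gives
  \<open>I = {0}\<close>.\<close>

lemma krull_intersection:
  assumes A: "local_ring A" "noetherian A" and a: "\<And>n. a \<in> ideal_pow A (max_ideal A) n"
  shows "a = 0"
proof -
  let ?m = "max_ideal A"
  note sA = local_subring[OF A(1)] and im = local_max[OF A(1)]
  define I where "I = (\<Inter>n. ideal_pow A ?m n)"
  have I: "sr_ideal A I" unfolding I_def sr_ideal_def
    using ideal_ideal_pow[OF sA im] by (auto simp: sr_ideal_def) blast
  define H where "H = iprod A ?m I"
  have H: "sr_ideal A H" unfolding H_def by (intro ideal_iprod sA im I)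
  define \<K> where "\<K> = {K. sr_ideal A K \<and> H \<subseteq> K \<and> K \<inter> I \<subseteq> H}"
  have "\<K> \<noteq> {}" using H by (auto simp: \<K>_def)
  from noeth_max[OF A(2) _ this] obtain K where K: "sr_ideal A K" "H \<subseteq> K" "K \<inter> I \<subseteq> H"
    and max: "\<And>K'. sr_ideal A K' \<Longrightarrow> H \<subseteq> K' \<Longrightarrow> K' \<inter> I \<subseteq> H \<Longrightarrow> K \<subseteq> K' \<Longrightarrow> K' = K" by (auto simp: \<K>_def)
  have "\<exists>k. u ^ k \<in> K" if u: "u \<in> ?m" for u
  proof -
    have uA: "u ^ k \<in> A" for k using subring_power[OF sA max_sub[OF u]] .
    \<comment> \<open>The colon ideals of the powers of \<open>u\<close> become stationary. For
      \<open>k\<close> past that point, elements of \<open>I\<close> in \<open>K + u ^ k A\<close>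
      already lie in \<open>K\<close>, so maximality of \<open>K\<close> puts \<open>u ^ k\<close>
      into it.\<close>
    have "\<exists>N. \<forall>n\<ge>N. colon A K (u ^ n) = colon A K (u ^ N)"
    proof (rule noeth_chain[OF A(2) ideal_colon[OF sA K(1) uA]])
      show "colon A K (u ^ n) \<subseteq> colon A K (u ^ Suc n)" for n
        using ideal_mult[OF K(1) max_sub[OF u]] by (auto simp: colon_def mult.left_commute[of _ u])
    qed
    then obtain k where k: "colon A K (u ^ Suc k) = colon A K (u ^ k)" by (meson le_SucI order_refl)
    have pr: "sr_ideal A (prin A (u ^ k))" by (rule ideal_prin[OF sA uA])
    have "isum K (prin A (u ^ k)) = K"
    proof (rule max)
      show "sr_ideal A (isum K (prin A (u ^ k)))" by (intro ideal_isum sA K pr)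
      show s: "K \<subseteq> isum K (prin A (u ^ k))" by (rule isum_left[OF ideal_0[OF pr]])
      show "H \<subseteq> isum K (prin A (u ^ k))" using s K by blast
      show "isum K (prin A (u ^ k)) \<inter> I \<subseteq> H"
      proof
        fix z assume z: "z \<in> isum K (prin A (u ^ k)) \<inter> I"
        then obtain \<kappa> c where c: "z = \<kappa> + u ^ k * c" "\<kappa> \<in> K" "c \<in> A" using isum_prinD[of z] by blast
        have "u * z \<in> H" unfolding H_def using iprodI[OF sA u] z by blast
        then have "u * z - u * \<kappa> \<in> K" using K ideal_mult[OF K(1) max_sub[OF u] c(2)] ideal_diff[OF sA K(1)] by blast
        moreover have "u * z - u * \<kappa> = c * u ^ Suc k" using c by (simp add: algebra_simps)
        ultimately have "c \<in> colon A K (u ^ Suc k)" using c by (simp add: colon_def)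
        then have "c * u ^ k \<in> K" unfolding k by (simp add: colon_def)
        then have "z \<in> K" using c ideal_add[OF K(1), of \<kappa> "c * u ^ k"] by (simp add: mult.commute)
        then show "z \<in> H" using z K by blast
      qed
    qed
    then have "u ^ k \<in> K" using isum_right[OF ideal_0[OF K(1)], of "prin A (u ^ k)"] prin_self[OF sA, of "u ^ k"] by blast
    then show ?thesis by blast
  qed
  from max_pow_sub_primary[OF A K(1) this] obtain N where "ideal_pow A ?m N \<subseteq> K" by blast
  moreover have "I \<subseteq> ideal_pow A ?m N" unfolding I_def by blast
  ultimately have "I \<subseteq> H" using K(3) by blast
  then have "I \<subseteq> isum {0} (iprod A ?m I)" by (auto simp: isum_def H_def)
  then have "I \<subseteq> {0}" by (rule nakayama[OF A ideal_zero[OF sA] I])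
  then show "a = 0" using a by (auto simp: I_def)
qed

section \<open>Localization\<close>

lemma loc_atI: "a \<in> A \<Longrightarrow> b \<in> A \<Longrightarrow> b \<notin> P \<Longrightarrow> a / b \<in> loc_at A P"
  by (auto simp: loc_at_def frac_loc_def)
lemma loc_atE: assumes "z \<in> loc_at A P" obtains a b where "z = a / b" "a \<in> A" "b \<in> A" "b \<notin> P"
  using assms by (auto simp: loc_at_def frac_loc_def)

lemma prime_0: "sr_prime A P \<Longrightarrow> 0 \<in> P" using ideal_0 prime_ideal by blast

lemma loc_incl: "subring A \<Longrightarrow> sr_prime A P \<Longrightarrow> A \<subseteq> loc_at A P"
  using loc_atI[of _ A 1 P] prime_one by (auto intro: subring_intros)

lemma loc_subring: assumes A: "subring A" and P: "sr_prime A P" shows "subring (loc_at A P)"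
  unfolding subring_def
proof (intro conjI ballI)
  show "0 \<in> loc_at A P" "1 \<in> loc_at A P" using loc_incl[OF A P] A by (auto intro: subring_intros)
  fix x y assume "x \<in> loc_at A P" "y \<in> loc_at A P"
  then obtain a b c d where 1: "x = a / b" "a \<in> A" "b \<in> A" "b \<notin> P" "y = c / d" "c \<in> A" "d \<in> A" "d \<notin> P"
    by (metis loc_atE)
  have bd: "b * d \<in> A - P" using prime_mult_notin[OF P] 1 A by blast
  have nz: "b \<noteq> 0" "d \<noteq> 0" using 1 prime_0[OF P] by auto
  have "x + y = (a * d + c * b) / (b * d)" "x - y = (a * d - c * b) / (b * d)" "x * y = (a * c) / (b * d)"
    using nz 1 by (auto simp: field_simps)
  moreover have "a * d + c * b \<in> A" "a * d - c * b \<in> A" "a * c \<in> A" using 1 A by (auto intro!: subring_intros)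
  ultimately show "x + y \<in> loc_at A P" "x - y \<in> loc_at A P" "x * y \<in> loc_at A P" using bd by (auto intro!: loc_atI)
qed

definition ext_loc :: "'a::field set \<Rightarrow> 'a set \<Rightarrow> 'a set \<Rightarrow> 'a set" where
  "ext_loc A P I = {i / b | i b. i \<in> I \<and> b \<in> A \<and> b \<notin> P}"

lemma ideal_ext_loc: assumes A: "subring A" and P: "sr_prime A P" and I: "sr_ideal A I"
  shows "sr_ideal (loc_at A P) (ext_loc A P I)"
  unfolding sr_ideal_def
proof (intro conjI ballI)
  show "ext_loc A P I \<subseteq> loc_at A P" using ideal_memD[OF I] by (auto simp: ext_loc_def intro: loc_atI)
  show "0 \<in> ext_loc A P I" using ideal_0[OF I] subring_1[OF A] prime_one[OF P] by (force simp: ext_loc_def)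
  fix x assume "x \<in> ext_loc A P I"
  then obtain a b where x: "x = a / b" "a \<in> I" "b \<in> A" "b \<notin> P" by (auto simp: ext_loc_def)
  { fix y assume "y \<in> ext_loc A P I"
    then obtain c d where y: "y = c / d" "c \<in> I" "d \<in> A" "d \<notin> P" by (auto simp: ext_loc_def)
    have "b * d \<in> A - P" using prime_mult_notin[OF P] x y A by blast
    moreover have "b \<noteq> 0" "d \<noteq> 0" using x y prime_0[OF P] by auto
    then have "x + y = (d * a + b * c) / (b * d)" using x y by (auto simp: field_simps)
    moreover have "d * a + b * c \<in> I" using x y by (auto intro: ideal_add[OF I] ideal_mult[OF I])
    ultimately show "x + y \<in> ext_loc A P I" using \<open>x + y = _\<close> unfolding ext_loc_def by blast }
  { fix y assume "y \<in> loc_at A P"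
    then obtain c d where y: "y = c / d" "c \<in> A" "d \<in> A" "d \<notin> P" by (rule loc_atE)
    have "b * d \<in> A - P" using prime_mult_notin[OF P] x y A by blast
    moreover have "y * x = (c * a) / (b * d)" using x y by (auto simp: field_simps)
    moreover have "c * a \<in> I" using x y by (auto intro: ideal_mult[OF I])
    ultimately show "y * x \<in> ext_loc A P I" unfolding ext_loc_def by blast }
qed

lemma ext_loc_Int_prime: assumes A: "subring A" and P: "sr_prime A P" and I: "sr_prime A I" "I \<subseteq> P"
  shows "ext_loc A P I \<inter> A = I"
proof
  show "ext_loc A P I \<inter> A \<subseteq> I"
  proof
    fix z assume "z \<in> ext_loc A P I \<inter> A"
    then obtain i b where 1: "z = i / b" "i \<in> I" "b \<in> A" "b \<notin> P" "z \<in> A" by (auto simp: ext_loc_def)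
    then have "z * b \<in> I" using prime_0[OF P] by auto
    then show "z \<in> I" using primeD[OF I(1) 1(5,3)] 1 I by auto
  qed
  show "I \<subseteq> ext_loc A P I \<inter> A" using ideal_memD[OF prime_ideal[OF I(1)]] subring_1[OF A] prime_one[OF P]
    by (force simp: ext_loc_def)
qed

lemma ext_loc_prime: assumes A: "subring A" and P: "sr_prime A P" and I: "sr_prime A I" "I \<subseteq> P"
  shows "sr_prime (loc_at A P) (ext_loc A P I)"
proof (rule primeI[OF loc_subring[OF A P] ideal_ext_loc[OF A P prime_ideal[OF I(1)]]])
  show "1 \<notin> ext_loc A P I" using ext_loc_Int_prime[OF assms] subring_1[OF A] prime_one[OF I(1)] by blast
  fix x y assume "x \<in> loc_at A P" "y \<in> loc_at A P" and xy: "x * y \<in> ext_loc A P I"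
  then obtain a b c d where 1: "x = a / b" "a \<in> A" "b \<in> A" "b \<notin> P" "y = c / d" "c \<in> A" "d \<in> A" "d \<notin> P"
    by (metis loc_atE)
  have "(b * d) * (x * y) \<in> ext_loc A P I"
    using ideal_mult[OF ideal_ext_loc[OF A P prime_ideal[OF I(1)]] _ xy, of "b * d"] loc_incl[OF A P] 1 subring_mult[OF A] by blast
  moreover have "(b * d) * (x * y) = a * c" using 1 prime_0[OF P] by (auto simp: field_simps)
  ultimately have "a * c \<in> I" using ext_loc_Int_prime[OF assms] subring_mult[OF A 1(2,6)] by auto
  then show "x \<in> ext_loc A P I \<or> y \<in> ext_loc A P I" using primeD[OF I(1) 1(2,6)] 1 unfolding ext_loc_def by blast
qed

lemma contract_ideal: assumes A: "subring A" "A \<subseteq> B" and J: "sr_ideal B J" shows "sr_ideal A (J \<inter> A)"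
  using assms by (auto simp: sr_ideal_def intro: subring_intros)

lemma contract_prime: assumes A: "subring A" "A \<subseteq> B" and J: "sr_prime B J" shows "sr_prime A (J \<inter> A)"
  using prime_one[OF J] primeD[OF J] A by (intro primeI contract_ideal[OF A prime_ideal[OF J]]) blast+

lemma loc_ideal_contract: assumes A: "subring A" and P: "sr_prime A P" and J: "sr_ideal (loc_at A P) J"
  shows "ext_loc A P (J \<inter> A) = J"
proof
  show "ext_loc A P (J \<inter> A) \<subseteq> J"
  proof
    fix z assume "z \<in> ext_loc A P (J \<inter> A)"
    then obtain i b where 1: "z = i / b" "i \<in> J" "b \<in> A" "b \<notin> P" by (auto simp: ext_loc_def)
    have "(1 / b) * i \<in> J" using ideal_mult[OF J loc_atI[OF subring_1[OF A] 1(3,4)] 1(2)] .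
    then show "z \<in> J" using 1 by simp
  qed
  show "J \<subseteq> ext_loc A P (J \<inter> A)"
  proof
    fix z assume z: "z \<in> J"
    obtain a b where 1: "z = a / b" "a \<in> A" "b \<in> A" "b \<notin> P" using loc_atE[OF ideal_memD[OF J z]] .
    have "b * z \<in> J" using ideal_mult[OF J _ z] loc_incl[OF A P] 1 by blast
    moreover have "b \<noteq> 0" using 1 prime_0[OF P] by auto
    ultimately have "a \<in> J" using 1 by auto
    then show "z \<in> ext_loc A P (J \<inter> A)" using 1 by (auto simp: ext_loc_def)
  qed
qed

lemma loc_max: assumes A: "subring A" and P: "sr_prime A P"
  shows "max_ideal (loc_at A P) = ext_loc A P P"
proof
  show "max_ideal (loc_at A P) \<subseteq> ext_loc A P P"
  proof
    fix z assume z: "z \<in> max_ideal (loc_at A P)"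
    obtain a b where 1: "z = a / b" "a \<in> A" "b \<in> A" "b \<notin> P" using loc_atE[OF max_sub[OF z]] .
    have "a \<in> P"
    proof (rule ccontr)
      assume "a \<notin> P"
      then have "b / a \<in> loc_at A P" using 1 by (auto intro: loc_atI)
      moreover have "z \<noteq> 0" using 1 \<open>a \<notin> P\<close> prime_0[OF P] by auto
      ultimately show False using z 1 by (auto simp: max_ideal_def)
    qed
    then show "z \<in> ext_loc A P P" using 1 by (auto simp: ext_loc_def)
  qed
  show "ext_loc A P P \<subseteq> max_ideal (loc_at A P)"
    by (rule prime_sub_max[OF ext_loc_prime[OF A P P subset_refl]])
qed

lemma loc_local: assumes A: "subring A" and P: "sr_prime A P" shows "local_ring (loc_at A P)"
  unfolding local_ring_def loc_max[OF assms] using loc_subring[OF assms] ideal_ext_loc[OF assms prime_ideal[OF P]] by auto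

lemma loc_noetherian: assumes A: "noetherian A" and P: "sr_prime A P" shows "noetherian (loc_at A P)"
  unfolding noetherian_def
proof (intro conjI allI impI)
  note sA = noeth_subring[OF A]
  show "subring (loc_at A P)" by (rule loc_subring[OF sA P])
  fix J assume J: "sr_ideal (loc_at A P) J"
  obtain X where X: "finite X" "X \<subseteq> A" "J \<inter> A = gen_ideal A X"
    using noeth_fg[OF A contract_ideal[OF sA loc_incl[OF sA P] J]] by blast
  have XL: "X \<subseteq> loc_at A P" using X loc_incl[OF sA P] by blast
  have "J = gen_ideal (loc_at A P) X"
  proof
    show "gen_ideal (loc_at A P) X \<subseteq> J" using X gen_ideal_incl[OF sA, of X] by (intro gen_ideal_least[OF J]) blast
    have g: "sr_ideal (loc_at A P) (gen_ideal (loc_at A P) X)" by (rule ideal_gen[OF loc_subring[OF sA P] XL])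
    have "gen_ideal A X \<subseteq> gen_ideal (loc_at A P) X \<inter> A"
      using X gen_ideal_incl[OF loc_subring[OF sA P], of X]
      by (intro gen_ideal_least[OF contract_ideal[OF sA loc_incl[OF sA P] g]]) blast
    then have "ext_loc A P (J \<inter> A) \<subseteq> ext_loc A P (gen_ideal (loc_at A P) X \<inter> A)"
      unfolding X(3) by (auto simp: ext_loc_def)
    then show "J \<subseteq> gen_ideal (loc_at A P) X"
      unfolding loc_ideal_contract[OF sA P J] loc_ideal_contract[OF sA P g] .
  qed
  then show "\<exists>X. finite X \<and> X \<subseteq> loc_at A P \<and> J = gen_ideal (loc_at A P) X" using X XL by blast
qed

section \<open>Krull's height theorem\<close>

lemma iprod_commute: "iprod A I J = iprod A J I"
proof -
  have sub: "{x * y | x y. x \<in> I \<and> y \<in> J} \<subseteq> {x * y | x y. x \<in> J \<and> y \<in> I}" for I J :: "'a set"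
    using mult.commute by fastforce
  have "{x * y | x y. x \<in> I \<and> y \<in> J} = {x * y | x y. x \<in> J \<and> y \<in> I}"
    by (rule subset_antisym) (rule sub)+
  then show ?thesis unfolding iprod_def by simp
qed

text \<open>A socle element \<open>z\<close> of \<open>A / K\<close> splits a chain above \<open>K\<close> into a chain above \<open>K + zA\<close>
  and a chain in the one-dimensional space \<open>(K + zA) / K\<close>.\<close>
lemma dcc_above_primary:
  assumes A: "local_ring A" "noetherian A" and K: "sr_ideal A K"
    and prim: "\<And>u. u \<in> max_ideal A \<Longrightarrow> \<exists>k. u ^ k \<in> K"
    and J: "\<And>n. sr_ideal A (J n)" "\<And>n. K \<subseteq> J n" "\<And>n. J (Suc n) \<subseteq> J n"
  shows "\<exists>N. \<forall>n\<ge>N. J n = J N"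
  using prim J
proof (induction arbitrary: J rule: noeth_induct[OF A(2) K])
  case (1 K)
  note sA = local_subring[OF A(1)] and im = local_max[OF A(1)]
  note K = 1(1) and prim = 1(3) and J = 1(4,5,6)
  show ?case
  proof (cases "1 \<in> K")
    case True
    then have "J n = A" for n using J(1,2) ideal_one by blast
    then show ?thesis by auto
  next
    case False
    \<comment> \<open>A maximal annihilator modulo \<open>K\<close> comes from a socle element: if
      \<open>u * z\<close> were outside \<open>K\<close>, its colon ideal would equal that of
      \<open>z\<close> and thus exclude every power of \<open>u\<close>, although some power lies in
      \<open>K\<close>.\<close>
    define \<C> where "\<C> = {colon A K z | z. z \<in> A \<and> z \<notin> K}"
    have "\<C> \<noteq> {}" using False subring_1[OF sA] by (auto simp: \<C>_def)
    moreover have "\<And>I. I \<in> \<C> \<Longrightarrow> sr_ideal A I" using ideal_colon[OF sA K] by (auto simp: \<C>_def)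
    ultimately obtain M where M: "M \<in> \<C>" "\<forall>I\<in>\<C>. M \<subseteq> I \<longrightarrow> I = M" using noeth_max[OF A(2)] by meson
    then obtain z where z: "z \<in> A" "z \<notin> K" "M = colon A K z" by (auto simp: \<C>_def)
    have soc: "u * z \<in> K" if u: "u \<in> max_ideal A" for u
    proof (rule ccontr)
      assume uz: "u * z \<notin> K"
      have uA: "u \<in> A" using u max_sub by auto
      have "colon A K (u * z) \<in> \<C>" using uz subring_mult[OF sA uA z(1)] by (auto simp: \<C>_def)
      moreover have "M \<subseteq> colon A K (u * z)"
        using ideal_mult[OF K uA] by (auto simp: z colon_def mult.left_commute[of _ u])
      ultimately have eq: "colon A K (u * z) = colon A K z" using M z by auto
      have nk: "u ^ k \<notin> colon A K z" for k
      proof (induction k)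
        case 0 then show ?case using z by (simp add: colon_def)
      next
        case (Suc k)
        have "u ^ k \<notin> colon A K (u * z)" using Suc eq by simp
        then show ?case using subring_power[OF sA uA] by (simp add: colon_def mult.assoc mult.left_commute)
      qed
      obtain k where "u ^ k \<in> K" using prim[OF u] by auto
      then show False using nk[of k] subring_power[OF sA uA] ideal_multr[OF K z(1)] by (auto simp: colon_def)
    qed
    define Z where "Z = isum K (prin A z)"
    have pz: "sr_ideal A (prin A z)" by (rule ideal_prin[OF sA z(1)])
    have Z: "sr_ideal A Z" unfolding Z_def by (intro ideal_isum sA K pz)
    have KZ: "K \<subseteq> Z" unfolding Z_def by (rule isum_left[OF ideal_0[OF pz]])
    have zZ: "z \<in> Z" unfolding Z_def using isum_right[OF ideal_0[OF K], of "prin A z"] prin_self[OF sA, of z] by blast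
    have KZs: "K \<subset> Z" using KZ zZ z by auto
    have primZ: "\<exists>k. u ^ k \<in> Z" if "u \<in> max_ideal A" for u using prim[OF that] KZ by auto
    have "\<exists>N. \<forall>n\<ge>N. isum (J n) Z = isum (J N) Z"
    proof (rule 1(2)[OF Z KZs primZ])
      show "sr_ideal A (isum (J n) Z)" for n by (intro ideal_isum sA J Z)
      show "Z \<subseteq> isum (J n) Z" for n by (rule isum_right[OF ideal_0[OF J(1)]])
      show "isum (J (Suc n)) Z \<subseteq> isum (J n) Z" for n using J(3)[of n] by (auto simp: isum_def)
    qed
    then obtain N1 where N1: "\<And>n. n \<ge> N1 \<Longrightarrow> isum (J n) Z = isum (J N1) Z" by metis
    have anti: "m \<le> n \<Longrightarrow> J n \<subseteq> J m" for m n by (rule lift_Suc_antimono_le[of J]) (use J(3) in auto)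
    have two: "J n \<inter> Z = K \<or> z \<in> J n" for n
    proof (rule disjCI)
      assume nz: "z \<notin> J n"
      show "J n \<inter> Z = K"
      proof
        show "K \<subseteq> J n \<inter> Z" using J(2) KZ by auto
        show "J n \<inter> Z \<subseteq> K"
        proof
          fix w assume w: "w \<in> J n \<inter> Z"
          then obtain i s where i: "w = i + z * s" "i \<in> K" "s \<in> A" unfolding Z_def using isum_prinD[of w] by blast
          have zs: "z * s \<in> J n" using ideal_diff[OF sA J(1), of w n i] w i J(2)[of n] by auto
          have "s \<in> max_ideal A"
          proof (rule ccontr)
            assume "s \<notin> max_ideal A"
            then have s: "s \<noteq> 0" "inverse s \<in> A" using nonmax_unit i by auto
            have "inverse s * (z * s) \<in> J n" by (rule ideal_mult[OF J(1) s(2) zs])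
            then show False using s nz by (simp add: field_simps)
          qed
          then have "z * s \<in> K" using soc[of s] by (simp add: mult.commute)
          then show "w \<in> K" using i ideal_add[OF K] by auto
        qed
      qed
    qed
    have "\<exists>N2. \<forall>n\<ge>N2. J n \<inter> Z = J N2 \<inter> Z"
    proof (cases "\<forall>n. z \<in> J n")
      case True
      have "J n \<inter> Z = Z" for n
      proof -
        have "Z \<subseteq> J n" unfolding Z_def using True J by (intro isum_least[OF J(1)] prin_least[OF J(1)]) auto
        then show ?thesis by auto
      qed
      then show ?thesis by auto
    next
      case False
      then obtain N2 where "z \<notin> J N2" by auto
      then have "\<forall>n\<ge>N2. z \<notin> J n" using anti by blast
      then have "\<forall>n\<ge>N2. J n \<inter> Z = K" using two by blast
      then show ?thesis by (intro exI[of _ N2]) auto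
    qed
    then obtain N2 where N2: "\<And>n. n \<ge> N2 \<Longrightarrow> J n \<inter> Z = J N2 \<inter> Z" by metis
    define N where "N = max N1 N2"
    \<comment> \<open>Modular law: nested ideals with the same sum with \<open>Z\<close> and the
      same intersection with \<open>Z\<close> are equal.\<close>
    have "J n = J N" if n: "n \<ge> N" for n
    proof
      show "J n \<subseteq> J N" using anti n by blast
      show "J N \<subseteq> J n"
      proof
        fix w assume w: "w \<in> J N"
        have "isum (J n) Z = isum (J N) Z" using N1[of n] N1[of N] n by (simp add: N_def)
        moreover have "w \<in> isum (J N) Z" using w isum_left[OF ideal_0[OF Z]] by blast
        ultimately have "w \<in> isum (J n) Z" by simp
        then obtain v t where v: "w = v + t" "v \<in> J n" "t \<in> Z" unfolding isum_def by blast
        have "t = w - v" using v by simp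
        then have "t \<in> J N" using ideal_diff[OF sA J(1)] w v anti[OF n] by blast
        then have "t \<in> J n" using v N2[of n] N2[of N] n by (auto simp: N_def)
        then show "w \<in> J n" using v ideal_add[OF J(1)] by auto
      qed
    qed
    then show ?thesis by blast
  qed
qed

text \<open>The usual argument for the domain \<open>A / P'\<close>; the symbolic powers of \<open>P\<close> are contracted from \<open>A\<^sub>P\<close>.\<close>
lemma principal_ideal_theorem_local:
  assumes A: "local_ring A" "noetherian A" and P': "sr_prime A P'" and P: "sr_prime A P"
    and sub: "P' \<subseteq> P" "P \<noteq> max_ideal A" and a: "a \<in> max_ideal A"
    and min: "\<And>Q. sr_prime A Q \<Longrightarrow> P' \<subseteq> Q \<Longrightarrow> a \<in> Q \<Longrightarrow> Q = max_ideal A"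
  shows "P \<subseteq> P'"
proof -
  note sA = local_subring[OF A(1)] and im = local_max[OF A(1)]
  note iP = prime_ideal[OF P] and iP' = prime_ideal[OF P']
  have aA: "a \<in> A" using a max_sub by auto
  have aP: "a \<notin> P" using min[OF P sub(1)] sub(2) by auto
  define K where "K = isum P' (prin A a)"
  have pa: "sr_ideal A (prin A a)" by (rule ideal_prin[OF sA aA])
  have K: "sr_ideal A K" unfolding K_def by (intro ideal_isum sA iP' pa)
  have P'K: "P' \<subseteq> K" unfolding K_def by (rule isum_left[OF ideal_0[OF pa]])
  have aK: "a \<in> K" unfolding K_def using isum_right[OF ideal_0[OF iP'], of "prin A a"] prin_self[OF sA, of a] by blast
  have prim: "\<exists>k. u ^ k \<in> K" if u: "u \<in> max_ideal A" for u
  proof (rule ccontr)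
    assume "\<not> ?thesis"
    then obtain Q where "sr_prime A Q" "K \<subseteq> Q" "u \<notin> Q" using prime_avoiding[OF A(2) K max_sub[OF u]] by blast
    then show False using min[of Q] P'K aK u by blast
  qed
  define L where "L = loc_at A P"
  have L: "local_ring L" "noetherian L" unfolding L_def using loc_local[OF sA P] loc_noetherian[OF A(2) P] by auto
  note sL = local_subring[OF L(1)] and imL = local_max[OF L(1)]
  have AL: "A \<subseteq> L" unfolding L_def by (rule loc_incl[OF sA P])
  define PL' where "PL' = ext_loc A P P'"
  have PL': "sr_prime L PL'" unfolding L_def PL'_def by (rule ext_loc_prime[OF sA P P' sub(1)])
  have PL'A: "PL' \<inter> A = P'" unfolding PL'_def by (rule ext_loc_Int_prime[OF sA P P' sub(1)])
  have mLA: "max_ideal L \<inter> A = P" unfolding L_def loc_max[OF sA P] by (rule ext_loc_Int_prime[OF sA P P subset_refl])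
  define G where "G n = isum (ideal_pow L (max_ideal L) n) PL'" for n
  have G: "sr_ideal L (G n)" for n unfolding G_def by (intro ideal_isum sL ideal_ideal_pow imL prime_ideal[OF PL'])
  have Gdec: "G (Suc n) \<subseteq> G n" for n unfolding G_def using ideal_pow_dec[OF sL imL, of n] by (auto simp: isum_def)
  define sp where "sp n = G n \<inter> A" for n
  have sp: "sr_ideal A (sp n)" for n unfolding sp_def by (rule contract_ideal[OF sA AL G])
  have P'sp: "P' \<subseteq> sp n" for n
    unfolding sp_def G_def using PL'A isum_right[OF ideal_0[OF ideal_ideal_pow[OF sL imL]], of PL' n] by blast
  have "\<exists>N. \<forall>n\<ge>N. isum (sp n) (prin A a) = isum (sp N) (prin A a)"
  proof (rule dcc_above_primary[OF A K prim])
    show "sr_ideal A (isum (sp n) (prin A a))" for n by (intro ideal_isum sA sp pa)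
    show "K \<subseteq> isum (sp n) (prin A a)" for n unfolding K_def using P'sp[of n] by (auto simp: isum_def)
    show "isum (sp (Suc n)) (prin A a) \<subseteq> isum (sp n) (prin A a)" for n
      using Gdec[of n] by (auto simp: isum_def sp_def)
  qed
  then obtain n where n: "isum (sp (Suc n)) (prin A a) = isum (sp n) (prin A a)" by (metis le_SucI order_refl)
  have ainv: "inverse a \<in> L" unfolding L_def using loc_atI[OF subring_1[OF sA] aA aP] by (simp add: inverse_eq_divide)
  have a0: "a \<noteq> 0" using aP prime_0[OF P] by auto
  \<comment> \<open>Since \<open>a\<close> is a unit in \<open>L\<close>, the cofactor
    \<open>c\<close> in \<open>f = g + a * c\<close> lies in \<open>sp n\<close> again, as Nakayama
    requires.\<close>
  have "sp n \<subseteq> sp (Suc n)"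
  proof (rule nakayama_prin[OF A sp sp a])
    fix f assume f: "f \<in> sp n"
    then have "f \<in> isum (sp (Suc n)) (prin A a)" unfolding n using isum_left[OF ideal_0[OF pa]] by blast
    then obtain g c where g: "f = g + a * c" "g \<in> sp (Suc n)" "c \<in> A" using isum_prinD[of f] by blast
    have "a * c = f - g" using g by simp
    moreover have "f \<in> G n" "g \<in> G n" using f g Gdec[of n] by (auto simp: sp_def)
    ultimately have "a * c \<in> G n" using ideal_diff[OF sL G] by metis
    then have "inverse a * (a * c) \<in> G n" by (rule ideal_mult[OF G ainv])
    then have "c \<in> sp n" using a0 g by (simp add: sp_def field_simps)
    then show "\<exists>h\<in>sp (Suc n). \<exists>g\<in>sp n. f = h + a * g" using g by blast
  qed
  then have "ext_loc A P (G n \<inter> A) \<subseteq> ext_loc A P (G (Suc n) \<inter> A)" by (auto simp: sp_def ext_loc_def)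
  then have GG: "G n \<subseteq> G (Suc n)" using loc_ideal_contract[OF sA P] G unfolding L_def by auto
  \<comment> \<open>Modulo \<open>PL'\<close> two consecutive powers of the maximal ideal coincide,
    so they vanish; as \<open>PL'\<close> is prime, the maximal ideal itself lies in it.\<close>
  have "ideal_pow L (max_ideal L) n \<subseteq> PL'"
  proof (rule nakayama[OF L prime_ideal[OF PL'] ideal_ideal_pow[OF sL imL]], rule subsetI)
    fix f assume "f \<in> ideal_pow L (max_ideal L) n"
    then have "f \<in> G (Suc n)" using GG isum_left[OF ideal_0[OF prime_ideal[OF PL']]] unfolding G_def by blast
    then obtain g p where g: "f = g + p" "g \<in> ideal_pow L (max_ideal L) (Suc n)" "p \<in> PL'" by (auto simp: G_def isum_def)
    have "ideal_pow L (max_ideal L) (Suc n) = iprod L (max_ideal L) (ideal_pow L (max_ideal L) n)"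
      unfolding ideal_pow_Suc_iprod by (rule iprod_commute)
    then show "f \<in> isum PL' (iprod L (max_ideal L) (ideal_pow L (max_ideal L) n))"
      using isumI[OF g(3), of g] g by (auto simp: add.commute)
  qed
  then have "max_ideal L \<subseteq> PL'"
    using ideal_pow_elem[OF sL imL] prime_powD[OF sL PL'] max_sub by blast
  then show ?thesis using mLA PL'A by blast
qed

text \<open>If no such \<open>p\<close> existed, then after localizing at \<open>Q\<close> the
  maximal ideal would be the only prime above \<open>P'\<close> that contains \<open>a\<close>, and
  the local version leaves no room for \<open>P\<close> strictly between.\<close>

lemma principal_ideal_theorem:
  assumes A: "noetherian A" and P': "sr_prime A P'" and P: "sr_prime A P" and Q: "sr_prime A Q"
    and sub: "P' \<subset> P" "P \<subset> Q" and a: "a \<in> Q"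
  shows "\<exists>p. sr_prime A p \<and> P' \<subseteq> p \<and> a \<in> p \<and> p \<subset> Q"
proof (rule ccontr)
  assume no: "\<not> ?thesis"
  note sA = noeth_subring[OF A]
  define L where "L = loc_at A Q"
  have AL: "A \<subseteq> L" unfolding L_def by (rule loc_incl[OF sA Q])
  have mL: "max_ideal L = ext_loc A Q Q" unfolding L_def by (rule loc_max[OF sA Q])
  have P'Q: "P' \<subseteq> Q" and PQ: "P \<subseteq> Q" using sub by auto
  have cP: "ext_loc A Q P \<inter> A = P" by (rule ext_loc_Int_prime[OF sA Q P PQ])
  have cP': "ext_loc A Q P' \<inter> A = P'" by (rule ext_loc_Int_prime[OF sA Q P' P'Q])
  have cQ: "ext_loc A Q Q \<inter> A = Q" by (rule ext_loc_Int_prime[OF sA Q Q subset_refl])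
  have "ext_loc A Q P \<subseteq> ext_loc A Q P'"
  proof (rule principal_ideal_theorem_local[of L])
    show "local_ring L" "noetherian L" unfolding L_def using loc_local[OF sA Q] loc_noetherian[OF A Q] by auto
    show "sr_prime L (ext_loc A Q P')" "sr_prime L (ext_loc A Q P)" unfolding L_def
      using ext_loc_prime[OF sA Q] P P' P'Q PQ by auto
    show "ext_loc A Q P' \<subseteq> ext_loc A Q P" using sub by (auto simp: ext_loc_def)
    show "ext_loc A Q P \<noteq> max_ideal L" using cP cQ sub mL by auto
    show "a \<in> max_ideal L" using cQ a mL by auto
    fix p assume p: "sr_prime L p" "ext_loc A Q P' \<subseteq> p" "a \<in> p"
    have pm: "p \<subseteq> ext_loc A Q Q" using prime_sub_max[OF p(1)] mL by simp
    have "sr_prime A (p \<inter> A)" by (rule contract_prime[OF sA AL p(1)])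
    moreover have "P' \<subseteq> p \<inter> A" "a \<in> p \<inter> A" "p \<inter> A \<subseteq> Q"
      using p cP' a ideal_memD[OF prime_ideal[OF Q]] pm cQ by auto
    ultimately have "p \<inter> A = Q" using no by blast
    then have "ext_loc A Q (p \<inter> A) = ext_loc A Q Q" by simp
    then show "p = max_ideal L" using loc_ideal_contract[OF sA Q, of p] prime_ideal[OF p(1)] mL by (simp add: L_def)
  qed
  then show False using cP cP' sub by blast
qed

definition prime_chain :: "'a::field set \<Rightarrow> (nat \<Rightarrow> 'a set) \<Rightarrow> nat \<Rightarrow> bool" where
  "prime_chain A P n \<longleftrightarrow> (\<forall>i\<le>n. sr_prime A (P i)) \<and> (\<forall>i<n. P i \<subset> P (Suc i))"

text \<open>Works from the top: the principal ideal theorem gets \<open>a\<close> into the prime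
  just below the top, and the induction carries it down to position 1 while both ends of the chain
  stay fixed.\<close>

lemma chain_shift:
  assumes A: "noetherian A" and "prime_chain A P (Suc n)" and a: "a \<in> P (Suc n)"
  shows "\<exists>P'. prime_chain A P' (Suc n) \<and> P' 0 = P 0 \<and> P' (Suc n) = P (Suc n) \<and> a \<in> P' 1"
  using assms(2,3)
proof (induction n arbitrary: P)
  case 0 then show ?case by auto
next
  case (Suc n)
  note c = Suc.prems(1)[unfolded prime_chain_def]
  have strict: "P n \<subset> P (Suc n)" "P (Suc n) \<subset> P (Suc (Suc n))" using c by auto
  have pr: "sr_prime A (P n)" "sr_prime A (P (Suc n))" "sr_prime A (P (Suc (Suc n)))" using c by auto
  obtain p where p: "sr_prime A p" "P n \<subset> p" "a \<in> p" "p \<subset> P (Suc (Suc n))"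
  proof (cases "a \<in> P n")
    case True then show ?thesis using that[of "P (Suc n)"] pr strict by blast
  next
    case False then show ?thesis using principal_ideal_theorem[OF A pr strict Suc.prems(2)] that by blast
  qed
  define P1 where "P1 = P(Suc n := p)"
  have "prime_chain A P1 (Suc n)" unfolding prime_chain_def P1_def using c p by (auto simp: less_Suc_eq le_Suc_eq)
  from Suc.IH[OF this] p obtain P2 where P2: "prime_chain A P2 (Suc n)" "P2 0 = P 0" "P2 (Suc n) = p" "a \<in> P2 1"
    by (auto simp: P1_def)
  define P3 where "P3 = P2(Suc (Suc n) := P (Suc (Suc n)))"
  have "prime_chain A P3 (Suc (Suc n))" using P2 p pr unfolding prime_chain_def P3_def
    by (auto simp: less_Suc_eq le_Suc_eq)
  moreover have "P3 0 = P 0" "P3 (Suc (Suc n)) = P (Suc (Suc n))" "a \<in> P3 1" using P2 by (auto simp: P3_def)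
  ultimately show ?case by blast
qed

text \<open>\<open>I\<close> holds the generators already absorbed by the bottom prime. Once
  \<open>chain_shift\<close> has moved \<open>a\<close> into position 1, dropping the bottom prime
  costs one step of the chain and one generator.\<close>

theorem krull_height:
  assumes A: "noetherian A" and "finite X" "prime_chain A P n" "I \<subseteq> P 0" "X \<subseteq> P n"
    and min: "\<And>Q. sr_prime A Q \<Longrightarrow> I \<union> X \<subseteq> Q \<Longrightarrow> Q \<subseteq> P n \<Longrightarrow> Q = P n"
  shows "n \<le> card X"
  using assms(2-)
proof (induction X arbitrary: I P n rule: finite_induct)
  case empty
  have "n = 0"
  proof (rule ccontr)
    assume "n \<noteq> 0"
    have m: "P i \<subset> P (Suc i)" if "i < n" for i using empty.prems(1) that by (auto simp: prime_chain_def)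
    have "P 1 \<subseteq> P j" if "j \<ge> 1" "j \<le> n" for j using that
    proof (induction j rule: dec_induct)
      case (step j) then show ?case using m[of j] by (simp add: psubset_imp_subset subset_trans[of "P 1" "P j"])
    qed auto
    then have "P 0 \<subset> P n" using \<open>n \<noteq> 0\<close> m[of 0] by (metis One_nat_def le_refl less_one linorder_not_less neq0_conv psubset_subset_trans)
    moreover have "P 0 = P n"
      using empty.prems(1,2) empty.prems(4)[of "P 0"] calculation by (auto simp: prime_chain_def)
    ultimately show False by auto
  qed
  then show ?case by simp
next
  case (insert a X)
  show ?case
  proof (cases n)
    case 0 then show ?thesis by simp
  next
    case (Suc m)
    from chain_shift[OF A] insert.prems(1,3) obtain P' where P': "prime_chain A P' (Suc m)" "P' 0 = P 0" "P' (Suc m) = P n" "a \<in> P' 1"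
      unfolding Suc by blast
    have "m \<le> card X"
    proof (rule insert.IH[of "\<lambda>i. P' (Suc i)" m "insert a I"])
      show "prime_chain A (\<lambda>i. P' (Suc i)) m" using P'(1) by (auto simp: prime_chain_def)
      have "P' 0 \<subset> P' (Suc 0)" using P'(1) by (auto simp: prime_chain_def)
      then show "insert a I \<subseteq> P' (Suc 0)" using P' insert.prems(2) by auto
      show "X \<subseteq> P' (Suc m)" using P' insert.prems(3) by auto
      show "Q = P' (Suc m)" if "sr_prime A Q" "insert a I \<union> X \<subseteq> Q" "Q \<subseteq> P' (Suc m)" for Q
        using insert.prems(4)[of Q] that P' by auto
    qed
    then show ?thesis using insert.hyps Suc by simp
  qed
qed

section \<open>Regular systems of parameters\<close>

text \<open>By Krull's height theorem the dimension is then exactly \<open>length xs\<close>, so \<open>xs\<close> is a regular system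
  of parameters.\<close>
definition regsys :: "'a::field set \<Rightarrow> 'a list \<Rightarrow> bool" where
  "regsys A xs \<longleftrightarrow> local_ring A \<and> noetherian A \<and> set xs \<subseteq> A \<and> gen_ideal A (set xs) = max_ideal A
     \<and> has_prime_chain A (length xs)"

text \<open>If only the maximal ideal contained \<open>X\<close>, it would be minimal over
  \<open>X\<close>. The chain, with its top raised to the maximal ideal, would then be no longer
  than \<open>card X\<close>.\<close>

lemma few_generators:
  assumes A: "local_ring A" "noetherian A" and ch: "has_prime_chain A d"
    and X: "finite X" "X \<subseteq> max_ideal A" "card X < d"
  shows "\<exists>p. sr_prime A p \<and> X \<subseteq> p \<and> p \<noteq> max_ideal A"
proof (rule ccontr)
  assume no: "\<not> ?thesis"
  obtain P where P: "prime_chain A P d" using ch unfolding has_prime_chain_def prime_chain_def by blast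
  define P' where "P' = P(d := max_ideal A)"
  have "P d \<subseteq> max_ideal A" using prime_sub_max P by (auto simp: prime_chain_def)
  then have P': "prime_chain A P' d" unfolding prime_chain_def P'_def
    using P max_prime[OF A(1)] by (auto simp: prime_chain_def)
  have "d \<le> card X"
  proof (rule krull_height[OF A(2) X(1) P', of "{}"])
    show "X \<subseteq> P' d" using X by (simp add: P'_def)
    show "Q = P' d" if "sr_prime A Q" "{} \<union> X \<subseteq> Q" "Q \<subseteq> P' d" for Q
      using that no by (auto simp: P'_def)
  qed auto
  then show False using X by simp
qed

text \<open>Without \<open>z\<close> too few generators would remain, contrary to
  \<open>few_generators\<close>.\<close>

lemma regsys_not_redundant:
  assumes "regsys A (us @ z # vs)" shows "z \<notin> gen_ideal A (set us \<union> set vs)"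
proof
  assume z: "z \<in> gen_ideal A (set us \<union> set vs)"
  have A: "local_ring A" "noetherian A" and sub: "set us \<union> set vs \<subseteq> A"
    and g: "gen_ideal A (set (us @ z # vs)) = max_ideal A" and ch: "has_prime_chain A (length (us @ z # vs))"
    using assms by (auto simp: regsys_def)
  note sA = local_subring[OF A(1)]
  have gU: "sr_ideal A (gen_ideal A (set us \<union> set vs))" by (rule ideal_gen[OF sA sub])
  have "max_ideal A \<subseteq> gen_ideal A (set us \<union> set vs)"
    unfolding g[symmetric] using z gen_ideal_incl[OF sA, of "set us \<union> set vs"] by (intro gen_ideal_least[OF gU]) auto
  moreover have "set us \<union> set vs \<subseteq> max_ideal A" using gen_ideal_incl[OF sA, of "set (us @ z # vs)"] g by auto
  moreover have "card (set us \<union> set vs) < length (us @ z # vs)"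
    using card_length[of "us @ vs"] by simp
  ultimately obtain p where p: "sr_prime A p" "set us \<union> set vs \<subseteq> p" "p \<noteq> max_ideal A"
    using few_generators[OF A ch, of "set us \<union> set vs"] by auto
  have "gen_ideal A (set us \<union> set vs) \<subseteq> p" by (rule gen_ideal_least[OF prime_ideal[OF p(1)] p(2)])
  then show False using \<open>max_ideal A \<subseteq> _\<close> prime_sub_max[OF p(1)] p(3) by blast
qed

text \<open>Incomparability supplies, for each earlier prime \<open>q\<close>, an element of
  \<open>q\<close> outside the new prime \<open>p\<close>. If \<open>x + a\<close> falls into
  \<open>p\<close>, the product of these elements with the square of some \<open>e\<close> in the
  maximal ideal but outside \<open>p\<close> corrects \<open>a\<close> without disturbing the
  earlier primes.\<close>

lemma coset_avoidance:
  assumes A: "local_ring A" and x: "x \<in> A" and "finite \<P>"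
    and "\<And>p. p \<in> \<P> \<Longrightarrow> sr_prime A p \<and> p \<noteq> max_ideal A"
    and "\<And>p q. p \<in> \<P> \<Longrightarrow> q \<in> \<P> \<Longrightarrow> p \<subseteq> q \<Longrightarrow> p = q"
  shows "\<exists>a\<in>iprod A (max_ideal A) (max_ideal A). \<forall>p\<in>\<P>. x + a \<notin> p"
  using assms(3-)
proof (induction \<P> rule: finite_induct)
  case empty
  then show ?case using ideal_0[OF ideal_iprod[OF local_subring[OF A] local_max[OF A] local_max[OF A]]] by auto
next
  case (insert p \<P>)
  note sA = local_subring[OF A] and im = local_max[OF A]
  let ?mm = "iprod A (max_ideal A) (max_ideal A)"
  have imm: "sr_ideal A ?mm" by (rule ideal_iprod[OF sA im im])
  obtain a where a: "a \<in> ?mm" "\<forall>q\<in>\<P>. x + a \<notin> q"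
    using insert.IH insert.prems by (metis insertCI)
  show ?case
  proof (cases "x + a \<in> p")
    case False then show ?thesis using a by auto
  next
    case True
    have pp: "sr_prime A p" "p \<noteq> max_ideal A" using insert.prems(1) by auto
    obtain e where e: "e \<in> max_ideal A" "e \<notin> p" using prime_sub_max[OF pp(1)] pp(2) by auto
    have "\<exists>c. c \<in> q \<and> c \<notin> p" if "q \<in> \<P>" for q using insert.prems(2)[of q p] that insert.hyps(2) by auto
    then obtain c where c: "\<And>q. q \<in> \<P> \<Longrightarrow> c q \<in> q \<and> c q \<notin> p" by metis
    have cA: "c q \<in> A" if "q \<in> \<P>" for q using c[OF that] insert.prems(1)[of q] that ideal_memD prime_ideal by blast
    define b where "b = (e * e) * prod c \<P>"
    have eA: "e \<in> A" using e max_sub by auto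
    have prA: "prod c \<P>' \<in> A" if "\<P>' \<subseteq> \<P>" for \<P>' using that cA by (intro subring_prod[OF sA]) auto
    have prn: "prod c \<P>' \<notin> p" if "\<P>' \<subseteq> \<P>" for \<P>'
      using finite_subset[OF that insert.hyps(1)] that
    proof (induction \<P>' rule: finite_induct)
      case empty then show ?case using prime_one[OF pp(1)] by simp
    next
      case (insert q Q)
      then show ?case using primeD[OF pp(1), of "c q" "prod c Q"] c[of q] cA[of q] prA[of Q] by auto
    qed
    have bA: "b \<in> A" unfolding b_def using eA prA[of \<P>] by (auto intro: subring_intros sA)
    have bp: "b \<notin> p"
      using primeD[OF pp(1), of "e * e" "prod c \<P>"] primeD[OF pp(1) eA eA] e prn[of \<P>] prA[of \<P>] subring_mult[OF sA eA eA]
      by (auto simp: b_def)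
    have bmm: "b \<in> ?mm" unfolding b_def using ideal_multr[OF imm prA[of \<P>] iprodI[OF sA e(1) e(1)]] by auto
    have bq: "b \<in> q" if q: "q \<in> \<P>" for q
    proof -
      have "prod c \<P> = prod c (\<P> - {q}) * c q" using insert.hyps(1) q by (simp add: prod.remove[of \<P> q] mult.commute)
      then have "b = (e * e * prod c (\<P> - {q})) * c q" by (simp add: b_def mult.assoc)
      moreover have "e * e * prod c (\<P> - {q}) \<in> A" using eA prA[of "\<P> - {q}"] by (auto intro!: subring_mult[OF sA])
      ultimately show ?thesis using ideal_mult[OF prime_ideal] c[OF q] insert.prems(1)[of q] q by auto
    qed
    have ab: "a + b \<in> ?mm" using ideal_add[OF imm a(1) bmm] .
    have xab: "x + (a + b) = (x + a) + b" by (simp add: add.assoc)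
    have "x + (a + b) \<notin> p"
    proof
      assume "x + (a + b) \<in> p"
      then have "(x + (a + b)) - (x + a) \<in> p" using ideal_diff[OF sA prime_ideal[OF pp(1)]] True by blast
      then show False using bp by simp
    qed
    moreover have "x + (a + b) \<notin> q" if q: "q \<in> \<P>" for q
    proof
      have "sr_prime A q" using insert.prems(1)[of q] q by auto
      moreover assume "x + (a + b) \<in> q"
      ultimately have "(x + (a + b)) - b \<in> q" using ideal_diff[OF sA prime_ideal] bq[OF q] by blast
      then show False using a q by simp
    qed
    ultimately show ?thesis using ab by auto
  qed
qed

text \<open>Replacing \<open>xs ! i\<close> by an element of \<open>xs ! i + m\<^sup>2\<close> outside all minimal primes of
  \<open>I = (xs ! 0, \<dots>, xs ! (i - 1))\<close>, Nakayama shows that a minimal prime of \<open>I\<close> equals \<open>I\<close>.\<close>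
lemma regsys_prime:
  assumes "regsys A xs" "i \<le> length xs"
  shows "sr_prime A (gen_ideal A (set (take i xs)))"
  using assms
proof (induction "length xs - i" arbitrary: i xs)
  case 0
  then show ?case using max_prime by (auto simp: regsys_def)
next
  case (Suc k)
  have A: "local_ring A" "noetherian A" and sub: "set xs \<subseteq> A" and g: "gen_ideal A (set xs) = max_ideal A"
    and ch: "has_prime_chain A (length xs)" using Suc.prems by (auto simp: regsys_def)
  note sA = local_subring[OF A(1)] and im = local_max[OF A(1)]
  have i: "i < length xs" using Suc by auto
  let ?ti = "set (take i xs)"
  have tA: "?ti \<subseteq> A" using sub set_take_subset by fastforce
  have xm: "set xs \<subseteq> max_ideal A" using gen_ideal_incl[OF sA, of "set xs"] g by auto
  define I where "I = gen_ideal A ?ti"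
  have I: "sr_ideal A I" unfolding I_def by (rule ideal_gen[OF sA tA])
  obtain \<P> where P: "finite \<P>" "\<And>p. p \<in> \<P> \<Longrightarrow> sr_prime A p \<and> I \<subseteq> p"
    "\<And>Q. sr_prime A Q \<Longrightarrow> I \<subseteq> Q \<Longrightarrow> \<exists>p\<in>\<P>. p \<subseteq> Q"
    "\<And>p Q. p \<in> \<P> \<Longrightarrow> sr_prime A Q \<Longrightarrow> I \<subseteq> Q \<Longrightarrow> Q \<subseteq> p \<Longrightarrow> Q = p"
    using minimal_primes[OF A(2) I] by metis
  have "card ?ti < length xs" using card_length[of "take i xs"] i by simp
  moreover have "?ti \<subseteq> max_ideal A" using xm set_take_subset by fastforce
  ultimately obtain p0 where p0: "sr_prime A p0" "?ti \<subseteq> p0" "p0 \<noteq> max_ideal A"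
    using few_generators[OF A ch, of ?ti] by auto
  have Ip0: "I \<subseteq> p0" unfolding I_def by (rule gen_ideal_least[OF prime_ideal[OF p0(1)] p0(2)])
  have pm: "p \<noteq> max_ideal A" if "p \<in> \<P>" for p
    using P(4)[OF that p0(1) Ip0] prime_sub_max[OF p0(1)] p0(3) by auto
  have x: "xs ! i \<in> A" using sub i by auto
  have "\<exists>a\<in>iprod A (max_ideal A) (max_ideal A). \<forall>p\<in>\<P>. xs ! i + a \<notin> p"
  proof (rule coset_avoidance[OF A(1) x P(1)])
    show "sr_prime A p \<and> p \<noteq> max_ideal A" if "p \<in> \<P>" for p using P(2)[OF that] pm[OF that] by auto
    show "p = q" if "p \<in> \<P>" "q \<in> \<P>" "p \<subseteq> q" for p q using P(4)[of q p] P(2)[of p] that by auto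
  qed
  then obtain a where a: "a \<in> iprod A (max_ideal A) (max_ideal A)" "\<And>p. p \<in> \<P> \<Longrightarrow> xs ! i + a \<notin> p" by auto
  have imm: "sr_ideal A (iprod A (max_ideal A) (max_ideal A))" by (rule ideal_iprod[OF sA im im])
  have mmm: "iprod A (max_ideal A) (max_ideal A) \<subseteq> max_ideal A"
    by (rule iprod_least[OF im]) (rule ideal_multr[OF im max_sub])
  define z where "z = xs ! i + a"
  have zm: "z \<in> max_ideal A" unfolding z_def using ideal_add[OF im] a(1) mmm xm i by (meson nth_mem subsetD)
  have zA: "z \<in> A" using zm max_sub by auto
  define xs' where "xs' = take i xs @ z # drop (Suc i) xs"
  have len: "length xs' = length xs" using i by (simp add: xs'_def)
  have sxs: "set xs \<subseteq> insert (xs ! i) (set xs')"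
  proof -
    have "set xs = set (take i xs @ xs ! i # drop (Suc i) xs)" using id_take_nth_drop[OF i] by simp
    then show ?thesis unfolding xs'_def by auto
  qed
  have xs'm: "set xs' \<subseteq> max_ideal A" unfolding xs'_def
    using xm zm set_take_subset[of i xs] set_drop_subset[of "Suc i" xs] by auto
  have xs'A: "set xs' \<subseteq> A" using xs'm max_sub by blast
  have g': "sr_ideal A (gen_ideal A (set xs'))" by (rule ideal_gen[OF sA xs'A])
  have isg: "sr_ideal A (isum (gen_ideal A (set xs')) (iprod A (max_ideal A) (max_ideal A)))" (is "sr_ideal A ?sg")
    by (rule ideal_isum[OF sA g' imm])
  have s1: "gen_ideal A (set xs') \<subseteq> ?sg" by (rule isum_left[OF ideal_0[OF imm]])
  have s2: "iprod A (max_ideal A) (max_ideal A) \<subseteq> ?sg" by (rule isum_right[OF ideal_0[OF g']])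
  \<comment> \<open>Changing a generator by an element of the square of the maximal ideal keeps a
    generating set, by Nakayama.\<close>
  have "xs ! i = z - a" by (simp add: z_def)
  moreover have "z \<in> ?sg" using s1 gen_ideal_incl[OF sA, of "set xs'"] by (auto simp: xs'_def)
  moreover have "a \<in> ?sg" using s2 a by auto
  ultimately have "xs ! i \<in> ?sg" using ideal_diff[OF sA isg] by metis
  then have "set xs \<subseteq> ?sg" using sxs s1 gen_ideal_incl[OF sA, of "set xs'"] by blast
  then have "max_ideal A \<subseteq> ?sg" unfolding g[symmetric] by (rule gen_ideal_least[OF isg, unfolded g[symmetric]])
  then have "max_ideal A \<subseteq> gen_ideal A (set xs')" by (rule nakayama[OF A g' im])
  then have "gen_ideal A (set xs') = max_ideal A" using gen_ideal_least[OF im xs'm] by auto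
  then have rs': "regsys A xs'" using A ch xs'A len by (auto simp: regsys_def)
  have "sr_prime A (gen_ideal A (set (take (Suc i) xs')))"
    by (rule Suc.hyps(1)[OF _ rs']) (use Suc.hyps(2) i len in auto)
  moreover have "set (take (Suc i) xs') = insert z ?ti" using i by (simp add: xs'_def take_Suc_conv_app_nth)
  ultimately have Q: "sr_prime A (isum I (prin A z))"
    using gen_ideal_insert[OF sA zA tA] by (simp add: I_def)
  have "I \<subseteq> isum I (prin A z)" by (rule isum_left[OF ideal_0[OF ideal_prin[OF sA zA]]])
  from P(3)[OF Q this] obtain p where p: "p \<in> \<P>" "p \<subseteq> isum I (prin A z)" by auto
  have pp: "sr_prime A p" "I \<subseteq> p" using P(2)[OF p(1)] by auto
  \<comment> \<open>\<open>p\<close> lies in \<open>I + zA\<close> and avoids \<open>z\<close>, so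
    for \<open>f = g + z * s\<close> in \<open>p\<close> the factor \<open>s\<close> is in
    \<open>p\<close> as well.\<close>
  have "p \<subseteq> I"
  proof (rule nakayama_prin[OF A I prime_ideal[OF pp(1)] zm])
    fix f assume f: "f \<in> p"
    then obtain g s where gs: "f = g + z * s" "g \<in> I" "s \<in> A" using p(2) isum_prinD[of f] by blast
    have "z * s = f - g" using gs by simp
    then have "z * s \<in> p" using f gs pp ideal_diff[OF sA prime_ideal[OF pp(1)]] by (metis subsetD)
    then have "s \<in> p" using primeD[OF pp(1) zA gs(3)] a(2)[OF p(1)] by (auto simp: z_def)
    then show "\<exists>n\<in>I. \<exists>g\<in>p. f = n + z * g" using gs by blast
  qed
  then show ?case using pp unfolding I_def by auto
qed

text \<open>Outside the square of the maximal ideal, some coefficient of \<open>y\<close> in the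
  generators is a unit, and that generator can be solved for.\<close>

lemma regsys_exchange:
  assumes rs: "regsys A xs" and y: "y \<in> max_ideal A" "y \<notin> iprod A (max_ideal A) (max_ideal A)"
  shows "\<exists>us. regsys A (y # us)"
proof -
  have A: "local_ring A" "noetherian A" and sub: "set xs \<subseteq> A" and g: "gen_ideal A (set xs) = max_ideal A"
    and ch: "has_prime_chain A (length xs)" using rs by (auto simp: regsys_def)
  note sA = local_subring[OF A(1)] and im = local_max[OF A(1)]
  have xm: "set xs \<subseteq> max_ideal A" using gen_ideal_incl[OF sA, of "set xs"] g by auto
  obtain Y c where Y: "y = (\<Sum>x\<in>Y. c x * x)" "finite Y" "Y \<subseteq> set xs" "\<forall>x\<in>Y. c x \<in> A"
    using y(1) unfolding g[symmetric] gen_ideal_def by blast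
  have "\<exists>x\<in>Y. c x \<notin> max_ideal A"
  proof (rule ccontr)
    assume "\<not> ?thesis"
    then have "y \<in> iprod A (max_ideal A) (max_ideal A)" unfolding Y(1)
      using Y xm by (intro ideal_sum[OF ideal_iprod[OF sA im im]] iprodI[OF sA]) auto
    then show False using y by auto
  qed
  then obtain x0 where x0: "x0 \<in> Y" "c x0 \<notin> max_ideal A" by auto
  have u: "c x0 \<noteq> 0" "inverse (c x0) \<in> A" using nonmax_unit[of "c x0" A] Y(4) x0 by auto
  obtain us vs where xs: "xs = us @ x0 # vs" using x0 Y(3) split_list[of x0 xs] by auto
  let ?ys = "y # us @ vs"
  have ysm: "set ?ys \<subseteq> max_ideal A" using xm y xs by auto
  then have ysA: "set ?ys \<subseteq> A" using max_sub by blast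
  have gi: "sr_ideal A (gen_ideal A (set ?ys))" by (rule ideal_gen[OF sA ysA])
  have inc: "set ?ys \<subseteq> gen_ideal A (set ?ys)" by (rule gen_ideal_incl[OF sA])
  have "y = c x0 * x0 + (\<Sum>x\<in>Y - {x0}. c x * x)" using Y x0 by (simp add: sum.remove)
  then have "x0 = inverse (c x0) * (y - (\<Sum>x\<in>Y - {x0}. c x * x))" using u by (simp add: field_simps)
  moreover have "(\<Sum>x\<in>Y - {x0}. c x * x) \<in> gen_ideal A (set ?ys)"
    using Y xs inc by (intro ideal_sum[OF gi] ideal_mult[OF gi]) auto
  ultimately have "x0 \<in> gen_ideal A (set ?ys)"
    using ideal_mult[OF gi u(2)] ideal_diff[OF sA gi] inc by (metis list.set_intros(1) subsetD)
  then have "set xs \<subseteq> gen_ideal A (set ?ys)" using xs inc by auto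
  then have "max_ideal A \<subseteq> gen_ideal A (set ?ys)" using gen_ideal_least[OF gi] g by auto
  then have "gen_ideal A (set ?ys) = max_ideal A" using gen_ideal_least[OF im ysm] by auto
  then have "regsys A ?ys" using A ch ysA xs by (auto simp: regsys_def)
  then show ?thesis by blast
qed

lemma chain_le: assumes "has_prime_chain A n" "m \<le> n" shows "has_prime_chain A m"
  using assms unfolding has_prime_chain_def by (meson le_trans less_le_trans)

lemma regular_regsys: assumes "regular_local A" shows "\<exists>xs. regsys A xs"
proof -
  obtain d X where A: "noetherian A" "local_ring A" and d: "has_prime_chain A d"
    and X: "finite X" "X \<subseteq> A" "card X \<le> d" "gen_ideal A X = max_ideal A"
    using assms by (auto simp: regular_local_def krull_dim_eq_def)
  obtain xs where xs: "set xs = X" "length xs = card X" using finite_distinct_list[OF X(1)] distinct_card by metis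
  have "has_prime_chain A (length xs)" using chain_le[OF d] X xs by simp
  then show ?thesis using A X xs by (intro exI[of _ xs]) (auto simp: regsys_def)
qed

section \<open>Complete integral closedness of regular local rings\<close>

text \<open>Complete integral closedness of the domain \<open>A / I\<close>, expressed with representatives in \<open>A\<close>.\<close>
definition cic_mod :: "'a::field set \<Rightarrow> 'a set \<Rightarrow> bool" where
  "cic_mod A I \<longleftrightarrow> (\<forall>a\<in>A. \<forall>b\<in>A. \<forall>d\<in>A. b \<notin> I \<longrightarrow> d \<notin> I \<longrightarrow>
     (\<forall>k. d * a ^ k \<in> isum I (prin A (b ^ k))) \<longrightarrow> a \<in> isum I (prin A b))"

text \<open>\<open>y\<close> represents a nonzero prime element of the domain \<open>A / I\<close>;
  complete integral closedness is to be lifted from \<open>A / (I + yA)\<close> to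
  \<open>A / I\<close>.\<close>

locale cic_step =
  fixes A I :: "'a::field set" and y :: 'a
  assumes A: "local_ring A" "noetherian A" and I: "sr_prime A I" and y: "y \<in> max_ideal A" "y \<notin> I"
    and I': "sr_prime A (isum I (prin A y))" and cic': "cic_mod A (isum I (prin A y))"
begin

abbreviation "I' \<equiv> isum I (prin A y)"

lemma sA: "subring A" using A local_subring by auto
lemma iI: "sr_ideal A I" using I prime_ideal by auto
lemma yA: "y \<in> A" using y max_sub by auto
lemma II': "I \<subseteq> I'" by (rule isum_left[OF ideal_0[OF ideal_prin[OF sA yA]]])
lemma yI': "y \<in> I'" using isum_right[OF ideal_0[OF iI], of "prin A y"] prin_self[OF sA, of y] by blast

lemma cancel_pow: assumes "u \<in> A" "y ^ n * u \<in> I" shows "u \<in> I"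
  using assms(2) primeD[OF I subring_power[OF sA yA] assms(1)] prime_powD[OF sA I yA] y(2) by blast

text \<open>Among the cofactors \<open>c\<close> of powers of \<open>y\<close> in \<open>b\<close>,
  take one with \<open>I + cA\<close> maximal. If still \<open>c = i + y * e\<close>, maximality
  gives \<open>e \<in> I + cA\<close>, so \<open>e * (1 - y * s)\<close> lies in \<open>I\<close>
  for some \<open>s\<close>, and then \<open>e\<close> and \<open>b\<close> do too.\<close>

lemma factor: assumes b: "b \<in> A" "b \<notin> I"
  shows "\<exists>\<beta>. \<exists>c\<in>A. c \<notin> I' \<and> b - y ^ \<beta> * c \<in> I"
proof (rule ccontr)
  assume no: "\<not> ?thesis"
  define \<C> where "\<C> = {isum I (prin A c) | c. c \<in> A \<and> (\<exists>\<beta>. b - y ^ \<beta> * c \<in> I)}"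
  have "b - y ^ 0 * b \<in> I" using ideal_0[OF iI] by simp
  then have "\<C> \<noteq> {}" using b unfolding \<C>_def by blast
  moreover have "\<And>J. J \<in> \<C> \<Longrightarrow> sr_ideal A J" using ideal_isum[OF sA iI ideal_prin[OF sA]] by (auto simp: \<C>_def)
  ultimately obtain M where "M \<in> \<C>" and max: "\<forall>J\<in>\<C>. M \<subseteq> J \<longrightarrow> J = M" using noeth_max[OF A(2)] by meson
  then obtain c \<beta> where c: "M = isum I (prin A c)" "c \<in> A" "b - y ^ \<beta> * c \<in> I" unfolding \<C>_def by blast
  have "c \<in> I'" using no c by blast
  then obtain i e where e: "c = i + y * e" "i \<in> I" "e \<in> A" using isum_prinD[of c I A y] by blast
  have "b - y ^ Suc \<beta> * e = (b - y ^ \<beta> * c) + y ^ \<beta> * i" using e by (simp add: algebra_simps)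
  also have "\<dots> \<in> I" using ideal_add[OF iI c(3)] ideal_mult[OF iI subring_power[OF sA yA] e(2)] by blast
  finally have be: "b - y ^ Suc \<beta> * e \<in> I" .
  then have "isum I (prin A e) \<in> \<C>" using e unfolding \<C>_def by blast
  moreover have ide: "sr_ideal A (isum I (prin A e))" by (rule ideal_isum[OF sA iI ideal_prin[OF sA e(3)]])
  have Ie: "I \<subseteq> isum I (prin A e)" by (rule isum_left[OF ideal_0[OF ideal_prin[OF sA e(3)]]])
  have ee: "e \<in> isum I (prin A e)" using isum_right[OF ideal_0[OF iI], of "prin A e"] prin_self[OF sA, of e] by blast
  have "c \<in> isum I (prin A e)" using e Ie ee ideal_add[OF ide] ideal_mult[OF ide yA] by (metis subsetD)
  then have "M \<subseteq> isum I (prin A e)" unfolding c(1) by (intro isum_least[OF ide Ie] prin_least[OF ide])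
  ultimately have "e \<in> isum I (prin A c)" using max ee c by auto
  then obtain j s where s: "e = j + c * s" "j \<in> I" "s \<in> A" using isum_prinD[of e I A c] by blast
  have "e * (1 - y * s) = j + i * s" using s(1) unfolding e(1) by (simp add: algebra_simps)
  moreover have ys: "y * s \<in> max_ideal A" using ideal_multr[OF local_max[OF A(1)] s(3) y(1)] .
  ultimately have "e = (j + i * s) * inverse (1 - y * s)" using one_minus_unit(1)[OF A(1) ys] by (simp add: field_simps)
  then have "e \<in> I" using ideal_multr[OF iI one_minus_unit(2)[OF A(1) ys] ideal_add[OF iI s(2) ideal_multr[OF iI s(3) e(2)]]] by simp
  then have "y ^ Suc \<beta> * e \<in> I" by (rule ideal_mult[OF iI subring_power[OF sA yA]])
  then have "b \<in> I" using ideal_add[OF iI be] by fastforce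
  then show False using b by simp
qed

text \<open>Modulo \<open>I\<close> the prime element \<open>y\<close> does not divide
  \<open>b\<close>, so it divides the cofactor of \<open>b ^ k\<close>, and one factor
  \<open>y\<close> cancels at a time.\<close>

lemma cancel_y:
  assumes b: "b \<in> A" "b \<notin> I'" and "u \<in> A" "y ^ n * u \<in> isum I (prin A (b ^ k))"
  shows "u \<in> isum I (prin A (b ^ k))"
  using assms(4)
proof (induction n)
  case 0 then show ?case by simp
next
  case (Suc n)
  then obtain i h where h: "y ^ Suc n * u = i + b ^ k * h" "i \<in> I" "h \<in> A"
    using isum_prinD[of "y ^ Suc n * u" I A "b ^ k"] by blast
  have uA: "y ^ n * u \<in> A" using assms(3) by (intro subring_mult[OF sA] subring_power[OF sA yA])
  have bk: "b ^ k \<in> A" by (rule subring_power[OF sA b(1)])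
  have "b ^ k * h = y * (y ^ n * u) - i" using h by (simp add: algebra_simps)
  then have "b ^ k * h \<in> I'" using ideal_diff[OF sA prime_ideal[OF I'] ideal_multr[OF prime_ideal[OF I'] uA yI']] II' h by auto
  then have "h \<in> I'" using primeD[OF I' bk h(3)] prime_powD[OF sA I' b(1)] b(2) by blast
  then obtain j e where e: "h = j + y * e" "j \<in> I" "e \<in> A" using isum_prinD[of h I A y] by blast
  have "y ^ 1 * (y ^ n * u - b ^ k * e) = i + b ^ k * j" using h e by (simp add: algebra_simps)
  also have "\<dots> \<in> I" using ideal_add[OF iI h(2) ideal_mult[OF iI bk e(2)]] .
  finally have "y ^ n * u - b ^ k * e \<in> I"
    using cancel_pow[of "y ^ n * u - b ^ k * e" 1] subring_diff[OF sA uA subring_mult[OF sA bk e(3)]] by blast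
  then have "(y ^ n * u - b ^ k * e) + b ^ k * e \<in> isum I (prin A (b ^ k))" using e by (intro isum_prinI)
  then show ?case using Suc.IH by simp
qed

text \<open>For the set \<open>\<A>\<close> of all such \<open>a\<close>, closedness modulo
  \<open>I'\<close> gives \<open>a = j + y * c\<close> with \<open>j\<close> in
  \<open>J = I + bA\<close>, and \<open>c\<close> turns out to be in \<open>\<A>\<close> again;
  Nakayama then forces \<open>\<A> \<subseteq> J\<close>.\<close>

lemma cic_good:
  assumes b: "b \<in> A" "b \<notin> I'" and d: "d \<in> A" "d \<notin> I'" and a: "a \<in> A"
    and H: "\<And>k. d * a ^ k \<in> isum I (prin A (b ^ k))"
  shows "a \<in> isum I (prin A b)"
proof -
  define \<A> where "\<A> = {a \<in> A. \<forall>k. d * a ^ k \<in> isum I (prin A (b ^ k))}"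
  define J where "J = isum I (prin A b)"
  have J: "sr_ideal A J" unfolding J_def by (intro ideal_isum[OF sA iI] ideal_prin[OF sA b(1)])
  have idk: "sr_ideal A (isum I (prin A (b ^ k)))" for k
    by (intro ideal_isum[OF sA iI] ideal_prin[OF sA] subring_power[OF sA b(1)])
  have step: "\<exists>j\<in>J. \<exists>c\<in>\<A>. a = j + y * c" if a: "a \<in> \<A>" for a
  proof -
    have aA: "a \<in> A" and Ha: "\<And>k. d * a ^ k \<in> isum I (prin A (b ^ k))" using a by (auto simp: \<A>_def)
    have "d * a ^ k \<in> isum I' (prin A (b ^ k))" for k
    proof -
      obtain i e where "d * a ^ k = i + b ^ k * e" "i \<in> I" "e \<in> A" using isum_prinD[OF Ha[of k]] by blast
      then show ?thesis using isum_prinI[of i I' e A "b ^ k"] II' by auto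
    qed
    then have "a \<in> isum I' (prin A b)" using cic' aA b d unfolding cic_mod_def by blast
    then obtain i0 s where s: "a = i0 + b * s" "i0 \<in> I'" "s \<in> A" using isum_prinD[of a I' A b] by blast
    then obtain i c where c: "i0 = i + y * c" "i \<in> I" "c \<in> A" using isum_prinD[of i0 I A y] by blast
    have bsA: "b * s \<in> A" using subring_mult[OF sA b(1) s(3)] .
    \<comment> \<open>Subtracting \<open>b * s\<close> from \<open>a\<close> keeps the divisibility;
      the additional factor \<open>a ^ j\<close> is what makes the induction on \<open>k\<close>
      close.\<close>
    have pw: "d * a ^ j * (a - b * s) ^ k \<in> isum I (prin A (b ^ (j + k)))" for j k
    proof (induction k arbitrary: j)
      case 0 then show ?case using Ha by simp
    next
      case (Suc k)
      have e: "d * a ^ j * (a - b * s) ^ Suc k = d * a ^ Suc j * (a - b * s) ^ k - s * (b * (d * a ^ j * (a - b * s) ^ k))"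
        by (simp add: algebra_simps)
      obtain u v where uv: "d * a ^ j * (a - b * s) ^ k = u + b ^ (j + k) * v" "u \<in> I" "v \<in> A"
        using isum_prinD[OF Suc[of j]] by blast
      have "b * (d * a ^ j * (a - b * s) ^ k) = b * u + b ^ (j + Suc k) * v" unfolding uv by (simp add: algebra_simps)
      also have "\<dots> \<in> isum I (prin A (b ^ (j + Suc k)))" using ideal_mult[OF iI b(1) uv(2)] uv by (intro isum_prinI)
      finally show ?case unfolding e using Suc[of "Suc j"] by (intro ideal_diff[OF sA idk] ideal_mult[OF idk s(3)]) auto
    qed
    have ycA: "y * c \<in> A" using subring_mult[OF sA yA c(3)] .
    have "d * c ^ k \<in> isum I (prin A (b ^ k))" for k
    proof (rule cancel_y[OF b])
      show "d * c ^ k \<in> A" by (intro subring_mult[OF sA d(1)] subring_power[OF sA c(3)])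
      have ai: "a - b * s = i + y * c" using s c by simp
      have "(i + y * c) ^ k - (y * c) ^ k \<in> I"
      proof (induction k)
        case (Suc k)
        have "(i + y * c) ^ Suc k - (y * c) ^ Suc k = i * (i + y * c) ^ k + (y * c) * ((i + y * c) ^ k - (y * c) ^ k)"
          by (simp add: algebra_simps)
        then show ?case using ideal_add[OF iI ideal_multr[OF iI subring_power[OF sA subring_add[OF sA ideal_memD[OF iI c(2)] ycA]] c(2)] ideal_mult[OF iI ycA Suc]] by simp
      qed (use ideal_0[OF iI] in simp)
      then have "d * ((i + y * c) ^ k - (y * c) ^ k) \<in> isum I (prin A (b ^ k))"
        using ideal_mult[OF iI d(1)] isum_left[OF ideal_0[OF ideal_prin[OF sA subring_power[OF sA b(1)]]]] by blast
      moreover have "d * (i + y * c) ^ k \<in> isum I (prin A (b ^ k))" using pw[of 0 k] ai by simp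
      ultimately have "d * (i + y * c) ^ k - d * ((i + y * c) ^ k - (y * c) ^ k) \<in> isum I (prin A (b ^ k))"
        using ideal_diff[OF sA idk] by blast
      then show "y ^ k * (d * c ^ k) \<in> isum I (prin A (b ^ k))" by (simp add: algebra_simps power_mult_distrib)
    qed
    then have "c \<in> \<A>" using c by (simp add: \<A>_def)
    moreover have "a = (i + b * s) + y * c" using s c by simp
    moreover have "i + b * s \<in> J" unfolding J_def using c s by (intro isum_prinI)
    ultimately show ?thesis by blast
  qed
  have AA: "\<A> \<subseteq> A" by (auto simp: \<A>_def)
  \<comment> \<open>\<open>\<A>\<close> is only a set, so Nakayama is applied to the ideal it
    generates.\<close>
  define M where "M = gen_ideal A \<A>"
  have M: "sr_ideal A M" unfolding M_def by (rule ideal_gen[OF sA AA])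
  have AM: "\<A> \<subseteq> M" unfolding M_def by (rule gen_ideal_incl[OF sA])
  define Q where "Q = {j + y * g | j g. j \<in> J \<and> g \<in> M}"
  have Q: "sr_ideal A Q" unfolding sr_ideal_def
  proof (intro conjI ballI)
    show "Q \<subseteq> A" unfolding Q_def using ideal_memD[OF J] ideal_memD[OF M] by (auto intro!: subring_add[OF sA] subring_mult[OF sA yA])
    show "0 \<in> Q" unfolding Q_def using ideal_0[OF J] ideal_0[OF M] by force
    fix u assume "u \<in> Q"
    then obtain j g where u: "u = j + y * g" "j \<in> J" "g \<in> M" unfolding Q_def by blast
    { fix v assume "v \<in> Q"
      then obtain j' g' where v: "v = j' + y * g'" "j' \<in> J" "g' \<in> M" unfolding Q_def by blast
      have "u + v = (j + j') + y * (g + g')" using u v by (simp add: algebra_simps)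
      then show "u + v \<in> Q" unfolding Q_def using ideal_add[OF J u(2) v(2)] ideal_add[OF M u(3) v(3)] by blast }
    { fix r assume r: "r \<in> A"
      have "r * u = r * j + y * (r * g)" using u by (simp add: algebra_simps)
      then show "r * u \<in> Q" unfolding Q_def using ideal_mult[OF J r u(2)] ideal_mult[OF M r u(3)] by blast }
  qed
  have "\<A> \<subseteq> Q" unfolding Q_def using step AM by blast
  then have MQ: "M \<subseteq> Q" unfolding M_def by (rule gen_ideal_least[OF Q])
  have "M \<subseteq> J"
  proof (rule nakayama_prin[OF A J M y(1)])
    fix f assume "f \<in> M"
    then show "\<exists>n\<in>J. \<exists>g\<in>M. f = n + y * g" using MQ unfolding Q_def by blast
  qed
  moreover have "a \<in> \<A>" using a H by (simp add: \<A>_def)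
  ultimately show ?thesis using AM unfolding J_def by blast
qed

lemma cong_mult: assumes "u - u' \<in> I" "v - v' \<in> I" "u \<in> A" "v' \<in> A" shows "u * v - u' * v' \<in> I"
proof -
  have "u * v - u' * v' = u * (v - v') + (u - u') * v'" by (simp add: algebra_simps)
  then show ?thesis using ideal_add[OF iI ideal_mult[OF iI assms(3,2)] ideal_multr[OF iI assms(4,1)]] by simp
qed

lemma cong_pow: assumes "u - u' \<in> I" "u \<in> A" "u' \<in> A" shows "u ^ k - u' ^ k \<in> I"
proof (induction k)
  case 0 then show ?case using ideal_0[OF iI] by simp
next
  case (Suc k) then show ?case using cong_mult[OF assms(1) Suc assms(2) subring_power[OF sA assms(3)]] by simp
qed

text \<open>All powers of \<open>y\<close> are split off from \<open>a\<close>, \<open>b\<close> and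
  \<open>d\<close>. Once the exponent of \<open>b\<close> is seen not to exceed that of
  \<open>a\<close>, the problem reduces to \<open>cic_good\<close>.\<close>

lemma cic: "cic_mod A I"
  unfolding cic_mod_def
proof (intro ballI impI)
  fix a b d assume a: "a \<in> A" and b: "b \<in> A" and d: "d \<in> A" and bI: "b \<notin> I" and dI: "d \<notin> I"
    and H: "\<forall>k. d * a ^ k \<in> isum I (prin A (b ^ k))"
  show "a \<in> isum I (prin A b)"
  proof (cases "a \<in> I")
    case True then show ?thesis using isum_left[OF ideal_0[OF ideal_prin[OF sA b]]] by blast
  next
    case False
    obtain \<alpha> a' where a': "a' \<in> A" "a' \<notin> I'" "a - y ^ \<alpha> * a' \<in> I" using factor[OF a False] by blast
    obtain \<beta> b' where b': "b' \<in> A" "b' \<notin> I'" "b - y ^ \<beta> * b' \<in> I" using factor[OF b bI] by blast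
    obtain \<delta> d' where d': "d' \<in> A" "d' \<notin> I'" "d - y ^ \<delta> * d' \<in> I" using factor[OF d dI] by blast
    have yp: "y ^ n \<in> A" for n by (rule subring_power[OF sA yA])
    have ya: "y ^ \<alpha> * a' \<in> A" "y ^ \<beta> * b' \<in> A" "y ^ \<delta> * d' \<in> A" using subring_mult[OF sA yp] a' b' d' by auto
    have H1: "\<exists>h\<in>A. (y ^ \<delta> * d') * (y ^ \<alpha> * a') ^ k - (y ^ \<beta> * b') ^ k * h \<in> I" for k
    proof -
      obtain i h where h: "d * a ^ k = i + b ^ k * h" "i \<in> I" "h \<in> A"
        using H[rule_format, of k] isum_prinD[of "d * a ^ k" I A "b ^ k"] by blast
      have 1: "d * a ^ k - (y ^ \<delta> * d') * (y ^ \<alpha> * a') ^ k \<in> I"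
        by (rule cong_mult[OF d'(3) cong_pow[OF a'(3) a ya(1)] d subring_power[OF sA ya(1)]])
      have 2: "b ^ k * h - (y ^ \<beta> * b') ^ k * h \<in> I"
        by (rule cong_mult[OF cong_pow[OF b'(3) b ya(2)] _ subring_power[OF sA b] h(3)]) (use ideal_0[OF iI] in simp)
      have "(y ^ \<delta> * d') * (y ^ \<alpha> * a') ^ k - (y ^ \<beta> * b') ^ k * h
        = (d * a ^ k - b ^ k * h) - (d * a ^ k - (y ^ \<delta> * d') * (y ^ \<alpha> * a') ^ k) + (b ^ k * h - (y ^ \<beta> * b') ^ k * h)"
        by (simp add: algebra_simps)
      also have "\<dots> \<in> I"
      proof -
        have "d * a ^ k - b ^ k * h \<in> I" using h by simp
        then show ?thesis using ideal_add[OF iI ideal_diff[OF sA iI _ 1] 2] by blast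
      qed
      finally show ?thesis using h(3) by blast
    qed
    have "\<alpha> \<ge> \<beta>"
    proof (rule ccontr)
      assume "\<not> \<alpha> \<ge> \<beta>"
      then have ab: "Suc \<alpha> \<le> \<beta>" by simp
      \<comment> \<open>If \<open>\<alpha> < \<beta>\<close>, this \<open>k\<close> makes
        \<open>\<beta> * k\<close> exceed \<open>\<delta> + \<alpha> * k\<close>, so that
        \<open>y\<close> would divide \<open>d' * a' ^ k\<close> modulo \<open>I\<close>.\<close>
      define k where "k = Suc \<delta>"
      define e where "e = \<beta> * k - (\<delta> + \<alpha> * k)"
      have "Suc \<alpha> * k \<le> \<beta> * k" using ab by (rule mult_le_mono1)
      then have e: "\<beta> * k = (\<delta> + \<alpha> * k) + e" "e > 0" unfolding e_def by (auto simp: k_def)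
      obtain h where h: "h \<in> A" "(y ^ \<delta> * d') * (y ^ \<alpha> * a') ^ k - (y ^ \<beta> * b') ^ k * h \<in> I" using H1 by blast
      have w: "d' * a' ^ k - y ^ e * (b' ^ k * h) \<in> A"
        using a' b' d' h by (intro subring_diff[OF sA] subring_mult[OF sA] subring_power[OF sA] yA) auto
      have p1: "(y ^ \<alpha> * a') ^ k = y ^ (\<alpha> * k) * a' ^ k" by (simp only: power_mult_distrib power_mult)
      have p2: "(y ^ \<beta> * b') ^ k = y ^ (\<delta> + \<alpha> * k) * y ^ e * b' ^ k"
        unfolding power_add[symmetric] e(1)[symmetric] by (simp only: power_mult_distrib power_mult)
      have "(y ^ \<delta> * d') * (y ^ \<alpha> * a') ^ k - (y ^ \<beta> * b') ^ k * h = y ^ (\<delta> + \<alpha> * k) * (d' * a' ^ k - y ^ e * (b' ^ k * h))"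
        unfolding p1 p2 power_add by (simp only: right_diff_distrib ac_simps)
      then have "d' * a' ^ k - y ^ e * (b' ^ k * h) \<in> I" using cancel_pow[OF w] h by simp
      moreover have "y ^ e * (b' ^ k * h) \<in> I'"
        using ideal_power[OF sA prime_ideal[OF I'] yI' e(2)] b' h
        by (intro ideal_multr[OF prime_ideal[OF I']] subring_mult[OF sA] subring_power[OF sA]) auto
      ultimately have "(d' * a' ^ k - y ^ e * (b' ^ k * h)) + y ^ e * (b' ^ k * h) \<in> I'" using II' ideal_add[OF prime_ideal[OF I']] by blast
      then have "d' * a' ^ k \<in> I'" by simp
      then show False using primeD[OF I' d'(1) subring_power[OF sA a'(1)]] prime_powD[OF sA I' a'(1)] a' d' by blast
    qed
    define a1 where "a1 = y ^ (\<alpha> - \<beta>) * a'"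
    have a1A: "a1 \<in> A" unfolding a1_def using subring_mult[OF sA yp a'(1)] .
    have a1: "y ^ \<alpha> * a' = y ^ \<beta> * a1" unfolding a1_def using \<open>\<alpha> \<ge> \<beta>\<close> by (simp add: power_add[symmetric] mult.assoc[symmetric])
    have "d' * a1 ^ k \<in> isum I (prin A (b' ^ k))" for k
    proof -
      obtain h where h: "h \<in> A" "(y ^ \<delta> * d') * (y ^ \<alpha> * a') ^ k - (y ^ \<beta> * b') ^ k * h \<in> I" using H1 by blast
      have w: "y ^ \<delta> * (d' * a1 ^ k) - b' ^ k * h \<in> A"
        using a1A b' d' h by (intro subring_diff[OF sA] subring_mult[OF sA] subring_power[OF sA] yA) auto
      have "(y ^ \<delta> * d') * (y ^ \<alpha> * a') ^ k - (y ^ \<beta> * b') ^ k * h = y ^ (\<beta> * k) * (y ^ \<delta> * (d' * a1 ^ k) - b' ^ k * h)"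
        unfolding a1 power_mult_distrib power_mult by (simp only: right_diff_distrib ac_simps)
      then have "y ^ \<delta> * (d' * a1 ^ k) - b' ^ k * h \<in> I" using cancel_pow[OF w] h by simp
      then have "(y ^ \<delta> * (d' * a1 ^ k) - b' ^ k * h) + b' ^ k * h \<in> isum I (prin A (b' ^ k))" using h by (intro isum_prinI)
      then have "y ^ \<delta> * (d' * a1 ^ k) \<in> isum I (prin A (b' ^ k))" by simp
      then show ?thesis using cancel_y[OF b'(1,2)] subring_mult[OF sA d'(1) subring_power[OF sA a1A]] by blast
    qed
    then have "a1 \<in> isum I (prin A b')" by (rule cic_good[OF b'(1,2) d'(1,2) a1A])
    then obtain i s where s: "a1 = i + b' * s" "i \<in> I" "s \<in> A" using isum_prinD[of a1 I A b'] by blast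
    have "a - b * s = (a - y ^ \<alpha> * a') + y ^ \<beta> * i - (b - y ^ \<beta> * b') * s"
      unfolding a1 s(1) by (simp add: algebra_simps)
    also have "\<dots> \<in> I" 
      by (rule ideal_diff[OF sA iI ideal_add[OF iI a'(3) ideal_mult[OF iI yp s(2)]] ideal_multr[OF iI s(3) b'(3)]])
    finally have "(a - b * s) + b * s \<in> isum I (prin A b)" using s by (intro isum_prinI)
    then show ?thesis by simp
  qed
qed

end

text \<open>Descending induction on \<open>i\<close>: modulo all parameters there is a field, and by
  \<open>regsys_prime\<close> each parameter is prime modulo its predecessors, so
  \<open>cic_step\<close> applies.\<close>

lemma regsys_cic_mod:
  assumes "regsys A xs" "i \<le> length xs"
  shows "cic_mod A (gen_ideal A (set (take i xs)))"
  using assms(2)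
proof (induction "length xs - i" arbitrary: i)
  case 0
  have A: "local_ring A" and g: "gen_ideal A (set xs) = max_ideal A" using assms by (auto simp: regsys_def)
  note sA = local_subring[OF A]
  have "cic_mod A (max_ideal A)" unfolding cic_mod_def
  proof (intro ballI impI)
    fix a b d assume a: "a \<in> A" and b: "b \<in> A" "b \<notin> max_ideal A"
    have "b \<noteq> 0" "inverse b \<in> A" using nonmax_unit[OF b] by auto
    then have "a = 0 + b * (inverse b * a)" "inverse b * a \<in> A" using a subring_mult[OF sA] by auto
    then show "a \<in> isum (max_ideal A) (prin A b)" using isum_prinI[OF ideal_0[OF local_max[OF A]]] by metis
  qed
  then show ?case using 0 g by simp
next
  case (Suc k)
  have i: "i < length xs" using Suc by simp
  have A: "local_ring A" "noetherian A" and sub: "set xs \<subseteq> A" and g: "gen_ideal A (set xs) = max_ideal A"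
    using assms by (auto simp: regsys_def)
  note sA = local_subring[OF A(1)]
  have tA: "set (take i xs) \<subseteq> A" using sub set_take_subset by fastforce
  have x: "xs ! i \<in> A" using sub i by auto
  have eq: "gen_ideal A (set (take (Suc i) xs)) = isum (gen_ideal A (set (take i xs))) (prin A (xs ! i))"
    using gen_ideal_insert[OF sA x tA] i by (simp add: take_Suc_conv_app_nth)
  interpret cic_step A "gen_ideal A (set (take i xs))" "xs ! i"
  proof
    show "local_ring A" "noetherian A" by fact+
    show "sr_prime A (gen_ideal A (set (take i xs)))" by (rule regsys_prime[OF assms(1)]) (use i in simp)
    show "xs ! i \<in> max_ideal A" using gen_ideal_incl[OF sA, of "set xs"] g i by auto
    show "xs ! i \<notin> gen_ideal A (set (take i xs))"
    proof
      assume "xs ! i \<in> gen_ideal A (set (take i xs))"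
      moreover have "set (take i xs) \<union> set (drop (Suc i) xs) \<subseteq> A" using sub set_take_subset set_drop_subset by fastforce
      ultimately have "xs ! i \<in> gen_ideal A (set (take i xs) \<union> set (drop (Suc i) xs))"
        using gen_ideal_mono[OF sA, of "set (take i xs) \<union> set (drop (Suc i) xs)" "set (take i xs)"] by auto
      moreover have "regsys A (take i xs @ xs ! i # drop (Suc i) xs)" using assms(1) id_take_nth_drop[OF i] by simp
      ultimately show False using regsys_not_redundant by blast
    qed
    show "sr_prime A (isum (gen_ideal A (set (take i xs))) (prin A (xs ! i)))"
      unfolding eq[symmetric] by (rule regsys_prime[OF assms(1)]) (use i in simp)
    show "cic_mod A (isum (gen_ideal A (set (take i xs))) (prin A (xs ! i)))"
      unfolding eq[symmetric] by (rule Suc.hyps(1)) (use Suc.hyps(2) i in auto)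
  qed
  show ?case by (rule cic)
qed

theorem regular_completely_integrally_closed:
  assumes "regular_local A" "has_quotient_field A" "d \<in> A" "d \<noteq> 0" "\<And>k. d * z ^ k \<in> A"
  shows "z \<in> A"
proof -
  obtain xs where xs: "regsys A xs" using regular_regsys[OF assms(1)] by blast
  have sA: "subring A" using xs local_subring by (auto simp: regsys_def)
  obtain a b where ab: "a \<in> A" "b \<in> A" "b \<noteq> 0" "z = a / b" using assms(2) unfolding has_quotient_field_def by blast
  have "cic_mod A {0}" using regsys_cic_mod[OF xs, of 0] by (simp add: gen_ideal_empty)
  moreover have "d * a ^ k \<in> isum {0} (prin A (b ^ k))" for k
  proof -
    have "d * a ^ k = 0 + b ^ k * (d * z ^ k)" using ab by (simp add: power_divide)
    then show ?thesis using isum_prinI[OF singletonI assms(5)] by metis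
  qed
  ultimately have "a \<in> isum {0} (prin A b)" using ab assms(3,4) unfolding cic_mod_def by blast
  then obtain s where "s \<in> A" "a = b * s" using isum_prinD[of a "{0}" A b] by auto
  then show ?thesis using ab by simp
qed

section \<open>The blow-up chart and the order valuation\<close>

text \<open>For a subring \<open>C\<close> this is an explicit form of \<open>ring_adj C {t}\<close>
  (\<open>ring_adj_single\<close>); for an ideal \<open>J\<close> of \<open>C\<close> it is the
  extension of \<open>J\<close> to \<open>C[t]\<close>.\<close>

definition padj :: "'a::field set \<Rightarrow> 'a \<Rightarrow> 'a set" where
  "padj C t = {poly p t | p. \<forall>i. coeff p i \<in> C}"

lemma padjI: "(\<And>i. coeff p i \<in> C) \<Longrightarrow> poly p t \<in> padj C t" by (auto simp: padj_def)
lemma padjE: assumes "z \<in> padj C t" obtains p where "z = poly p t" "\<And>i. coeff p i \<in> C"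
  using assms by (auto simp: padj_def)

lemma poly_altdef_le: fixes p :: "'a::comm_semiring_1 poly" assumes "degree p \<le> n" shows "poly p x = (\<Sum>i\<le>n. coeff p i * x ^ i)"
  unfolding poly_altdef using assms by (intro sum.mono_neutral_left) (auto simp: coeff_eq_0)

lemma coeff_mult_ideal:
  assumes "sr_ideal C J" "\<And>i. coeff p i \<in> C" "\<And>i. coeff q i \<in> J"
  shows "coeff (p * q) i \<in> J"
  unfolding coeff_mult using assms by (intro ideal_sum[OF assms(1)] ideal_mult[OF assms(1)]) auto

lemma coeff_const_in: "0 \<in> C \<Longrightarrow> c \<in> C \<Longrightarrow> coeff [:c:] i \<in> C"
  by (cases i) auto

lemma coeff_monom_in: "0 \<in> C \<Longrightarrow> c \<in> C \<Longrightarrow> coeff (monom c n) i \<in> C"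
  by (auto simp: coeff_monom)

lemma padj_const: "0 \<in> C \<Longrightarrow> C \<subseteq> padj C t"
  using padjI[of "[:_:]" C t] coeff_const_in[of C] by fastforce

lemma padj_subring: assumes C: "subring C" shows "subring (padj C t)"
  unfolding subring_def
proof (intro conjI ballI)
  show "0 \<in> padj C t" "1 \<in> padj C t" using padj_const[OF subring_0[OF C]] C by (auto intro: subring_intros)
  fix x z assume "x \<in> padj C t" "z \<in> padj C t"
  then obtain p q where p: "x = poly p t" "\<And>i. coeff p i \<in> C" and q: "z = poly q t" "\<And>i. coeff q i \<in> C"
    by (meson padjE)
  have "poly (p + q) t \<in> padj C t" using p q by (intro padjI) (simp add: subring_add[OF C])
  moreover have "poly (p - q) t \<in> padj C t" using p q by (intro padjI) (simp add: subring_diff[OF C])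
  moreover have "poly (p * q) t \<in> padj C t" using p q by (intro padjI coeff_mult_ideal[OF ideal_self[OF C]])
  ultimately show "x + z \<in> padj C t" "x - z \<in> padj C t" "x * z \<in> padj C t" using p q by auto
qed

lemma padj_gen: assumes "subring C" shows "t \<in> padj C t"
  using padjI[of "monom 1 1" C t] coeff_monom_in[OF subring_0[OF assms] subring_1[OF assms]] by (simp add: poly_monom)

lemma poly_in: assumes "subring B" "\<And>i. coeff p i \<in> B" "t \<in> B" shows "poly p t \<in> B"
  unfolding poly_altdef using assms by (intro subring_sum[OF assms(1)] subring_mult[OF assms(1)] subring_power[OF assms(1)]) auto

lemma poly_in_ideal: assumes "subring B" "sr_ideal B J" "\<And>i. coeff p i \<in> J" "t \<in> B" shows "poly p t \<in> J"
  unfolding poly_altdef using assms by (intro ideal_sum[OF assms(2)] ideal_multr[OF assms(2)] subring_power[OF assms(1)]) auto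

lemma padj_least: assumes "subring B" "C \<subseteq> B" "t \<in> B" shows "padj C t \<subseteq> B"
  using poly_in[OF assms(1)] assms by (auto simp: padj_def)

lemma ring_adj_single: assumes A: "subring A" shows "ring_adj A {t} = padj A t"
proof
  show "ring_adj A {t} \<subseteq> padj A t" unfolding ring_adj_def
    using padj_subring[OF A] padj_const[OF subring_0[OF A]] padj_gen[OF A] by (intro Inter_lower) auto
  show "padj A t \<subseteq> ring_adj A {t}" unfolding ring_adj_def
    by (intro Inter_greatest padj_least) auto
qed

lemma ring_adj_subring: assumes "subring A" shows "subring (ring_adj A X)"
  unfolding ring_adj_def subring_def by (auto intro: subring_intros)

lemma ring_adj_incl: "A \<union> X \<subseteq> ring_adj A X" unfolding ring_adj_def by auto
lemma ring_adj_least: "subring B \<Longrightarrow> A \<union> X \<subseteq> B \<Longrightarrow> ring_adj A X \<subseteq> B" unfolding ring_adj_def by auto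

lemma padj_ideal: assumes C: "subring C" and J: "sr_ideal C J" shows "sr_ideal (padj C t) (padj J t)"
  unfolding sr_ideal_def
proof (intro conjI ballI)
  show "padj J t \<subseteq> padj C t" using ideal_memD[OF J] by (force simp: padj_def)
  show "0 \<in> padj J t" using padj_const[OF ideal_0[OF J]] ideal_0[OF J] by blast
  fix x assume "x \<in> padj J t"
  then obtain p where p: "x = poly p t" "\<And>i. coeff p i \<in> J" by (meson padjE)
  { fix z assume "z \<in> padj J t"
    then obtain q where q: "z = poly q t" "\<And>i. coeff q i \<in> J" by (meson padjE)
    have "poly (p + q) t \<in> padj J t" using p q by (intro padjI) (simp add: ideal_add[OF J])
    then show "x + z \<in> padj J t" using p q by simp }
  { fix z assume "z \<in> padj C t"
    then obtain q where q: "z = poly q t" "\<And>i. coeff q i \<in> C" by (meson padjE)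
    have "poly (q * p) t \<in> padj J t" using p q by (intro padjI coeff_mult_ideal[OF J])
    then show "z * x \<in> padj J t" using p q by simp }
qed

text \<open>The lowest coefficients of \<open>p\<close> and \<open>q\<close> outside
  \<open>J\<close> meet in one coefficient of the product, where every other summand lies in
  \<open>J\<close>.\<close>

lemma gauss_prime:
  assumes C: "subring C" and J: "sr_prime C J" and p: "\<And>i. coeff p i \<in> C" and q: "\<And>i. coeff q i \<in> C"
    and pq: "\<And>i. coeff (p * q) i \<in> J"
  shows "(\<forall>i. coeff p i \<in> J) \<or> (\<forall>i. coeff q i \<in> J)"
proof (rule ccontr)
  assume no: "\<not> ?thesis"
  define i where "i = (LEAST i. coeff p i \<notin> J)"
  define j where "j = (LEAST j. coeff q j \<notin> J)"
  have i: "coeff p i \<notin> J" unfolding i_def by (rule LeastI_ex) (use no in blast)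
  have j: "coeff q j \<notin> J" unfolding j_def by (rule LeastI_ex) (use no in blast)
  have il: "coeff p k \<in> J" if "k < i" for k using not_less_Least[OF that[unfolded i_def]] by simp
  have jl: "coeff q k \<in> J" if "k < j" for k using not_less_Least[OF that[unfolded j_def]] by simp
  note iJ = prime_ideal[OF J]
  have "coeff (p * q) (i + j) = coeff p i * coeff q j + (\<Sum>k\<in>{..i+j} - {i}. coeff p k * coeff q (i + j - k))"
    unfolding coeff_mult by (subst sum.remove[of _ i]) auto
  moreover have "(\<Sum>k\<in>{..i+j} - {i}. coeff p k * coeff q (i + j - k)) \<in> J"
  proof (rule ideal_sum[OF iJ])
    fix k assume "k \<in> {..i+j} - {i}"
    then have "k < i \<or> i + j - k < j" by auto
    then show "coeff p k * coeff q (i + j - k) \<in> J" using il jl p q by (meson ideal_mult[OF iJ] ideal_multr[OF iJ])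
  qed
  ultimately have "coeff p i * coeff q j \<in> J" using ideal_diff[OF C iJ pq[of "i + j"]] by fastforce
  then show False using primeD[OF J p q] i j by blast
qed

text \<open>Since \<open>y\<close>, \<open>u\<close> is a regular sequence, \<open>C[u/y] = C[T]/(yT - u)\<close>; modulo an ideal containing
  \<open>y\<close> and \<open>u\<close> the element \<open>u/y\<close> therefore becomes an indeterminate.\<close>
locale elementary_blowup =
  fixes C :: "'a::field set" and y u :: 'a
  assumes C: "subring C" and y: "y \<in> C" "y \<noteq> 0" and u: "u \<in> C"
    and reg: "\<And>c. c \<in> C \<Longrightarrow> c * u \<in> prin C y \<Longrightarrow> c \<in> prin C y"
begin

abbreviation "t \<equiv> u / y"

text \<open>Clearing denominators shows that \<open>y\<close> divides the leading coefficient times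
  \<open>u ^ Suc n\<close>, so by regularity the coefficient is \<open>y * e\<close>. As
  \<open>y * t = u\<close>, the leading term equals \<open>e * u * t ^ n\<close>, which lowers the
  degree.\<close>

lemma relation_coeffs:
  assumes J: "sr_ideal C J" "y \<in> J" "u \<in> J" and "degree p \<le> n" "\<And>i. coeff p i \<in> C" "poly p t = 0"
  shows "coeff p i \<in> J"
  using assms(4-)
proof (induction n arbitrary: p i)
  case 0
  then obtain c where "p = [:c:]" using degree_0_id[of p] by (metis le_zero_eq)
  then show ?case using 0 ideal_0[OF J(1)] by (cases i) auto
next
  case (Suc n)
  let ?c = "coeff p (Suc n)"
  have iy: "sr_ideal C (prin C y)" by (rule ideal_prin[OF C y(1)])
  have "0 = y ^ Suc n * (\<Sum>i\<le>Suc n. coeff p i * t ^ i)" using Suc.prems poly_altdef_le[of p "Suc n"] by simp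
  also have "\<dots> = (\<Sum>i\<le>Suc n. coeff p i * u ^ i * y ^ (Suc n - i))"
    unfolding sum_distrib_left
  proof (rule sum.cong[OF refl])
    fix i assume "i \<in> {..Suc n}"
    then have "y ^ Suc n = y ^ i * y ^ (Suc n - i)" by (simp add: power_add[symmetric])
    then show "y ^ Suc n * (coeff p i * t ^ i) = coeff p i * u ^ i * y ^ (Suc n - i)"
      using y by (simp add: power_divide)
  qed
  also have "\<dots> = ?c * u ^ Suc n + (\<Sum>i\<le>n. coeff p i * u ^ i * y ^ (Suc n - i))" by (simp add: add.commute)
  finally have e: "?c * u ^ Suc n = - (\<Sum>i\<le>n. coeff p i * u ^ i * y ^ (Suc n - i))"
    by (metis add_eq_0_iff2)
  have "(\<Sum>i\<le>n. coeff p i * u ^ i * y ^ (Suc n - i)) \<in> prin C y"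
  proof (rule ideal_sum[OF iy])
    fix i assume "i \<in> {..n}"
    then have "y ^ (Suc n - i) \<in> prin C y" using ideal_power[OF C iy prin_self[OF C]] by simp
    then show "coeff p i * u ^ i * y ^ (Suc n - i) \<in> prin C y"
      using Suc.prems u by (intro ideal_mult[OF iy] subring_mult[OF C] subring_power[OF C]) auto
  qed
  then have "?c * u ^ Suc n \<in> prin C y" unfolding e by (rule ideal_uminus[OF C iy])
  moreover have "c * u ^ k \<in> prin C y \<Longrightarrow> c \<in> C \<Longrightarrow> c \<in> prin C y" for c k
  proof (induction k arbitrary: c)
    case (Suc k)
    have "(c * u ^ k) * u \<in> prin C y" using Suc.prems by (simp add: ac_simps)
    then have "c * u ^ k \<in> prin C y" using reg Suc.prems(2) subring_mult[OF C _ subring_power[OF C u]] by blast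
    then show ?case using Suc by blast
  qed auto
  ultimately obtain e where e: "?c = y * e" "e \<in> C" using Suc.prems(2)[of "Suc n"] unfolding prin_def by blast
  define p' where "p' = p - monom ?c (Suc n) + monom (e * u) n"
  have c': "coeff p' i = (if i = Suc n then 0 else if i = n then coeff p n + e * u else coeff p i)" for i
    by (auto simp: p'_def coeff_monom)
  have dp: "degree p' \<le> n"
    by (rule degree_le) (use Suc.prems(1) in \<open>auto simp: c' coeff_eq_0\<close>)
  have pC: "coeff p' i \<in> C" for i unfolding c' using Suc.prems(2) e u C by (auto intro: subring_intros)
  have "poly p' t = 0"
    using Suc.prems(3) y e by (simp add: p'_def poly_monom)
  from Suc.IH[OF dp pC this] have J': "coeff p' i \<in> J" for i .
  have euJ: "e * u \<in> J" using ideal_mult[OF J(1) e(2) J(3)] .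
  consider "i = Suc n" | "i = n" | "i \<noteq> n" "i \<noteq> Suc n" by blast
  then show ?case
  proof cases
    case 1 then show ?thesis using e ideal_multr[OF J(1) e(2) J(2)] by simp
  next
    case 2
    then have "coeff p i = coeff p' n - e * u" by (simp add: c')
    then show ?thesis using ideal_diff[OF C J(1) J' euJ] by simp
  next
    case 3 then show ?thesis using J'[of i] by (simp add: c')
  qed
qed

lemma coeffs_in_ideal:
  assumes J: "sr_ideal C J" "y \<in> J" "u \<in> J" and p: "\<And>i. coeff p i \<in> C" "poly p t \<in> padj J t"
  shows "coeff p i \<in> J"
proof -
  obtain q where q: "poly p t = poly q t" "\<And>i. coeff q i \<in> J" using p(2) by (meson padjE)
  have "coeff (p - q) i \<in> J"
    by (rule relation_coeffs[OF J order_refl]) (use p q ideal_memD[OF J(1)] subring_diff[OF C] in auto)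
  then show ?thesis using ideal_add[OF J(1) _ q(2)[of i]] by fastforce
qed

lemma padj_prime: assumes J: "sr_prime C J" "y \<in> J" "u \<in> J" shows "sr_prime (padj C t) (padj J t)"
proof (rule primeI[OF padj_subring[OF C] padj_ideal[OF C prime_ideal[OF J(1)]]])
  show "1 \<notin> padj J t"
  proof
    assume "1 \<in> padj J t"
    then have "coeff [:1:] 0 \<in> J"
      by (intro coeffs_in_ideal[OF prime_ideal[OF J(1)] J(2,3)] coeff_const_in) (auto intro: subring_intros C)
    then show False using prime_one[OF J(1)] by simp
  qed
  fix a b assume "a \<in> padj C t" "b \<in> padj C t" and ab: "a * b \<in> padj J t"
  then obtain p q where p: "a = poly p t" "\<And>i. coeff p i \<in> C" and q: "b = poly q t" "\<And>i. coeff q i \<in> C"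
    by (meson padjE)
  have pqC: "coeff (p * q) i \<in> C" for i using p q by (intro coeff_mult_ideal[OF ideal_self[OF C]])
  have pqJ: "coeff (p * q) i \<in> J" for i
    using coeffs_in_ideal[OF prime_ideal[OF J(1)] J(2,3) pqC] ab p q by simp
  show "a \<in> padj J t \<or> b \<in> padj J t" using gauss_prime[OF C J(1) p(2) q(2) pqJ] p q padjI by blast
qed

text \<open>In \<open>C[t]\<close> the generator \<open>u = t * y\<close> becomes redundant.\<close>

lemma gen_padj: assumes X: "X \<subseteq> C"
  shows "gen_ideal (padj C t) (insert y X) = padj (gen_ideal C (insert y (insert u X))) t"
proof
  let ?C' = "padj C t" let ?J = "gen_ideal C (insert y (insert u X))"
  have XC: "insert y (insert u X) \<subseteq> C" using X y u by auto
  have J: "sr_ideal C ?J" by (rule ideal_gen[OF C XC])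
  note C' = padj_subring[OF C, of t]
  have CC': "C \<subseteq> ?C'" by (rule padj_const[OF subring_0[OF C]])
  have "insert y X \<subseteq> padj ?J t" using gen_ideal_incl[OF C, of "insert y (insert u X)"] padj_const[OF ideal_0[OF J], of t] by blast
  then show "gen_ideal ?C' (insert y X) \<subseteq> padj ?J t" by (rule gen_ideal_least[OF padj_ideal[OF C J]])
  have XC': "insert y X \<subseteq> ?C'" using X y CC' by auto
  have G: "sr_ideal ?C' (gen_ideal ?C' (insert y X))" by (rule ideal_gen[OF C' XC'])
  have inc: "insert y X \<subseteq> gen_ideal ?C' (insert y X)" by (rule gen_ideal_incl[OF C'])
  have "t * y \<in> gen_ideal ?C' (insert y X)" using inc by (intro ideal_mult[OF G padj_gen[OF C]]) auto
  then have "u \<in> gen_ideal ?C' (insert y X)" using y by simp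
  then have "insert y (insert u X) \<subseteq> gen_ideal ?C' (insert y X) \<inter> C" using inc XC by auto
  then have "?J \<subseteq> gen_ideal ?C' (insert y X) \<inter> C" by (rule gen_ideal_least[OF contract_ideal[OF C CC' G]])
  then show "padj ?J t \<subseteq> gen_ideal ?C' (insert y X)"
    using poly_in_ideal[OF C' G _ padj_gen[OF C]] by (force simp: padj_def)
qed

end

text \<open>The head of the list is adjoined last, so list induction treats the whole ring as a
  one-variable extension of a smaller tower.\<close>

primrec tower_ring :: "'a::field set \<Rightarrow> 'a \<Rightarrow> 'a list \<Rightarrow> 'a set" where
  "tower_ring A y [] = A"
| "tower_ring A y (u # us) = padj (tower_ring A y us) (u / y)"

text \<open>With \<open>B = A\<close>, the elements of \<open>tower_ring A y us\<close> of total degree at most \<open>n\<close> in the adjoined quotients.\<close>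
primrec tower_fil :: "'a::field set \<Rightarrow> 'a \<Rightarrow> 'a list \<Rightarrow> nat \<Rightarrow> 'a set" where
  "tower_fil B y [] = (\<lambda>n. B)"
| "tower_fil B y (u # us) = (\<lambda>n. {poly p (u / y) | p. degree p \<le> n \<and> (\<forall>i. coeff p i \<in> tower_fil B y us (n - i))})"

lemma tower_ring_subring: "subring A \<Longrightarrow> subring (tower_ring A y us)"
  by (induction us) (auto intro: padj_subring)

lemma tower_ring_incl: "subring A \<Longrightarrow> A \<subseteq> tower_ring A y us"
  by (induction us) (auto intro!: set_mp[OF padj_const] subring_0 tower_ring_subring)

lemma tower_ring_mem: "subring A \<Longrightarrow> u \<in> set us \<Longrightarrow> u / y \<in> tower_ring A y us"
proof (induction us)
  case (Cons w us)
  then show ?case using padj_gen[OF tower_ring_subring] padj_const[OF subring_0[OF tower_ring_subring]] by fastforce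
qed auto

lemma tower_ring_least: "subring B \<Longrightarrow> A \<subseteq> B \<Longrightarrow> (\<And>u. u \<in> set us \<Longrightarrow> u / y \<in> B) \<Longrightarrow> tower_ring A y us \<subseteq> B"
proof (induction us)
  case (Cons u us)
  show ?case unfolding tower_ring.simps by (rule padj_least) (use Cons in auto)
qed auto

lemma tower_ring_mono: "subring A \<Longrightarrow> set us \<subseteq> set vs \<Longrightarrow> tower_ring A y us \<subseteq> tower_ring A y vs"
  by (rule tower_ring_least) (use tower_ring_subring tower_ring_incl tower_ring_mem in blast)+

lemma regsys_perm: "regsys A xs \<Longrightarrow> set ys = set xs \<Longrightarrow> length ys = length xs \<Longrightarrow> regsys A ys"
  by (simp add: regsys_def)

text \<open>\<open>ws\<close> are the parameters not yet divided by \<open>y\<close>. The three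
  clauses need each other: primality of \<open>y\<close> with the contraction to \<open>A\<close>
  makes the next \<open>u\<close> regular modulo \<open>y\<close>, and the resulting elementary
  blow-up extends the primes and contractions one level up.\<close>

lemma tower:
  assumes "regsys A (y # us @ ws)"
  shows "(\<forall>i\<le>length ws. sr_prime (tower_ring A y us) (gen_ideal (tower_ring A y us) (insert y (set (take i ws)))))
    \<and> (\<forall>i\<le>length ws. \<forall>a\<in>A. a \<in> gen_ideal (tower_ring A y us) (insert y (set (take i ws)))
          \<longrightarrow> a \<in> gen_ideal A (insert y (set us \<union> set (take i ws))))
    \<and> (us \<noteq> [] \<longrightarrow> elementary_blowup (tower_ring A y (tl us)) y (hd us))"
  using assms
proof (induction us arbitrary: ws)
  case Nil
  have "sr_prime A (gen_ideal A (insert y (set (take i ws))))" if "i \<le> length ws" for i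
    using regsys_prime[OF Nil, of "Suc i"] that by simp
  then show ?case by simp
next
  case (Cons u us)
  have rs: "regsys A (y # us @ u # ws)" by (rule regsys_perm[OF Cons.prems]) auto
  have sub: "set (y # u # us @ ws) \<subseteq> A" and A: "local_ring A" using Cons.prems by (auto simp: regsys_def)
  note sA = local_subring[OF A]
  define C where "C = tower_ring A y us"
  have C: "subring C" unfolding C_def by (rule tower_ring_subring[OF sA])
  have AC: "A \<subseteq> C" unfolding C_def by (rule tower_ring_incl[OF sA])
  have IH1: "sr_prime C (gen_ideal C (insert y (set (take i (u # ws)))))" if "i \<le> Suc (length ws)" for i
    using Cons.IH[OF rs] that unfolding C_def by auto
  have IH2: "a \<in> gen_ideal A (insert y (set us \<union> set (take i (u # ws))))"
    if "i \<le> Suc (length ws)" "a \<in> A" "a \<in> gen_ideal C (insert y (set (take i (u # ws))))" for i a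
    using Cons.IH[OF rs] that unfolding C_def by auto
  have yC: "y \<in> C" and uC: "u \<in> C" using sub AC by auto
  \<comment> \<open>Were \<open>u\<close> in \<open>yC\<close>, contraction to \<open>A\<close>
    would express it through the other parameters.\<close>
  have "u \<notin> gen_ideal A (set (y # us) \<union> set ws)" using regsys_not_redundant[of A "y # us" u ws] rs by simp
  moreover have "gen_ideal A (insert y (set us)) \<subseteq> gen_ideal A (set (y # us) \<union> set ws)"
    by (rule gen_ideal_mono[OF sA]) (use sub in auto)
  ultimately have un: "u \<notin> prin C y" using IH2[of 0 u] sub gen_ideal_single[OF C yC] by auto
  have yp: "sr_prime C (prin C y)" using IH1[of 0] gen_ideal_single[OF C yC] by simp
  have "y \<notin> gen_ideal A (set (us @ u # ws))" using regsys_not_redundant[of A "[]" y "us @ u # ws"] rs by simp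
  then have y0: "y \<noteq> 0" using ideal_0[OF ideal_gen[OF sA, of "set (us @ u # ws)"]] sub by auto
  have eb: "elementary_blowup C y u"
  proof
    show "c \<in> prin C y" if "c \<in> C" "c * u \<in> prin C y" for c using primeD[OF yp that(1) uC that(2)] un by blast
  qed (fact C yC y0 uC)+
  interpret elementary_blowup C y u by (rule eb)
  have ge: "gen_ideal (padj C t) (insert y (set (take i ws))) = padj (gen_ideal C (insert y (set (take (Suc i) (u # ws))))) t" for i
  proof -
    have "set (take i ws) \<subseteq> C" using sub AC set_take_subset[of i ws] by auto
    then show ?thesis using gen_padj by simp
  qed
  have JJ: "y \<in> gen_ideal C (insert y (set (take (Suc i) (u # ws))))" "u \<in> gen_ideal C (insert y (set (take (Suc i) (u # ws))))" for i
    using gen_ideal_incl[OF C, of "insert y (set (take (Suc i) (u # ws)))"] by auto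
  have 1: "sr_prime (padj C t) (gen_ideal (padj C t) (insert y (set (take i ws))))" if "i \<le> length ws" for i
    unfolding ge by (rule padj_prime[OF IH1 JJ]) (use that in simp)
  have 2: "a \<in> gen_ideal A (insert y (set (u # us) \<union> set (take i ws)))"
    if i: "i \<le> length ws" and a: "a \<in> A" "a \<in> gen_ideal (padj C t) (insert y (set (take i ws)))" for i a
  proof -
    have J: "sr_ideal C (gen_ideal C (insert y (set (take (Suc i) (u # ws)))))" using IH1[of "Suc i"] i prime_ideal by auto
    have "coeff [:a:] 0 \<in> gen_ideal C (insert y (set (take (Suc i) (u # ws))))"
      by (rule coeffs_in_ideal[OF J JJ coeff_const_in[OF subring_0[OF C]]]) (use a ge AC in auto)
    then have "a \<in> gen_ideal A (insert y (set us \<union> set (take (Suc i) (u # ws))))" using IH2[of "Suc i" a] i a by simp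
    then show ?thesis by (simp add: insert_commute)
  qed
  show ?case using 1 2 eb by (simp add: C_def[symmetric])
qed

lemma tower_fil_zero: "0 \<in> B \<Longrightarrow> 0 \<in> tower_fil B y us n"
proof (induction us arbitrary: n)
  case (Cons u us) then show ?case by (auto intro!: exI[of _ 0])
qed auto

lemma tower_fil_mono: "0 \<in> B \<Longrightarrow> n \<le> m \<Longrightarrow> tower_fil B y us n \<subseteq> tower_fil B y us m"
proof (induction us arbitrary: n m)
  case (Cons u us)
  show ?case
  proof
    fix z assume "z \<in> tower_fil B y (u # us) n"
    then obtain p where "z = poly p (u / y)" "degree p \<le> n" "\<forall>i. coeff p i \<in> tower_fil B y us (n - i)" by auto
    moreover have "n - i \<le> m - i" for i using Cons.prems by simp
    ultimately show "z \<in> tower_fil B y (u # us) m" using Cons by (auto intro!: exI[of _ p] intro: set_mp[OF Cons.IH])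
  qed
qed auto

lemma tower_fil_const: "0 \<in> B \<Longrightarrow> B \<subseteq> tower_fil B y us n"
proof (induction us arbitrary: n)
  case (Cons u us)
  show ?case
  proof
    fix b assume b: "b \<in> B"
    have "coeff [:b:] i \<in> tower_fil B y us (n - i)" for i
      using b Cons.IH[OF Cons.prems, of "n - i"] tower_fil_zero[OF Cons.prems] by (cases i) auto
    then show "b \<in> tower_fil B y (u # us) n" by (auto intro!: exI[of _ "[:b:]"])
  qed
qed auto

lemma tower_fil_tail: assumes "0 \<in> B" shows "tower_fil B y us n \<subseteq> tower_fil B y (u # us) n"
proof
  fix b assume b: "b \<in> tower_fil B y us n"
  have "coeff [:b:] i \<in> tower_fil B y us (n - i)" for i using b tower_fil_zero[OF assms] by (cases i) auto
  then show "b \<in> tower_fil B y (u # us) n" by (auto intro!: exI[of _ "[:b:]"])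
qed

lemma tower_fil_add: "sr_ideal A B \<Longrightarrow> z \<in> tower_fil B y us n \<Longrightarrow> w \<in> tower_fil B y us n \<Longrightarrow> z + w \<in> tower_fil B y us n"
proof (induction us arbitrary: n z w)
  case Nil then show ?case by (auto intro: ideal_add)
next
  case (Cons u us)
  obtain p where p: "z = poly p (u / y)" "degree p \<le> n" "\<forall>i. coeff p i \<in> tower_fil B y us (n - i)" using Cons.prems by auto
  obtain q where q: "w = poly q (u / y)" "degree q \<le> n" "\<forall>i. coeff q i \<in> tower_fil B y us (n - i)" using Cons.prems by auto
  have "degree (p + q) \<le> n" using p q by (simp add: degree_add_le)
  then show ?case using p q Cons.IH[OF Cons.prems(1)] by (auto intro!: exI[of _ "p + q"])
qed

lemma tower_fil_sum: "sr_ideal A B \<Longrightarrow> (\<And>i. i \<in> K \<Longrightarrow> f i \<in> tower_fil B y us n) \<Longrightarrow> sum f K \<in> tower_fil B y us n"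
  by (induction K rule: infinite_finite_induct) (auto intro: tower_fil_add tower_fil_zero ideal_0)

lemma tower_fil_mult: "subring A \<Longrightarrow> z \<in> tower_fil A y us n \<Longrightarrow> w \<in> tower_fil A y us m \<Longrightarrow> z * w \<in> tower_fil A y us (n + m)"
proof (induction us arbitrary: n m z w)
  case Nil then show ?case by (auto intro: subring_mult)
next
  case (Cons u us)
  obtain p where p: "z = poly p (u / y)" "degree p \<le> n" "\<forall>i. coeff p i \<in> tower_fil A y us (n - i)" using Cons.prems by auto
  obtain q where q: "w = poly q (u / y)" "degree q \<le> m" "\<forall>i. coeff q i \<in> tower_fil A y us (m - i)" using Cons.prems by auto
  have "degree (p * q) \<le> n + m" using p q degree_mult_le[of p q] by linarith
  moreover have "coeff (p * q) k \<in> tower_fil A y us (n + m - k)" for k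
    unfolding coeff_mult
  proof (rule tower_fil_sum[OF ideal_self[OF Cons.prems(1)]])
    fix i assume i: "i \<in> {..k}"
    show "coeff p i * coeff q (k - i) \<in> tower_fil A y us (n + m - k)"
    proof (cases "i \<le> n \<and> k - i \<le> m")
      case True
      have "coeff p i * coeff q (k - i) \<in> tower_fil A y us ((n - i) + (m - (k - i)))" using Cons.IH[OF Cons.prems(1)] p q by blast
      moreover have "(n - i) + (m - (k - i)) = n + m - k" using True i by auto
      ultimately show ?thesis by simp
    next
      case False
      then have "coeff p i * coeff q (k - i) = 0" using p(2) q(2) by (auto simp: coeff_eq_0)
      then show ?thesis using tower_fil_zero[OF subring_0[OF Cons.prems(1)], of y us "n + m - k"] by metis
    qed
  qed
  ultimately show ?case using p q by (auto intro!: exI[of _ "p * q"])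
qed

lemma tower_fil_gen: "subring A \<Longrightarrow> u \<in> set us \<Longrightarrow> u / y \<in> tower_fil A y us (Suc 0)"
proof (induction us)
  case (Cons w us)
  show ?case
  proof (cases "u = w")
    case True
    have "coeff [:0, 1:] i \<in> tower_fil A y us (Suc 0 - i)" for i :: nat
      using tower_fil_zero[OF subring_0[OF Cons.prems(1)]] set_mp[OF tower_fil_const[OF subring_0[OF Cons.prems(1)]] subring_1[OF Cons.prems(1)]]
      by (auto simp: coeff_pCons split: nat.split)
    then show ?thesis using True by (auto intro!: exI[of _ "[:0, 1:]"])
  next
    case False
    then show ?thesis using Cons tower_fil_tail[OF subring_0[OF Cons.prems(1)], of y us "Suc 0" w] by auto
  qed
qed auto

lemma tower_fil_sub_ring: "subring A \<Longrightarrow> tower_fil A y us n \<subseteq> tower_ring A y us"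
proof (induction us arbitrary: n)
  case (Cons u us) then show ?case by (force simp: padj_def)
qed auto

lemma tower_ring_sub_fil: "subring A \<Longrightarrow> z \<in> tower_ring A y us \<Longrightarrow> \<exists>n. z \<in> tower_fil A y us n"
proof (induction us arbitrary: z)
  case (Cons u us)
  obtain p where p: "z = poly p (u / y)" "\<And>i. coeff p i \<in> tower_ring A y us" using Cons.prems by (auto simp: padj_def)
  obtain f where f: "\<And>i. coeff p i \<in> tower_fil A y us (f i)" using Cons.IH[OF Cons.prems(1) p(2)] by metis
  define N where "N = degree p + (\<Sum>i\<le>degree p. f i)"
  have "coeff p i \<in> tower_fil A y us (N - i)" for i
  proof (cases "i \<le> degree p")
    case True
    have "f i \<le> (\<Sum>i\<le>degree p. f i)" using True by (intro member_le_sum) auto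
    then have "f i \<le> N - i" using True by (simp add: N_def)
    then show ?thesis using f[of i] tower_fil_mono[OF subring_0[OF Cons.prems(1)]] by blast
  next
    case False then show ?thesis using tower_fil_zero[OF subring_0[OF Cons.prems(1)]] by (simp add: coeff_eq_0)
  qed
  then have "z \<in> tower_fil A y (u # us) N" using p by (auto simp: N_def intro!: exI[of _ p])
  then show ?case by blast
qed auto

text \<open>Multiplication by \<open>y ^ n\<close> homogenizes: each \<open>u / y\<close> trades one
  factor \<open>y\<close> for \<open>u\<close>, and the coefficients contribute the further
  \<open>k\<close> factors.\<close>

lemma tower_fil_pow:
  assumes A: "subring A" and m: "sr_ideal A m" and y: "y \<in> m" "y \<noteq> 0" and B: "B \<subseteq> ideal_pow A m k"
  shows "set us \<subseteq> m \<Longrightarrow> z \<in> tower_fil B y us n \<Longrightarrow> y ^ n * z \<in> ideal_pow A m (n + k)"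
proof (induction us arbitrary: n z)
  case Nil
  then show ?case using ideal_pow_mult[OF A m ideal_pow_elem[OF A m y(1)]] B by auto
next
  case (Cons u us)
  obtain p where p: "z = poly p (u / y)" "degree p \<le> n" "\<forall>i. coeff p i \<in> tower_fil B y us (n - i)" using Cons.prems by auto
  have "y ^ n * z = (\<Sum>i\<le>n. (y ^ (n - i) * coeff p i) * u ^ i)"
    unfolding p(1) poly_altdef_le[OF p(2)] sum_distrib_left
  proof (rule sum.cong[OF refl])
    fix i assume "i \<in> {..n}"
    then have "y ^ n = y ^ i * y ^ (n - i)" by (simp add: power_add[symmetric])
    then show "y ^ n * (coeff p i * (u / y) ^ i) = y ^ (n - i) * coeff p i * u ^ i"
      using y by (simp add: power_divide)
  qed
  also have "\<dots> \<in> ideal_pow A m (n + k)"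
  proof (rule ideal_sum[OF ideal_ideal_pow[OF A m]])
    fix i assume i: "i \<in> {..n}"
    have "y ^ (n - i) * coeff p i \<in> ideal_pow A m (n - i + k)" using Cons.IH[of "coeff p i" "n - i"] Cons.prems p by auto
    moreover have "u ^ i \<in> ideal_pow A m i" using ideal_pow_elem[OF A m] Cons.prems by auto
    ultimately have "(y ^ (n - i) * coeff p i) * u ^ i \<in> ideal_pow A m ((n - i + k) + i)" by (rule ideal_pow_mult[OF A m])
    then show "(y ^ (n - i) * coeff p i) * u ^ i \<in> ideal_pow A m (n + k)" using i by simp
  qed
  finally show ?case .
qed

text \<open>Modulo an ideal with \<open>y\<close> and \<open>u\<close> in it, \<open>u / y\<close>
  is an indeterminate, so membership passes to the coefficients. Only empty \<open>ws\<close> is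
  used later; general \<open>ws\<close> carries the induction.\<close>

lemma tower_fil_Int_ideal:
  assumes "regsys A (y # us @ ws)"
  shows "z \<in> tower_fil A y us n \<Longrightarrow> z \<in> gen_ideal (tower_ring A y us) (insert y (set ws)) \<Longrightarrow> z \<in> tower_fil (max_ideal A) y us n"
  using assms
proof (induction us arbitrary: ws z n)
  case Nil then show ?case by (simp add: regsys_def)
next
  case (Cons u us)
  have rs: "regsys A (y # us @ u # ws)" by (rule regsys_perm[OF Cons.prems(3)]) auto
  have sub: "set (y # u # us @ ws) \<subseteq> A" and A: "local_ring A" using Cons.prems by (auto simp: regsys_def)
  note sA = local_subring[OF A]
  interpret elementary_blowup "tower_ring A y us" y u using tower[of A y "u # us" ws] Cons.prems by simp
  obtain p where p: "z = poly p t" "degree p \<le> n" "\<And>i. coeff p i \<in> tower_fil A y us (n - i)" using Cons.prems by auto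
  have pT: "coeff p i \<in> tower_ring A y us" for i using p(3)[of i] tower_fil_sub_ring[OF sA] by blast
  have wsC: "set ws \<subseteq> tower_ring A y us" using sub tower_ring_incl[OF sA] by fastforce
  define J where "J = gen_ideal (tower_ring A y us) (insert y (insert u (set ws)))"
  have J: "sr_ideal (tower_ring A y us) J" unfolding J_def by (rule ideal_gen[OF C]) (use wsC y u in auto)
  have JJ: "y \<in> J" "u \<in> J" unfolding J_def using gen_ideal_incl[OF C, of "insert y (insert u (set ws))"] by auto
  have "z \<in> padj J t" using Cons.prems(2) gen_padj[OF wsC] by (simp add: J_def)
  then have "coeff p i \<in> J" for i using coeffs_in_ideal[OF J JJ pT] p by simp
  then have "coeff p i \<in> tower_fil (max_ideal A) y us (n - i)" for i
    using Cons.IH[OF p(3) _ rs, of i] by (simp add: J_def)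
  then show ?case using p by auto
qed

text \<open>The chart \<open>E = A[m/y]\<close> of the blow-up of the maximal ideal; \<open>E / yE\<close> is a polynomial ring over
  the residue field in the classes of the quotients \<open>u / y\<close>.\<close>
locale chart =
  fixes A :: "'a::field set" and y :: 'a and us :: "'a list"
  assumes rs: "regsys A (y # us)"
begin

abbreviation "m \<equiv> max_ideal A"
definition "E = ring_adj A {a / y | a. a \<in> m}"

lemma A: "local_ring A" "noetherian A" using rs by (auto simp: regsys_def)
lemma sA: "subring A" using A local_subring by auto
lemma im: "sr_ideal A m" using A local_max by auto
lemma gens: "gen_ideal A (set (y # us)) = m" using rs by (auto simp: regsys_def)
lemma gens_m: "set (y # us) \<subseteq> m" using gen_ideal_incl[OF sA, of "set (y # us)"] gens by auto
lemma y_m: "y \<in> m" using gens_m by auto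
lemma yA: "y \<in> A" using y_m max_sub by auto
lemma y0: "y \<noteq> 0"
proof -
  have "y \<notin> gen_ideal A (set us)" using regsys_not_redundant[of A "[]" y us] rs by simp
  then show ?thesis using ideal_0[OF ideal_gen[OF sA, of "set us"]] rs by (auto simp: regsys_def)
qed

lemma m_tower_fil: "a \<in> m \<Longrightarrow> a / y \<in> tower_fil A y us (Suc 0)"
proof -
  define K where "K = {a \<in> A. a / y \<in> tower_fil A y us (Suc 0)}"
  have "sr_ideal A K" unfolding sr_ideal_def
  proof (intro conjI ballI)
    show "0 \<in> K" unfolding K_def using subring_0[OF sA] tower_fil_zero[OF subring_0[OF sA]] by simp
    fix x assume x: "x \<in> K"
    { fix z assume "z \<in> K" then show "x + z \<in> K" using x tower_fil_add[OF ideal_self[OF sA]] subring_add[OF sA]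
        by (auto simp: K_def add_divide_distrib) }
    { fix a assume a: "a \<in> A"
      then have "a * (x / y) \<in> tower_fil A y us (0 + Suc 0)" using x tower_fil_const[OF subring_0[OF sA], of y us 0]
        by (intro tower_fil_mult[OF sA]) (auto simp: K_def)
      then show "a * x \<in> K" using a x subring_mult[OF sA] by (auto simp: K_def) }
  qed (auto simp: K_def)
  moreover have "set (y # us) \<subseteq> K"
    using gens_m max_sub[of _ A] tower_fil_gen[OF sA, of _ us y] y0 set_mp[OF tower_fil_const[OF subring_0[OF sA]] subring_1[OF sA]]
    by (auto simp: K_def)
  ultimately have "m \<subseteq> K" using gen_ideal_least gens by metis
  then show "a \<in> m \<Longrightarrow> a / y \<in> tower_fil A y us (Suc 0)" by (auto simp: K_def)
qed

lemma E_tower_ring: "E = tower_ring A y us"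
proof
  show "E \<subseteq> tower_ring A y us" unfolding E_def
    using m_tower_fil tower_fil_sub_ring[OF sA, of y us "Suc 0"] by (intro ring_adj_least tower_ring_subring[OF sA]) (auto intro: set_mp[OF tower_ring_incl[OF sA]])
  show "tower_ring A y us \<subseteq> E" unfolding E_def
  proof (rule tower_ring_least[OF ring_adj_subring[OF sA]])
    show "A \<subseteq> ring_adj A {a / y |a. a \<in> m}" using ring_adj_incl by blast
    show "u / y \<in> ring_adj A {a / y |a. a \<in> m}" if "u \<in> set us" for u
      using that gens_m ring_adj_incl[of A "{a / y |a. a \<in> m}"] by auto
  qed
qed

lemma sE: "subring E" unfolding E_tower_ring by (rule tower_ring_subring[OF sA])
lemma AE: "A \<subseteq> E" unfolding E_tower_ring by (rule tower_ring_incl[OF sA])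
lemma yE: "y \<in> E" using yA AE by auto
lemma mE: "a \<in> m \<Longrightarrow> a / y \<in> E" unfolding E_def using ring_adj_incl[of A "{a / y |a. a \<in> m}"] by auto
lemma iyE: "sr_ideal E (prin E y)" by (rule ideal_prin[OF sE yE])

lemma m_sub_yE: "m \<subseteq> prin E y"
proof
  fix a assume "a \<in> m"
  then have "a = y * (a / y)" "a / y \<in> E" using y0 mE by auto
  then show "a \<in> prin E y" unfolding prin_def by blast
qed

lemma prime_yE: "sr_prime E (prin E y)"
  using tower[of A y us "[]"] rs gen_ideal_single[OF sE yE] by (simp add: E_tower_ring)

lemma pow_tower_fil: "a \<in> ideal_pow A m n \<Longrightarrow> a / y ^ n \<in> tower_fil A y us n"
proof (induction n arbitrary: a)
  case 0 then show ?case using tower_fil_const[OF subring_0[OF sA]] by auto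
next
  case (Suc n)
  define K where "K = {a \<in> A. a / y ^ Suc n \<in> tower_fil A y us (Suc n)}"
  have K: "sr_ideal A K" unfolding sr_ideal_def
  proof (intro conjI ballI)
    show "0 \<in> K" unfolding K_def using subring_0[OF sA] tower_fil_zero[OF subring_0[OF sA]] by simp
    fix x assume x: "x \<in> K"
    { fix z assume "z \<in> K" then show "x + z \<in> K" using x tower_fil_add[OF ideal_self[OF sA]] subring_add[OF sA]
        by (auto simp: K_def add_divide_distrib) }
    { fix a assume a: "a \<in> A"
      then have "a * (x / y ^ Suc n) \<in> tower_fil A y us (0 + Suc n)" using x tower_fil_const[OF subring_0[OF sA], of y us 0]
        by (intro tower_fil_mult[OF sA]) (auto simp: K_def)
      then show "a * x \<in> K" using a x subring_mult[OF sA] by (auto simp: K_def) }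
  qed (auto simp: K_def)
  have "iprod A (ideal_pow A m n) m \<subseteq> K"
  proof (rule iprod_least[OF K])
    fix a b assume ab: "a \<in> ideal_pow A m n" "b \<in> m"
    have "(a / y ^ n) * (b / y) \<in> tower_fil A y us (n + Suc 0)" by (rule tower_fil_mult[OF sA Suc.IH[OF ab(1)] m_tower_fil[OF ab(2)]])
    moreover have "a * b \<in> A" using ab ideal_memD[OF ideal_ideal_pow[OF sA im]] max_sub subring_mult[OF sA] by blast
    ultimately show "a * b \<in> K" by (simp add: K_def mult.commute)
  qed
  then show ?case using Suc.prems unfolding ideal_pow_Suc_iprod by (auto simp: K_def)
qed

lemma pow_E: "a \<in> ideal_pow A m n \<Longrightarrow> a / y ^ n \<in> E"
  using pow_tower_fil tower_fil_sub_ring[OF sA] unfolding E_tower_ring by blast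

text \<open>If \<open>y\<close> divides \<open>a / y ^ n\<close> in \<open>E\<close>, all its tower
  coefficients can be taken in \<open>m\<close>, and clearing the denominators again gains one more
  power of \<open>m\<close>.\<close>

lemma pow_step: assumes "a \<in> ideal_pow A m n" "a / y ^ n \<in> prin E y" shows "a \<in> ideal_pow A m (Suc n)"
proof -
  have "a / y ^ n \<in> gen_ideal (tower_ring A y us) (insert y (set []))"
    using assms(2) gen_ideal_single[OF sE yE] by (simp add: E_tower_ring)
  then have "a / y ^ n \<in> tower_fil m y us n" using tower_fil_Int_ideal[of A y us "[]"] rs pow_tower_fil[OF assms(1)] by simp
  moreover have "m \<subseteq> ideal_pow A m (Suc 0)" using ideal_pow_1[OF sA im] by simp
  moreover have "set us \<subseteq> m" using gens_m by auto
  ultimately have "y ^ n * (a / y ^ n) \<in> ideal_pow A m (n + Suc 0)"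
    using tower_fil_pow[OF sA im y_m y0] by blast
  then show ?thesis using y0 by simp
qed

lemma E_pow: assumes "z \<in> E" shows "\<exists>n. y ^ n * z \<in> ideal_pow A m n"
proof -
  obtain n where n: "z \<in> tower_fil A y us n" using tower_ring_sub_fil[OF sA, of z y us] assms unfolding E_tower_ring by auto
  have "A \<subseteq> ideal_pow A m 0" by simp
  moreover have "set us \<subseteq> m" using gens_m by auto
  ultimately have "y ^ n * z \<in> ideal_pow A m (n + 0)" using tower_fil_pow[OF sA im y_m y0 _ _ n] by blast
  then show ?thesis by auto
qed

end

text \<open>For \<open>a \<noteq> 0\<close> in \<open>A\<close> this is the largest \<open>n\<close>
  with \<open>a\<close> in the \<open>n\<close>-th power of the maximal ideal, as
  \<open>ordn_iff\<close> confirms; exponent 0 never fails, hence the shift by \<open>Suc\<close>.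
  At \<open>0\<close> the value is junk.\<close>

definition ordn :: "'a::field set \<Rightarrow> 'a \<Rightarrow> nat" where
  "ordn A a = (LEAST n. a \<notin> ideal_pow A (max_ideal A) (Suc n))"

text \<open>Any representation of \<open>z \<noteq> 0\<close> as a quotient of elements of \<open>A\<close> gives the same integer; the value at \<open>0\<close> is junk.\<close>
definition ordv :: "'a::field set \<Rightarrow> 'a \<Rightarrow> int" where
  "ordv A z = (SOME k. \<exists>a\<in>A. \<exists>b\<in>A. a \<noteq> 0 \<and> b \<noteq> 0 \<and> z = a / b \<and> k = int (ordn A a) - int (ordn A b))"

context chart
begin

lemma ordn_iff: assumes a: "a \<in> A" "a \<noteq> 0" shows "a \<in> ideal_pow A m n \<longleftrightarrow> n \<le> ordn A a"
proof -
  have ex: "\<exists>n. a \<notin> ideal_pow A m (Suc n)"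
  proof (rule ccontr)
    assume "\<not> ?thesis"
    then have "a \<in> ideal_pow A m n" for n using a by (cases n) auto
    then show False using krull_intersection[OF A] a by blast
  qed
  have n1: "a \<notin> ideal_pow A m (Suc (ordn A a))" unfolding ordn_def by (rule LeastI_ex[OF ex])
  have n2: "a \<in> ideal_pow A m (Suc k)" if "k < ordn A a" for k
    using not_less_Least[OF that[unfolded ordn_def]] by simp
  show ?thesis
  proof
    assume "a \<in> ideal_pow A m n"
    then show "n \<le> ordn A a" using n1 ideal_pow_antimono[OF sA im, of "Suc (ordn A a)" n] by (meson not_less_eq_eq subsetD)
  next
    assume "n \<le> ordn A a"
    then show "a \<in> ideal_pow A m n" using n2[of "n - 1"] a by (cases n) auto
  qed
qed

lemma ordn_unit: assumes a: "a \<in> A" "a \<noteq> 0" shows "a / y ^ ordn A a \<in> E - prin E y"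
proof -
  have "a \<in> ideal_pow A m (ordn A a)" "a \<notin> ideal_pow A m (Suc (ordn A a))" using ordn_iff[OF a] by auto
  then show ?thesis using pow_E pow_step by blast
qed

text \<open>The proper transforms of \<open>a\<close> and \<open>b\<close> in \<open>E\<close> lie
  outside the prime ideal \<open>yE\<close>, hence so does their product.\<close>

lemma ordn_mult: assumes a: "a \<in> A" "a \<noteq> 0" and b: "b \<in> A" "b \<noteq> 0" shows "ordn A (a * b) = ordn A a + ordn A b"
proof (rule antisym)
  have ab: "a * b \<in> A" "a * b \<noteq> 0" using a b subring_mult[OF sA] by auto
  have "a * b \<in> ideal_pow A m (ordn A a + ordn A b)"
    using ordn_iff[OF a] ordn_iff[OF b] by (intro ideal_pow_mult[OF sA im]) auto
  then show "ordn A a + ordn A b \<le> ordn A (a * b)" using ordn_iff[OF ab] by simp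
  show "ordn A (a * b) \<le> ordn A a + ordn A b"
  proof (rule ccontr)
    assume "\<not> ?thesis"
    then have "a * b \<in> ideal_pow A m (Suc (ordn A a + ordn A b))" using ordn_iff[OF ab] by simp
    then have "a * b / y ^ Suc (ordn A a + ordn A b) \<in> E" by (rule pow_E)
    then have "y * (a * b / y ^ Suc (ordn A a + ordn A b)) \<in> prin E y" by (rule prin_mult)
    moreover have "y * (a * b / y ^ Suc (ordn A a + ordn A b)) = (a / y ^ ordn A a) * (b / y ^ ordn A b)"
      using y0 by (simp add: power_add)
    ultimately show False using primeD[OF prime_yE, of "a / y ^ ordn A a" "b / y ^ ordn A b"] ordn_unit[OF a] ordn_unit[OF b] by auto
  qed
qed

lemma ordn_add: assumes a: "a \<in> A" "a \<noteq> 0" and b: "b \<in> A" "b \<noteq> 0" and ab: "a + b \<noteq> 0"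
  shows "min (ordn A a) (ordn A b) \<le> ordn A (a + b)"
proof -
  let ?k = "min (ordn A a) (ordn A b)"
  have "a \<in> ideal_pow A m ?k" "b \<in> ideal_pow A m ?k" using ordn_iff[OF a] ordn_iff[OF b] by auto
  then have "a + b \<in> ideal_pow A m ?k" by (rule ideal_add[OF ideal_ideal_pow[OF sA im]])
  then show ?thesis using ordn_iff[OF subring_add[OF sA a(1) b(1)] ab] by simp
qed

end

locale qchart = chart +
  assumes quot: "has_quotient_field A"
begin

lemma frac: assumes "z \<noteq> 0" obtains a b where "a \<in> A" "b \<in> A" "a \<noteq> 0" "b \<noteq> 0" "z = a / b"
proof -
  obtain a b where "a \<in> A" "b \<in> A" "b \<noteq> 0" "z = a / b" using quot unfolding has_quotient_field_def by blast
  then show ?thesis using that[of a b] assms by auto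
qed

lemma ordv_frac: assumes a: "a \<in> A" "a \<noteq> 0" and b: "b \<in> A" "b \<noteq> 0"
  shows "ordv A (a / b) = int (ordn A a) - int (ordn A b)"
proof -
  have "\<exists>c\<in>A. \<exists>d\<in>A. c \<noteq> 0 \<and> d \<noteq> 0 \<and> a / b = c / d \<and> ordv A (a / b) = int (ordn A c) - int (ordn A d)"
    unfolding ordv_def by (rule someI_ex) (use a b in blast)
  then obtain c d where cd: "c \<in> A" "d \<in> A" "c \<noteq> 0" "d \<noteq> 0" "a / b = c / d" "ordv A (a / b) = int (ordn A c) - int (ordn A d)" by blast
  have "a * d = c * b" using cd a b by (simp add: field_simps)
  then have "ordn A a + ordn A d = ordn A c + ordn A b" using ordn_mult[OF a cd(2,4)] ordn_mult[OF cd(1,3) b] by simp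
  then show ?thesis using cd by linarith
qed

lemma ordv_A: assumes a: "a \<in> A" "a \<noteq> 0" shows "ordv A a = int (ordn A a)"
proof -
  have "\<not> Suc 0 \<le> ordn A 1" using ordn_iff[of 1 "Suc 0"] subring_1[OF sA] ideal_pow_1[OF sA im] one_notin_max[OF sA] by simp
  then show ?thesis using ordv_frac[OF a, of 1] subring_1[OF sA] by simp
qed

lemma ordv_mult: assumes "z \<noteq> 0" "w \<noteq> 0" shows "ordv A (z * w) = ordv A z + ordv A w"
proof -
  obtain a b where ab: "a \<in> A" "b \<in> A" "a \<noteq> 0" "b \<noteq> 0" "z = a / b" using frac[OF assms(1)] .
  obtain c d where cd: "c \<in> A" "d \<in> A" "c \<noteq> 0" "d \<noteq> 0" "w = c / d" using frac[OF assms(2)] .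
  have "ordv A ((a * c) / (b * d)) = int (ordn A (a * c)) - int (ordn A (b * d))"
    using ab cd by (intro ordv_frac subring_mult[OF sA]) auto
  then show ?thesis using ab cd by (simp add: ordn_mult ordv_frac)
qed

lemma ordv_add: assumes "z \<noteq> 0" "w \<noteq> 0" "z + w \<noteq> 0" shows "min (ordv A z) (ordv A w) \<le> ordv A (z + w)"
proof -
  obtain a b where ab: "a \<in> A" "b \<in> A" "a \<noteq> 0" "b \<noteq> 0" "z = a / b" using frac[OF assms(1)] .
  obtain c d where cd: "c \<in> A" "d \<in> A" "c \<noteq> 0" "d \<noteq> 0" "w = c / d" using frac[OF assms(2)] .
  have 1: "z = (a * d) / (b * d)" "w = (c * b) / (b * d)" using ab cd by auto
  have 2: "z + w = (a * d + c * b) / (b * d)" unfolding 1 by (simp add: add_divide_distrib)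
  then have nz: "a * d + c * b \<noteq> 0" using assms by auto
  have m: "a * d \<in> A" "c * b \<in> A" "b * d \<in> A" "a * d \<noteq> 0" "c * b \<noteq> 0" "b * d \<noteq> 0" using ab cd subring_mult[OF sA] by auto
  have "ordv A z = int (ordn A (a * d)) - int (ordn A (b * d))" unfolding 1 using m by (intro ordv_frac)
  moreover have "ordv A w = int (ordn A (c * b)) - int (ordn A (b * d))" unfolding 1 using m by (intro ordv_frac)
  moreover have "ordv A (z + w) = int (ordn A (a * d + c * b)) - int (ordn A (b * d))"
    unfolding 2 using m nz subring_add[OF sA] by (intro ordv_frac) auto
  moreover have "min (ordn A (a * d)) (ordn A (c * b)) \<le> ordn A (a * d + c * b)" using m nz by (intro ordn_add)
  ultimately show ?thesis by linarith
qed

lemma ordv_iff: "a \<in> A \<Longrightarrow> a \<noteq> 0 \<Longrightarrow> a \<in> ideal_pow A m n \<longleftrightarrow> int n \<le> ordv A a"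
  using ordn_iff ordv_A by simp

lemma ord_ordn: assumes a: "a \<in> A" "a \<noteq> 0" shows "ord A a = enat (ordn A a)"
proof -
  have "{n. a \<in> ideal_pow A m n} = {..ordn A a}" using ordn_iff[OF a] by auto
  then have "ord A a = Sup (enat ` {..ordn A a})" using a by (simp add: ord_def)
  also have "\<dots> = enat (ordn A a)" by (rule Sup_eqI) auto
  finally show ?thesis .
qed

lemma ord_valring_iff: "z \<in> ord_valring A \<longleftrightarrow> z = 0 \<or> 0 \<le> ordv A z"
proof
  assume "z \<in> ord_valring A"
  then obtain a b where ab: "z = a / b" "a \<in> A" "b \<in> A" "b \<noteq> 0" "ord A b \<le> ord A a" by (auto simp: ord_valring_def)
  show "z = 0 \<or> 0 \<le> ordv A z"
  proof (cases "a = 0")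
    case False
    then show ?thesis using ab ord_ordn[of a] ord_ordn[of b] ordv_frac[of a b] by simp
  qed (use ab in auto)
next
  assume z: "z = 0 \<or> 0 \<le> ordv A z"
  show "z \<in> ord_valring A"
  proof (cases "z = 0")
    case True
    have "ord A 1 \<le> ord A 0" by (simp add: ord_def)
    then show ?thesis unfolding ord_valring_def True using subring_0[OF sA] subring_1[OF sA]
      by (intro CollectI exI[of _ 0] exI[of _ 1]) simp
  next
    case False
    obtain a b where ab: "a \<in> A" "b \<in> A" "a \<noteq> 0" "b \<noteq> 0" "z = a / b" using frac[OF False] .
    then have "ord A b \<le> ord A a" using z False ordv_frac[of a b] ord_ordn[of a] ord_ordn[of b] by simp
    then show ?thesis unfolding ord_valring_def using ab by blast
  qed
qed

end

section \<open>Local quadratic transforms\<close>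

lemma coeff_pcompose_ideal:
  assumes B: "subring B" and J: "sr_ideal B J" and q: "\<And>i. coeff q i \<in> B"
  shows "(\<And>i. coeff p i \<in> J) \<Longrightarrow> coeff (pcompose p q) i \<in> J"
proof (induction p arbitrary: i)
  case 0 then show ?case using ideal_0[OF J] by simp
next
  case (pCons a p)
  have a: "a \<in> J" using pCons.prems[of 0] by simp
  have p: "coeff p i \<in> J" for i using pCons.prems[of "Suc i"] by simp
  have "coeff (q * pcompose p q) i \<in> J" by (rule coeff_mult_ideal[OF J q pCons.IH[OF p]])
  moreover have "coeff [:a:] i \<in> J" by (rule coeff_const_in[OF ideal_0[OF J] a])
  ultimately show ?case unfolding pcompose_pCons coeff_add using ideal_add[OF J] by blast
qed

context qchart
begin

lemma ordn_y: "ordn A y = Suc 0"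
proof -
  have "Suc 0 \<le> ordn A y" using ordn_iff[OF yA y0, of "Suc 0"] ideal_pow_1[OF sA im] y_m by blast
  moreover have "\<not> Suc (Suc 0) \<le> ordn A y"
  proof
    assume "Suc (Suc 0) \<le> ordn A y"
    then have "y / y ^ Suc (Suc 0) \<in> E" using ordn_iff[OF yA y0] pow_E by blast
    then have "y * (y / y ^ Suc (Suc 0)) \<in> prin E y" by (rule prin_mult)
    then show False using prime_one[OF prime_yE] y0 by simp
  qed
  ultimately show ?thesis by simp
qed

lemma ordv_y: "ordv A y = 1" using ordv_A[OF yA y0] ordn_y by simp

lemma ordv_one: "ordv A 1 = 0" using ordv_mult[of 1 1] by simp

lemma ordv_pow: "z \<noteq> 0 \<Longrightarrow> ordv A (z ^ n) = int n * ordv A z"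
  by (induction n) (auto simp: ordv_mult ordv_one algebra_simps)

lemma ordv_divide: assumes "z \<noteq> 0" "w \<noteq> 0" shows "ordv A (z / w) = ordv A z - ordv A w"
  using ordv_mult[of "z / w" w] assms by simp

lemma E_ordv: assumes "e \<in> E" "e \<noteq> 0" shows "0 \<le> ordv A e"
proof -
  obtain n where n: "y ^ n * e \<in> ideal_pow A m n" using E_pow[OF assms(1)] by blast
  have "y ^ n * e \<in> A" using n ideal_memD[OF ideal_ideal_pow[OF sA im]] by blast
  then have "int n \<le> ordv A (y ^ n * e)" using ordv_iff[of "y ^ n * e" n] n assms y0 by simp
  then show ?thesis using ordv_mult[of "y ^ n" e] ordv_pow[OF y0] ordv_y assms y0 by simp
qed

text \<open>Positive order puts \<open>y ^ n * e\<close> into the power of \<open>m\<close> with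
  exponent \<open>Suc n\<close>, and division by \<open>y ^ Suc n\<close> leads back into
  \<open>E\<close>.\<close>

lemma E_ordv_pos: assumes "e \<in> E" "e \<noteq> 0" "1 \<le> ordv A e" shows "e \<in> prin E y"
proof -
  obtain n where n: "y ^ n * e \<in> ideal_pow A m n" using E_pow[OF assms(1)] by blast
  have A': "y ^ n * e \<in> A" using n ideal_memD[OF ideal_ideal_pow[OF sA im]] by blast
  have "int (Suc n) \<le> ordv A (y ^ n * e)" using ordv_mult[of "y ^ n" e] ordv_pow[OF y0] ordv_y assms y0 by simp
  then have "y ^ n * e \<in> ideal_pow A m (Suc n)" using ordv_iff[OF A', of "Suc n"] assms y0 by simp
  then have "y ^ n * e / y ^ Suc n \<in> E" by (rule pow_E)
  then have "y * (y ^ n * e / y ^ Suc n) \<in> prin E y" by (rule prin_mult)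
  then show ?thesis using y0 by simp
qed

lemma A_div_E: assumes "a \<in> A" "a \<noteq> 0" "int k \<le> ordv A a" shows "a / y ^ k \<in> E"
  using ordv_iff[OF assms(1,2), of k] assms pow_E by simp

end

locale qtrans = qchart +
  fixes q B :: "'a set"
  assumes q: "sr_prime E q" and mq: "m \<subseteq> q" and B_eq: "B = loc_at E q"
begin

lemma iq: "sr_ideal E q" by (rule prime_ideal[OF q])
lemma lB: "local_ring B" unfolding B_eq by (rule loc_local[OF sE q])
lemma sB: "subring B" using lB local_subring by auto
lemma imB: "sr_ideal B (max_ideal B)" using lB local_max by auto
lemma EB: "E \<subseteq> B" unfolding B_eq by (rule loc_incl[OF sE q])
lemma AB: "A \<subseteq> B" using AE EB by auto
lemma mB: "max_ideal B = ext_loc E q q" unfolding B_eq by (rule loc_max[OF sE q])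
lemma mB_E: "max_ideal B \<inter> E = q" unfolding mB by (rule ext_loc_Int_prime[OF sE q q subset_refl])
lemma m_mB: "m \<subseteq> max_ideal B" using mq mB_E by blast
lemma yB: "y \<in> B" using yE EB by auto
lemma yE_q: "prin E y \<subseteq> q" using prin_least[OF iq] mq y_m by auto
lemma divB: "a \<in> m \<Longrightarrow> a / y \<in> B" using mE EB by auto

lemma B_rep: assumes "b \<in> B" obtains e g where "b = e / g" "e \<in> E" "g \<in> E" "g \<notin> q" "g \<noteq> 0"
  using assms prime_0[OF q] unfolding B_eq by (elim loc_atE) (metis)

lemma notin_q_ordv: assumes "g \<in> E" "g \<notin> q" shows "ordv A g = 0"
proof -
  have "g \<noteq> 0" using assms prime_0[OF q] by auto
  then show ?thesis using E_ordv[OF assms(1)] E_ordv_pos[OF assms(1)] yE_q assms(2) by (smt (verit) subsetD)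
qed

lemma B_ordv: assumes "b \<in> B" "b \<noteq> 0" shows "0 \<le> ordv A b"
proof -
  obtain e g where eg: "b = e / g" "e \<in> E" "g \<in> E" "g \<notin> q" "g \<noteq> 0" using B_rep[OF assms(1)] .
  then show ?thesis using assms notin_q_ordv[OF eg(3,4)] E_ordv[OF eg(2)] ordv_divide[of e g] by auto
qed

lemma B_ordv_pos: assumes "b \<in> B" "b \<noteq> 0" shows "b \<in> prin B y \<longleftrightarrow> 1 \<le> ordv A b"
proof
  assume "b \<in> prin B y"
  then obtain c where "c \<in> B" "b = y * c" by (auto simp: prin_def)
  then show "1 \<le> ordv A b" using assms ordv_mult[of y c] ordv_y B_ordv[of c] by auto
next
  assume o: "1 \<le> ordv A b"
  obtain e g where eg: "b = e / g" "e \<in> E" "g \<in> E" "g \<notin> q" "g \<noteq> 0" using B_rep[OF assms(1)] .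
  then have "1 \<le> ordv A e" "e \<noteq> 0" using assms o notin_q_ordv[OF eg(3,4)] ordv_divide[of e g] by auto
  then have "e \<in> prin E y" using E_ordv_pos eg by blast
  then obtain c where c: "c \<in> E" "e = y * c" by (auto simp: prin_def)
  have "c / g \<in> B" unfolding B_eq using c eg by (auto intro: loc_atI)
  then have "y * (c / g) \<in> prin B y" by (rule prin_mult)
  then show "b \<in> prin B y" using eg c by simp
qed

text \<open>\<open>symb_ord f n\<close>: modulo \<open>yE\<close>, the element \<open>f\<close> lies in the \<open>n\<close>-th symbolic power of \<open>q\<close>.\<close>
inductive symb_ord :: "'a \<Rightarrow> nat \<Rightarrow> bool" where
  base: "f \<in> E \<Longrightarrow> symb_ord f 0"
| exc: "f \<in> prin E y \<Longrightarrow> symb_ord f n"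
| add: "symb_ord f n \<Longrightarrow> symb_ord g n \<Longrightarrow> symb_ord (f + g) n"
| scal: "e \<in> E \<Longrightarrow> symb_ord f n \<Longrightarrow> symb_ord (e * f) n"
| step: "symb_ord f n \<Longrightarrow> g \<in> q \<Longrightarrow> symb_ord (f * g) (Suc n)"
| sat: "u \<in> E \<Longrightarrow> u \<notin> q \<Longrightarrow> f \<in> E \<Longrightarrow> symb_ord (u * f) n \<Longrightarrow> symb_ord f n"
| dec: "symb_ord f (Suc n) \<Longrightarrow> symb_ord f n"

lemma symb_ord_E: "symb_ord f n \<Longrightarrow> f \<in> E"
  by (induction rule: symb_ord.induct) (auto intro: subring_add[OF sE] subring_mult[OF sE] ideal_memD[OF iyE] ideal_memD[OF iq])

lemma symb_ord_q: "symb_ord f n \<Longrightarrow> n \<ge> 1 \<Longrightarrow> f \<in> q"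
proof (induction rule: symb_ord.induct)
  case (exc f n) then show ?case using yE_q by auto
next
  case (add f n g) then show ?case using ideal_add[OF iq] by auto
next
  case (scal e f n) then show ?case using ideal_mult[OF iq] by auto
next
  case (step f n g) then show ?case using ideal_mult[OF iq symb_ord_E[OF step(1)]] by auto
next
  case (sat u f n) then show ?case using primeD[OF q sat(1,3)] by auto
qed auto

lemma symb_ord_zero: "symb_ord 0 n" by (rule symb_ord.exc[OF ideal_0[OF iyE]])

lemma symb_ord_diff: assumes "symb_ord f n" "symb_ord g n" shows "symb_ord (f - g) n"
proof -
  have "symb_ord ((-1) * g) n" by (rule symb_ord.scal[OF subring_uminus[OF sE subring_1[OF sE]] assms(2)])
  then have "symb_ord (f + (-1) * g) n" by (rule symb_ord.add[OF assms(1)])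
  then show ?thesis by simp
qed

lemma symb_ord_sum: "(\<And>i. i \<in> K \<Longrightarrow> symb_ord (f i) n) \<Longrightarrow> symb_ord (sum f K) n"
  by (induction K rule: infinite_finite_induct) (auto intro: symb_ord_zero symb_ord.add)

lemma symb_ord_le: assumes "k \<le> n" "symb_ord f n" shows "symb_ord f k"
  using assms by (induction rule: inc_induct) (auto intro: symb_ord.dec)

text \<open>Taylor expansion at \<open>t\<close> modulo \<open>yE\<close>: the \<open>r\<close>-th Hasse derivative with respect to one variable
  lowers the symbolic order at \<open>q\<close> by at most \<open>r\<close>.\<close>
lemma taylor:
  assumes C: "subring C" "C \<subseteq> E" and t: "t \<in> E" and EC: "E = padj C t"
    and indep: "\<And>p i. (\<And>i. coeff p i \<in> C) \<Longrightarrow> poly p t \<in> prin E y \<Longrightarrow> coeff p i \<in> prin E y"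
    and "symb_ord f n" and p: "\<And>i. coeff p i \<in> C" "poly p t = f"
  shows "symb_ord (coeff (pcompose p [:t, 1:]) r) (n - r)"
proof -
  \<comment> \<open>\<open>\<tau> p\<close> is \<open>p(t + X)\<close>; its coefficients are the
    Hasse derivatives of \<open>p\<close> at \<open>t\<close>.\<close>
  define \<tau> where "\<tau> p = pcompose p [:t, 1:]" for p
  define T where "T f n \<longleftrightarrow> (\<exists>p. (\<forall>i. coeff p i \<in> C) \<and> poly p t = f \<and> (\<forall>r. symb_ord (coeff (\<tau> p) r) (n - r)))" for f n
  have tE: "coeff [:t, 1:] i \<in> E" for i using t sE by (auto simp: coeff_pCons intro: subring_intros split: nat.split)
  have tauE: "coeff (\<tau> p) r \<in> E" if "\<And>i. coeff p i \<in> C" for p r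
    unfolding \<tau>_def by (rule coeff_pcompose_ideal[OF sE ideal_self[OF sE] tE]) (use that C in blast)
  have tau0: "coeff (\<tau> p) 0 = poly p t" for p
    by (simp add: \<tau>_def poly_0_coeff_0[symmetric] poly_pcompose)
  have tauy: "coeff (\<tau> p) r \<in> prin E y" if "\<And>i. coeff p i \<in> C" "poly p t \<in> prin E y" for p r
    unfolding \<tau>_def by (rule coeff_pcompose_ideal[OF sE iyE tE indep[OF that]])
  have tmult: "\<tau> (p * r) = \<tau> p * \<tau> r" and tadd: "\<tau> (p + r) = \<tau> p + \<tau> r" and tdiff: "\<tau> (p - r) = \<tau> p - \<tau> r" for p r
    by (simp_all add: \<tau>_def pcompose_mult pcompose_add pcompose_diff)
  \<comment> \<open>Two polynomials representing \<open>f\<close> differ by one with coefficients in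
    \<open>yE\<close>, so the estimate is independent of the choice. The saturation case below needs
    it for an arbitrary representative.\<close>
  have all: "symb_ord (coeff (\<tau> p) r) (n - r)" if T: "T f n" and p: "\<And>i. coeff p i \<in> C" "poly p t = f" for f n p r
  proof -
    obtain p0 where p0: "\<And>i. coeff p0 i \<in> C" "poly p0 t = f" "\<And>r. symb_ord (coeff (\<tau> p0) r) (n - r)" using T by (auto simp: T_def)
    have "coeff (\<tau> (p - p0)) r \<in> prin E y"
      using p p0 ideal_0[OF iyE] subring_diff[OF C(1)] by (intro tauy) auto
    then have "symb_ord (coeff (\<tau> p0) r + coeff (\<tau> (p - p0)) r) (n - r)" using p0(3) symb_ord.exc symb_ord.add by blast
    then show ?thesis by (simp add: tdiff)
  qed
  have rep: "\<exists>p. (\<forall>i. coeff p i \<in> C) \<and> poly p t = f" if "f \<in> E" for f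
    using that unfolding EC by (auto simp: padj_def)
  have "T f n" using \<open>symb_ord f n\<close>
  proof (induction rule: symb_ord.induct)
    case (base f)
    obtain p where p: "\<forall>i. coeff p i \<in> C" "poly p t = f" using rep[OF base] by blast
    then show ?case unfolding T_def using tauE by (intro exI[of _ p]) (auto intro: symb_ord.base)
  next
    case (exc f n)
    obtain p where p: "\<forall>i. coeff p i \<in> C" "poly p t = f" using rep[OF ideal_memD[OF iyE exc]] by blast
    then show ?case unfolding T_def using tauy exc by (intro exI[of _ p]) (auto intro: symb_ord.exc)
  next
    case (add f n g)
    obtain p where p: "\<forall>i. coeff p i \<in> C" "poly p t = f" "\<forall>r. symb_ord (coeff (\<tau> p) r) (n - r)" using add.IH by (auto simp: T_def)
    obtain p' where p': "\<forall>i. coeff p' i \<in> C" "poly p' t = g" "\<forall>r. symb_ord (coeff (\<tau> p') r) (n - r)" using add.IH by (auto simp: T_def)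
    show ?case unfolding T_def using p p' subring_add[OF C(1)] symb_ord.add by (intro exI[of _ "p + p'"]) (auto simp: tadd)
  next
    case (scal e f n)
    obtain p where p: "\<And>i. coeff p i \<in> C" "poly p t = f" "\<And>r. symb_ord (coeff (\<tau> p) r) (n - r)" using scal.IH by (auto simp: T_def)
    obtain p' where p': "\<And>i. coeff p' i \<in> C" "poly p' t = e" using rep[OF scal(1)] by blast
    have "symb_ord (coeff (\<tau> p' * \<tau> p) r) (n - r)" for r unfolding coeff_mult
      using symb_ord_le[OF _ p(3)] tauE[OF p'(1)] by (intro symb_ord_sum symb_ord.scal) auto
    then show ?case unfolding T_def using p p' coeff_mult_ideal[OF ideal_self[OF C(1)] p'(1) p(1)]
      by (intro exI[of _ "p' * p"]) (auto simp: tmult)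
  next
    case (step f n g)
    obtain p where p: "\<And>i. coeff p i \<in> C" "poly p t = f" "\<And>r. symb_ord (coeff (\<tau> p) r) (n - r)" using step.IH by (auto simp: T_def)
    obtain p' where p': "\<And>i. coeff p' i \<in> C" "poly p' t = g" using rep[OF ideal_memD[OF iq step(2)]] by blast
    have "symb_ord (coeff (\<tau> p * \<tau> p') r) (Suc n - r)" for r unfolding coeff_mult
    proof (rule symb_ord_sum)
      fix i assume i: "i \<in> {..r}"
      show "symb_ord (coeff (\<tau> p) i * coeff (\<tau> p') (r - i)) (Suc n - r)"
      \<comment> \<open>Only in the term \<open>i = r\<close> does the full order \<open>r\<close>
        get lost; there the other factor is the constant coefficient \<open>g \<in> q\<close>, which
        restores one unit.\<close>
      proof (cases "i = r")
        case True
        have g: "coeff (\<tau> p') (r - i) \<in> q" using True tau0 p' step(2) by simp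
        show ?thesis
        proof (cases "r \<le> n")
          case True
          have "symb_ord (coeff (\<tau> p) i * coeff (\<tau> p') (r - i)) (Suc (n - r))" using symb_ord.step[OF p(3)[of i] g] \<open>i = r\<close> by simp
          then show ?thesis using True by (simp add: Suc_diff_le)
        next
          case False
          then show ?thesis using symb_ord.base[OF subring_mult[OF sE tauE[OF p(1)] tauE[OF p'(1)]]] by simp
        qed
      next
        case False
        then have "Suc n - r \<le> n - i" using i by auto
        then have "symb_ord (coeff (\<tau> p) i) (Suc n - r)" using symb_ord_le p(3) by blast
        then have "symb_ord (coeff (\<tau> p') (r - i) * coeff (\<tau> p) i) (Suc n - r)" by (rule symb_ord.scal[OF tauE[OF p'(1)]])
        then show ?thesis by (simp add: mult.commute)
      qed
    qed
    then show ?case unfolding T_def using p p' coeff_mult_ideal[OF ideal_self[OF C(1)] p(1) p'(1)]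
      by (intro exI[of _ "p * p'"]) (auto simp: tmult)
  next
    case (sat u f n)
    obtain p where p: "\<And>i. coeff p i \<in> C" "poly p t = f" using rep[OF sat(3)] by blast
    obtain p' where p': "\<And>i. coeff p' i \<in> C" "poly p' t = u" using rep[OF sat(1)] by blast
    have pr: "symb_ord (coeff (\<tau> p' * \<tau> p) r) (n - r)" for r
      using all[OF sat.IH, of "p' * p" r] p p' coeff_mult_ideal[OF ideal_self[OF C(1)] p'(1) p(1)] by (simp add: tmult)
    \<comment> \<open>The constant coefficient of \<open>\<tau> p'\<close> is \<open>u\<close>,
      outside \<open>q\<close>; the other summands involve lower coefficients of
      \<open>\<tau> p\<close>, known by induction.\<close>
    have "symb_ord (coeff (\<tau> p) r) (n - r)" for r
    proof (induction r rule: less_induct)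
      case (less r)
      have "coeff (\<tau> p' * \<tau> p) r = u * coeff (\<tau> p) r + (\<Sum>i\<in>{..r} - {0}. coeff (\<tau> p') i * coeff (\<tau> p) (r - i))"
        unfolding coeff_mult by (subst sum.remove[of _ 0]) (auto simp: tau0 p')
      moreover have "symb_ord (\<Sum>i\<in>{..r} - {0}. coeff (\<tau> p') i * coeff (\<tau> p) (r - i)) (n - r)"
      proof (intro symb_ord_sum symb_ord.scal tauE[OF p'(1)])
        fix i assume "i \<in> {..r} - {0}"
        then have "r - i < r" by auto
        then have "symb_ord (coeff (\<tau> p) (r - i)) (n - (r - i))" by (rule less)
        then show "symb_ord (coeff (\<tau> p) (r - i)) (n - r)" by (rule symb_ord_le[rotated]) auto
      qed
      ultimately have "symb_ord (u * coeff (\<tau> p) r) (n - r)" using symb_ord_diff[OF pr[of r]] by fastforce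
      then show ?case by (rule symb_ord.sat[OF sat(1,2) tauE[OF p(1)]])
    qed
    then show ?case unfolding T_def using p by blast
  next
    case (dec f n)
    obtain p where p: "\<And>i. coeff p i \<in> C" "poly p t = f" "\<And>r. symb_ord (coeff (\<tau> p) r) (Suc n - r)" using dec.IH by (auto simp: T_def)
    have "symb_ord (coeff (\<tau> p) r) (n - r)" for r using symb_ord_le[OF _ p(3)[of r], of "n - r"] by simp
    then show ?case unfolding T_def using p by blast
  qed
  from all[OF this p] show ?thesis by (simp add: \<tau>_def)
qed

text \<open>The leading coefficient with respect to one variable is a Hasse derivative, so the variables can be
  removed one after the other.\<close>
lemma symb_ord_degree:
  assumes "regsys A (y # us1 @ us2)" "f \<in> tower_fil A y us1 s" "f \<notin> prin E y" "symb_ord f n"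
  shows "n \<le> s"
  using assms
proof (induction us1 arbitrary: us2 f s n)
  case Nil
  show ?case
  proof (rule ccontr)
    assume "\<not> n \<le> s"
    then have "f \<in> q" using symb_ord_q[OF Nil.prems(4)] by simp
    have fA: "f \<in> A" using Nil by simp
    moreover have "f \<notin> m" using Nil.prems m_sub_yE by auto
    ultimately have "f \<noteq> 0" "inverse f \<in> A" using nonmax_unit by auto
    then have "inverse f * f \<in> q" using ideal_mult[OF iq _ \<open>f \<in> q\<close>] AE by blast
    then show False using prime_one[OF q] \<open>f \<noteq> 0\<close> by simp
  qed
next
  case (Cons u us1)
  \<comment> \<open>\<open>us2\<close> keeps the variables already removed, so that \<open>E\<close>
    is generated over \<open>?C\<close> by the single element \<open>t = u / y\<close>.\<close>
  let ?C = "tower_ring A y (us1 @ us2)"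
  interpret c: chart A y "u # us1 @ us2" using Cons.prems(1) by unfold_locales simp
  interpret elementary_blowup ?C y u using tower[of A y "u # us1 @ us2" "[]"] c.rs by simp
  have EC: "E = padj ?C t" using c.E_tower_ring by simp
  have CE: "?C \<subseteq> E" unfolding EC by (rule padj_const[OF subring_0[OF C]])
  have tE: "t \<in> E" unfolding EC by (rule padj_gen[OF C])
  define J where "J = gen_ideal ?C (insert y (insert u {}))"
  have J: "sr_ideal ?C J" unfolding J_def by (rule ideal_gen[OF C]) (use y u in auto)
  have JJ: "y \<in> J" "u \<in> J" unfolding J_def using gen_ideal_incl[OF C, of "insert y (insert u {})"] by auto
  have gE: "prin E y = padj J t" using gen_padj[of "{}"] gen_ideal_single[OF sE yE] by (simp add: J_def EC)
  have JE: "J \<subseteq> prin E y" unfolding gE by (rule padj_const[OF ideal_0[OF J]])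
  have indep: "coeff p i \<in> prin E y" if "\<And>i. coeff p i \<in> ?C" "poly p t \<in> prin E y" for p i
    using coeffs_in_ideal[OF J JJ that(1)] that(2) JE unfolding gE by blast
  obtain p where p: "f = poly p t" "degree p \<le> s" "\<And>i. coeff p i \<in> tower_fil A y us1 (s - i)" using Cons.prems(2) by auto
  have pC: "coeff p i \<in> ?C" for i
    using p(3)[of i] tower_fil_sub_ring[OF sA, of y us1] tower_ring_mono[OF sA, of us1 "us1 @ us2" y] by auto
  have "\<exists>i. coeff p i \<notin> prin E y"
    using poly_in_ideal[OF sE iyE _ tE, of p] Cons.prems(3) p(1) by blast
  then obtain i0 where i0: "coeff p i0 \<notin> prin E y" by blast
  \<comment> \<open>This is the degree of \<open>p\<close> modulo \<open>yE\<close>. The coefficient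
    there survives the shift up to \<open>yE\<close>, and it has degree at most \<open>s - r\<close>
    in the remaining variables.\<close>
  define r where "r = (GREATEST i. coeff p i \<notin> prin E y)"
  have bd: "\<forall>i. coeff p i \<notin> prin E y \<longrightarrow> i \<le> s"
    using p(2) ideal_0[OF iyE] by (metis coeff_eq_0 le_less_trans not_le)
  have r: "coeff p r \<notin> prin E y" unfolding r_def by (rule GreatestI_nat[of _ i0 s]) (use i0 bd in auto)
  have rs': "r \<le> s" using r bd by blast
  have above: "coeff p i \<in> prin E y" if "i > r" for i
    using Greatest_le_nat[of "\<lambda>i. coeff p i \<notin> prin E y" i s] bd that by (fastforce simp: r_def)
  have Q: "symb_ord (coeff (pcompose p [:t, 1:]) r) (n - r)"
    by (rule taylor[OF C CE tE EC indep Cons.prems(4) pC p(1)[symmetric]])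
  define p1 where "p1 = (\<Sum>i\<le>r. monom (coeff p i) i)"
  define p2 where "p2 = p - p1"
  have c1: "coeff p1 i = (if i \<le> r then coeff p i else 0)" for i
    unfolding p1_def coeff_sum coeff_monom by (simp add: if_distrib cong: if_cong)
  have d1: "degree p1 \<le> r" by (rule degree_le) (simp add: c1)
  have tE': "coeff [:t, 1:] i \<in> E" for i using tE sE by (auto simp: coeff_pCons intro: subring_intros split: nat.split)
  have "coeff p2 i \<in> prin E y" for i using above[of i] ideal_0[OF iyE] by (auto simp: p2_def c1)
  then have "coeff (pcompose p2 [:t, 1:]) r \<in> prin E y" by (rule coeff_pcompose_ideal[OF sE iyE tE'])
  then have Q2: "symb_ord (coeff (pcompose p2 [:t, 1:]) r) (n - r)" by (rule symb_ord.exc)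
  have top: "coeff (pcompose w [:t, 1:]) r = coeff w r" if dw: "degree w \<le> r" for w :: "'a poly"
  proof (cases "degree w = r")
    case True
    have "degree (pcompose w [:t, 1:]) = r" using True degree_pcompose[of w "[:t, 1:]"] by simp
    then have "coeff (pcompose w [:t, 1:]) r = lead_coeff (pcompose w [:t, 1:])" by simp
    also have "\<dots> = lead_coeff w" using lead_coeff_comp[of "[:t, 1:]" w] by simp
    finally show ?thesis using True by simp
  next
    case False
    then have "degree w < r" using dw by simp
    then show ?thesis using degree_pcompose[of w "[:t, 1:]"] by (simp add: coeff_eq_0)
  qed
  have "coeff (pcompose p [:t, 1:]) r = coeff p r + coeff (pcompose p2 [:t, 1:]) r"
    using top[OF d1] by (simp add: p2_def pcompose_diff c1)
  then have "symb_ord (coeff p r) (n - r)" using symb_ord_diff[OF Q Q2] by simp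
  moreover have "regsys A (y # us1 @ u # us2)" by (rule regsys_perm[OF Cons.prems(1)]) auto
  ultimately have "n - r \<le> s - r" using Cons.IH[OF _ p(3) r] by blast
  then show ?case using rs' by linarith
qed

text \<open>Elements of \<open>E\<close> outside \<open>q\<close> are invertible in \<open>B\<close>
  and clear denominators; the clauses of \<open>symb_ord\<close> cover every operation that then
  occurs.\<close>

lemma pow_symb_ord: assumes "f \<in> ideal_pow B (max_ideal B) n" shows "\<exists>u\<in>E. u \<notin> q \<and> symb_ord (u * f) n"
  using assms
proof (induction n arbitrary: f)
  case 0
  then obtain e g where "f = e / g" "e \<in> E" "g \<in> E" "g \<notin> q" "g \<noteq> 0" using B_rep[of f] by auto
  then show ?case by (intro bexI[of _ g]) (auto intro: symb_ord.base)
next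
  case (Suc n)
  define K where "K = {f \<in> B. \<exists>u\<in>E. u \<notin> q \<and> symb_ord (u * f) (Suc n)}"
  have K: "sr_ideal B K" unfolding sr_ideal_def
  proof (intro conjI ballI)
    show "0 \<in> K" unfolding K_def using subring_0[OF sB] subring_1[OF sE] prime_one[OF q] symb_ord_zero by (auto intro!: bexI[of _ 1])
    fix a assume "a \<in> K"
    then obtain u where u: "a \<in> B" "u \<in> E" "u \<notin> q" "symb_ord (u * a) (Suc n)" by (auto simp: K_def)
    { fix b assume "b \<in> K"
      then obtain v where v: "b \<in> B" "v \<in> E" "v \<notin> q" "symb_ord (v * b) (Suc n)" by (auto simp: K_def)
      have "symb_ord (v * (u * a) + u * (v * b)) (Suc n)"
        by (rule symb_ord.add[OF symb_ord.scal[OF v(2) u(4)] symb_ord.scal[OF u(2) v(4)]])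
      then have "symb_ord ((u * v) * (a + b)) (Suc n)" by (simp add: algebra_simps)
      moreover have "u * v \<in> E - q" using prime_mult_notin[OF q _ _ sE] u v by auto
      ultimately show "a + b \<in> K" unfolding K_def using u v subring_add[OF sB] by auto }
    { fix b assume b: "b \<in> B"
      then obtain e g where g: "b = e / g" "e \<in> E" "g \<in> E" "g \<notin> q" "g \<noteq> 0" using B_rep by blast
      have "symb_ord (e * (u * a)) (Suc n)" by (rule symb_ord.scal[OF g(2) u(4)])
      then have "symb_ord ((u * g) * (b * a)) (Suc n)" using g by (simp add: algebra_simps)
      moreover have "u * g \<in> E - q" using prime_mult_notin[OF q _ _ sE] u g by auto
      ultimately show "b * a \<in> K" unfolding K_def using u b subring_mult[OF sB] by auto }
  qed (auto simp: K_def)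
  have "iprod B (ideal_pow B (max_ideal B) n) (max_ideal B) \<subseteq> K"
  proof (rule iprod_least[OF K])
    fix a b assume ab: "a \<in> ideal_pow B (max_ideal B) n" "b \<in> max_ideal B"
    obtain u where u: "u \<in> E" "u \<notin> q" "symb_ord (u * a) n" using Suc.IH[OF ab(1)] by blast
    obtain h w where w: "b = h / w" "h \<in> q" "w \<in> E" "w \<notin> q" using ab(2) unfolding mB ext_loc_def by blast
    have w0: "w \<noteq> 0" using w prime_0[OF q] by auto
    have "symb_ord ((u * a) * h) (Suc n)" by (rule symb_ord.step[OF u(3) w(2)])
    then have "symb_ord ((u * w) * (a * b)) (Suc n)" using w w0 by (simp add: algebra_simps)
    moreover have "u * w \<in> E - q" using prime_mult_notin[OF q _ _ sE] u w by auto
    moreover have "a * b \<in> B" using ab ideal_memD[OF ideal_ideal_pow[OF sB imB]] max_sub subring_mult[OF sB] by blast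
    ultimately show "a * b \<in> K" unfolding K_def by auto
  qed
  then show ?case using Suc.prems unfolding ideal_pow_Suc_iprod K_def by blast
qed

text \<open>The proper transform \<open>f\<close> has degree at most \<open>ordn A a\<close> in the
  quotients \<open>u / y\<close> and lies outside \<open>yE\<close>, so
  \<open>symb_ord_degree\<close> bounds its order in \<open>B\<close>. The term with
  \<open>ordv B y\<close> accounts for the power of \<open>y\<close> split off.\<close>

lemma ordv_transform:
  assumes B': "qchart B y' us'" and a: "a \<in> A" "a \<noteq> 0"
  shows "ordv B a \<le> ordv A a * (ordv B y + 1)"
proof -
  interpret b: qchart B y' us' by (rule B')
  let ?s = "ordn A a"
  define f where "f = a / y ^ ?s"
  have f: "f \<in> E" "f \<notin> prin E y" using ordn_unit[OF a] by (auto simp: f_def)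
  have fF: "f \<in> tower_fil A y us ?s" unfolding f_def using ordn_iff[OF a] by (intro pow_tower_fil) auto
  have f0: "f \<noteq> 0" using a y0 by (simp add: f_def)
  have "ordv B f \<le> int ?s"
  proof (rule ccontr)
    assume "\<not> ?thesis"
    then have "int (Suc ?s) \<le> ordv B f" by simp
    then have "f \<in> ideal_pow B (max_ideal B) (Suc ?s)" using b.ordv_iff[of f "Suc ?s"] f f0 EB by auto
    then obtain u where u: "u \<in> E" "u \<notin> q" "symb_ord (u * f) (Suc ?s)" using pow_symb_ord by blast
    have "symb_ord f (Suc ?s)" by (rule symb_ord.sat[OF u(1,2) f(1) u(3)])
    then have "Suc ?s \<le> ?s" using symb_ord_degree[of us "[]" f ?s "Suc ?s"] rs fF f by simp
    then show False by simp
  qed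
  moreover have "a = f * y ^ ?s" using y0 by (simp add: f_def)
  then have "ordv B a = ordv B f + int ?s * ordv B y" using b.ordv_mult[of f "y ^ ?s"] b.ordv_pow[OF y0] f0 y0 by simp
  ultimately show ?thesis using ordv_A[OF a] by (simp add: algebra_simps)
qed

section \<open>Prime elements under a local quadratic transform\<close>

lemma y_prime_B: "sr_prime B (prin B y)"
proof (rule primeI[OF sB ideal_prin[OF sB yB]])
  show "1 \<notin> prin B y" using B_ordv_pos[of 1] subring_1[OF sB] ordv_one by simp
  fix a b assume ab: "a \<in> B" "b \<in> B" "a * b \<in> prin B y"
  show "a \<in> prin B y \<or> b \<in> prin B y"
  proof (cases "a = 0 \<or> b = 0")
    case True then show ?thesis using ideal_0[OF ideal_prin[OF sB yB]] by auto
  next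
    case False
    then have "1 \<le> ordv A a + ordv A b" using B_ordv_pos[of "a * b"] subring_mult[OF sB] ab ordv_mult[of a b] by auto
    then have "1 \<le> ordv A a \<or> 1 \<le> ordv A b" by linarith
    then show ?thesis using B_ordv_pos ab False by auto
  qed
qed

text \<open>Powers of \<open>y\<close> carry elements of \<open>E\<close> into \<open>A\<close>,
  where \<open>p\<close> is prime. As \<open>p\<close> does not divide \<open>y\<close>, these
  powers can be cancelled again.\<close>

lemma prime_transform:
  assumes p: "p \<in> A" "p \<noteq> 0" "sr_prime A (prin A p)" and pm: "p / y ^ ordn A p \<in> max_ideal B"
  shows "sr_prime B (prin B (p / y ^ ordn A p))" "\<And>a. a \<in> A \<Longrightarrow> a \<in> prin B (p / y ^ ordn A p) \<Longrightarrow> a \<in> prin A p"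
proof -
  let ?o = "ordn A p"
  define p' where "p' = p / y ^ ?o"
  have p'E: "p' \<in> E" using ordn_unit[OF p(1,2)] by (simp add: p'_def)
  have p'0: "p' \<noteq> 0" using p y0 by (simp add: p'_def)
  have p'q: "p' \<in> q" using pm p'E mB_E by (auto simp: p'_def)
  have p'B: "p' \<in> B" using p'E EB by auto
  have pp: "p = p' * y ^ ?o" using y0 by (simp add: p'_def)
  \<comment> \<open>Otherwise, by comparison of orders, \<open>p\<close> has order 1 and its
    cofactor \<open>c\<close> in \<open>y\<close> has order 0; then \<open>p' * c = 1\<close>,
    although \<open>p'\<close> lies in \<open>q\<close>.\<close>
  have yn: "y \<notin> prin A p"
  proof
    assume "y \<in> prin A p"
    then obtain c where c: "y = p * c" "c \<in> A" by (auto simp: prin_def)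
    have c0: "c \<noteq> 0" using c y0 by auto
    have s: "Suc 0 = ?o + ordn A c" using ordn_mult[OF p(1,2) c(2) c0] ordn_y c by simp
    have "p \<in> m"
    proof (rule ccontr)
      assume "p \<notin> m"
      then have "inverse p \<in> A" using nonmax_unit p by auto
      then have "p * inverse p \<in> prin A p" by (rule prin_mult)
      then show False using p prime_one[OF p(3)] by simp
    qed
    then have "Suc 0 \<le> ?o" using ordn_iff[OF p(1,2), of "Suc 0"] ideal_pow_1[OF sA im] by simp
    then have o: "?o = Suc 0" "ordn A c = 0" using s by auto
    then have "p' * c = 1" using c p y0 by (simp add: p'_def)
    then have "1 \<in> q" using ideal_multr[OF iq _ p'q, of c] c AE by auto
    then show False using prime_one[OF q] by simp
  qed
  have yrn: "y ^ r \<notin> prin A p" for r using prime_powD[OF sA p(3) yA] yn by blast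
  have clear: "\<exists>R. y ^ R * f \<in> A" if "f \<in> E" for f
    using E_pow[OF that] ideal_memD[OF ideal_ideal_pow[OF sA im]] by blast
  have clearI: "y ^ R' * f \<in> A" if "y ^ R * f \<in> A" "R \<le> R'" for R R' f
  proof -
    have "y ^ R' * f = y ^ (R' - R) * (y ^ R * f)" using that(2) by (simp add: power_add[symmetric] mult.assoc[symmetric])
    then show ?thesis using subring_mult[OF sA subring_power[OF sA yA] that(1)] by metis
  qed
  \<comment> \<open>If \<open>y ^ r * f = p * c\<close>, the order of \<open>c\<close> is at least
    \<open>r - ?o\<close>, so any excess power of \<open>y\<close> divides \<open>c\<close> inside
    \<open>E\<close>.\<close>
  have D1: "f \<in> prin E p'" if f: "f \<in> E" "y ^ r * f \<in> prin A p" for f r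
  proof (cases "f = 0")
    case True then show ?thesis using ideal_0[OF ideal_prin[OF sE p'E]] by simp
  next
    case False
    obtain c where c: "y ^ r * f = p * c" "c \<in> A" using f(2) by (auto simp: prin_def)
    have c0: "c \<noteq> 0" using c False y0 by auto
    have "int r + ordv A f = int ?o + ordv A c"
      using ordv_mult[of "y ^ r" f] ordv_mult[of p c] ordv_pow[OF y0, of r] ordv_y ordv_A[OF p(1,2)] c False c0 p y0 by simp
    then have oc: "int r - int ?o \<le> ordv A c" using E_ordv[OF f(1) False] by linarith
    have "\<exists>h\<in>E. f = p' * h"
    proof (cases "r \<le> ?o")
      case True
      have "y ^ r * (p' * (c * y ^ (?o - r))) = p' * (y ^ r * y ^ (?o - r)) * c" by (simp add: ac_simps)
      also have "y ^ r * y ^ (?o - r) = y ^ ?o" using True by (simp add: power_add[symmetric])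
      finally have "y ^ r * (p' * (c * y ^ (?o - r))) = y ^ r * f" using pp c by simp
      then have "f = p' * (c * y ^ (?o - r))" using y0 by simp
      moreover have "c * y ^ (?o - r) \<in> E" using c AE by (intro subring_mult[OF sE] subring_power[OF sE yE]) auto
      ultimately show ?thesis by blast
    next
      case False
      then have "int (r - ?o) \<le> ordv A c" using oc by (simp add: of_nat_diff)
      then have "c / y ^ (r - ?o) \<in> E" by (rule A_div_E[OF c(2) c0])
      moreover have "y ^ r = y ^ ?o * y ^ (r - ?o)" using False by (simp add: power_add[symmetric])
      then have "y ^ r * (p' * (c / y ^ (r - ?o))) = (p' * y ^ ?o) * c" using y0 by simp
      then have "y ^ r * (p' * (c / y ^ (r - ?o))) = y ^ r * f" using pp c by metis
      then have "f = p' * (c / y ^ (r - ?o))" using y0 by (metis mult_left_cancel power_not_zero)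
      ultimately show ?thesis by blast
    qed
    then show ?thesis by (auto simp: prin_def)
  qed
  \<comment> \<open>The denominator \<open>g\<close> is outside \<open>q\<close>, which contains
    \<open>p'\<close>; by \<open>D1\<close>, \<open>p\<close> does not divide
    \<open>y ^ R * g\<close>, so it divides the cleared form of \<open>f\<close>.\<close>
  have D2: "\<exists>r. y ^ r * f \<in> A \<and> y ^ r * f \<in> prin A p" if f: "f \<in> E" "f \<in> prin B p'" for f
  proof -
    obtain b where b: "f = p' * b" "b \<in> B" using f(2) by (auto simp: prin_def)
    obtain e g where g: "b = e / g" "e \<in> E" "g \<in> E" "g \<notin> q" "g \<noteq> 0" using B_rep[OF b(2)] .
    have gf: "g * f = p' * e" using b g by simp
    obtain R1 R2 R3 where R: "y ^ R1 * f \<in> A" "y ^ R2 * e \<in> A" "y ^ R3 * g \<in> A" using clear f g by meson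
    define R where "R = R1 + R2 + R3"
    have RA: "y ^ R * f \<in> A" "y ^ R * e \<in> A" "y ^ R * g \<in> A" "y ^ (R + ?o) * f \<in> A"
      using clearI R by (auto simp: R_def)
    have "(y ^ R * g) * (y ^ (R + ?o) * f) = y ^ R * y ^ R * y ^ ?o * (g * f)" by (simp add: power_add ac_simps)
    also have "\<dots> = p * ((y ^ R * e) * y ^ R)" unfolding gf using pp by (simp add: ac_simps)
    also have "\<dots> \<in> prin A p" by (rule prin_mult[OF subring_mult[OF sA RA(2) subring_power[OF sA yA]]])
    finally have "y ^ R * g \<in> prin A p \<or> y ^ (R + ?o) * f \<in> prin A p" using primeD[OF p(3)] RA by blast
    moreover have "y ^ R * g \<notin> prin A p"
    proof
      assume "y ^ R * g \<in> prin A p"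
      then have "g \<in> prin E p'" using D1[OF g(3)] by blast
      then have "g \<in> q" using prin_least[OF iq p'q] by blast
      then show False using g by simp
    qed
    ultimately show ?thesis using RA by blast
  qed
  have EBp: "prin E p' \<subseteq> prin B p'" using EB by (auto simp: prin_def)
  have "sr_prime B (prin B p')"
  proof (rule primeI[OF sB ideal_prin[OF sB p'B]])
    show "1 \<notin> prin B p'"
      using prin_least[OF imB, of p'] pm one_notin_max[OF sB] by (auto simp: p'_def)
    fix a b assume ab: "a \<in> B" "b \<in> B" "a * b \<in> prin B p'"
    obtain e g where g: "a = e / g" "e \<in> E" "g \<in> E" "g \<notin> q" "g \<noteq> 0" using B_rep[OF ab(1)] .
    obtain e' g' where g': "b = e' / g'" "e' \<in> E" "g' \<in> E" "g' \<notin> q" "g' \<noteq> 0" using B_rep[OF ab(2)] .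
    have "e * e' = (g * g') * (a * b)" using g g' by simp
    then have "e * e' \<in> prin B p'" using ideal_mult[OF ideal_prin[OF sB p'B] _ ab(3), of "g * g'"] g g' EB subring_mult[OF sB] by auto
    then obtain r where r: "y ^ r * (e * e') \<in> prin A p" using D2 subring_mult[OF sE g(2) g'(2)] by blast
    obtain R1 R2 where R: "y ^ R1 * e \<in> A" "y ^ R2 * e' \<in> A" using clear g g' by meson
    define R where "R = R1 + R2"
    have RA: "y ^ R * e \<in> A" "y ^ (R + r) * e' \<in> A" using clearI R by (auto simp: R_def)
    have "(y ^ R * e) * (y ^ (R + r) * e') = y ^ (R + R) * (y ^ r * (e * e'))" by (simp add: power_add ac_simps)
    also have "\<dots> \<in> prin A p" by (rule ideal_mult[OF prime_ideal[OF p(3)] subring_power[OF sA yA] r])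
    finally have "y ^ R * e \<in> prin A p \<or> y ^ (R + r) * e' \<in> prin A p" using primeD[OF p(3) RA] by blast
    then have "e \<in> prin B p' \<or> e' \<in> prin B p'" using D1 g g' EBp by blast
    moreover have inv: "1 / g \<in> B" "1 / g' \<in> B" unfolding B_eq using g g' subring_1[OF sE] by (auto intro: loc_atI)
    ultimately have "1 / g * e \<in> prin B p' \<or> 1 / g' * e' \<in> prin B p'" using ideal_mult[OF ideal_prin[OF sB p'B]] by blast
    then show "a \<in> prin B p' \<or> b \<in> prin B p'" using g g' by simp
  qed
  then show "sr_prime B (prin B (p / y ^ ?o))" by (simp add: p'_def)
  show "a \<in> prin A p" if a: "a \<in> A" "a \<in> prin B (p / y ^ ?o)" for a
  proof -
    obtain r where "y ^ r * a \<in> prin A p" using D2[of a] a AE by (auto simp: p'_def)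
    then show ?thesis using primeD[OF p(3) subring_power[OF sA yA] a(1)] yrn by blast
  qed
qed

end

section \<open>Sequences of local quadratic transforms\<close>

locale qseq =
  fixes R :: "nat \<Rightarrow> 'a::field set" and yy :: "nat \<Rightarrow> 'a" and us :: "nat \<Rightarrow> 'a list" and qq :: "nat \<Rightarrow> 'a set"
  assumes qtr: "\<And>i. qtrans (R i) (yy i) (us i) (qq i) (R (Suc i))"
    and regR: "\<And>i. regular_local (R i)"
begin

sublocale t: qtrans "R i" "yy i" "us i" "qq i" "R (Suc i)" for i by (rule qtr)

abbreviation "v i \<equiv> ordv (R i)"
definition "S = (\<Union>i. R i)"
definition "N = (\<Union>i. max_ideal (R i))"
definition "V = boundary_valring R"

lemma R_mono: "i \<le> j \<Longrightarrow> R i \<subseteq> R j"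
  by (rule lift_Suc_mono_le[of R]) (rule t.AB)
lemma m_mono: "i \<le> j \<Longrightarrow> max_ideal (R i) \<subseteq> max_ideal (R j)"
  by (rule lift_Suc_mono_le[of "\<lambda>i. max_ideal (R i)"]) (rule t.m_mB)

lemma S_two: assumes "a \<in> S" "b \<in> S" obtains i where "a \<in> R i" "b \<in> R i"
proof -
  obtain i j where "a \<in> R i" "b \<in> R j" using assms by (auto simp: S_def)
  then show ?thesis using that[of "max i j"] R_mono[of i "max i j"] R_mono[of j "max i j"] by auto
qed

lemma sS: "subring S"
  unfolding subring_def
proof (intro conjI ballI)
  show "0 \<in> S" "1 \<in> S" using subring_0[OF t.sA] subring_1[OF t.sA] by (auto simp: S_def)
  fix a b assume "a \<in> S" "b \<in> S"
  then obtain i where "a \<in> R i" "b \<in> R i" by (rule S_two)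
  then have "a + b \<in> R i" "a - b \<in> R i" "a * b \<in> R i" by (auto intro: subring_intros t.sA)
  then show "a + b \<in> S" "a - b \<in> S" "a * b \<in> S" by (auto simp: S_def)
qed

lemma N_max: "N = max_ideal S"
proof
  show "N \<subseteq> max_ideal S"
  proof
    fix s assume "s \<in> N"
    then obtain i where i: "s \<in> max_ideal (R i)" by (auto simp: N_def)
    have "inverse s \<notin> S" if "s \<noteq> 0"
    proof
      assume "inverse s \<in> S"
      then obtain j where "inverse s \<in> R j" by (auto simp: S_def)
      then have "inverse s \<in> R (max i j)" "s \<in> max_ideal (R (max i j))"
        using R_mono[of j "max i j"] m_mono[of i "max i j"] i by auto
      then show False using that by (auto simp: max_ideal_def)
    qed
    then show "s \<in> max_ideal S" using max_sub[OF i] by (auto simp: max_ideal_def S_def)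
  qed
  show "max_ideal S \<subseteq> N"
  proof
    fix s assume s: "s \<in> max_ideal S"
    then obtain i where "s \<in> R i" by (auto simp: max_ideal_def S_def)
    then have "s \<in> max_ideal (R i)" using s by (auto simp: max_ideal_def S_def)
    then show "s \<in> N" by (auto simp: N_def)
  qed
qed

lemma V_iff: "z \<in> V \<longleftrightarrow> (\<exists>n. \<forall>i\<ge>n. z = 0 \<or> 0 \<le> v i z)"
  unfolding V_def boundary_valring_def using t.ord_valring_iff by auto

lemma R_v: "z \<in> R i \<Longrightarrow> z \<noteq> 0 \<Longrightarrow> 0 \<le> v i z" using t.ordv_A by auto

lemma SV: "S \<subseteq> V"
proof
  fix z assume "z \<in> S"
  then obtain n where "z \<in> R n" by (auto simp: S_def)
  then have "\<forall>i\<ge>n. z = 0 \<or> 0 \<le> v i z" using R_mono R_v by blast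
  then show "z \<in> V" unfolding V_iff by blast
qed

lemma sV: "subring V"
  unfolding subring_def
proof (intro conjI ballI)
  show "0 \<in> V" "1 \<in> V" using SV sS by (auto intro: subring_intros)
  fix a b assume "a \<in> V" "b \<in> V"
  then obtain n k where nk: "\<forall>i\<ge>n. a = 0 \<or> 0 \<le> v i a" "\<forall>i\<ge>k. b = 0 \<or> 0 \<le> v i b" unfolding V_iff by blast
  have neg: "v i (-b) = v i b" if "b \<noteq> 0" for i
    using t.ordv_mult[of "-1" "-1" i] t.ordv_one[of i] t.ordv_mult[of "-1" b i] that by simp
  have "a * b = 0 \<or> 0 \<le> v i (a * b)" if "i \<ge> max n k" for i
    using nk(1)[rule_format, of i] nk(2)[rule_format, of i] that t.ordv_mult[of a b i]
    by (cases "a = 0"; cases "b = 0") auto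
  then show "a * b \<in> V" unfolding V_iff by blast
  have "a + b = 0 \<or> 0 \<le> v i (a + b)" if "i \<ge> max n k" for i
  proof (cases "a = 0 \<or> b = 0 \<or> a + b = 0")
    case False
    then have "0 \<le> v i a" "0 \<le> v i b" "min (v i a) (v i b) \<le> v i (a + b)" using nk that t.ordv_add[of a b i] by auto
    then show ?thesis by linarith
  qed (use nk that in auto)
  then show "a + b \<in> V" unfolding V_iff by blast
  have "a - b = 0 \<or> 0 \<le> v i (a - b)" if "i \<ge> max n k" for i
  proof (cases "a = 0 \<or> b = 0 \<or> a - b = 0")
    case False
    then have "0 \<le> v i a" "0 \<le> v i b" "min (v i a) (v i b) \<le> v i (a - b)"
      using nk that t.ordv_add[of a "-b" i] neg[of i] by auto
    then show ?thesis by linarith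
  next
    case True
    then show ?thesis using nk that neg[of i] by (cases "b = 0") auto
  qed
  then show "a - b \<in> V" unfolding V_iff by blast
qed

lemma div_next: assumes "w \<in> R i" "w \<noteq> 0" "int k \<le> v i w" shows "w / yy i ^ k \<in> R (Suc i)"
  using t.A_div_E[OF assms] t.EB by blast

lemma v_div: "w \<noteq> 0 \<Longrightarrow> v j (w / yy i ^ k) = v j w - int k * v j (yy i)"
  using t.ordv_divide[of w "yy i ^ k" j] t.ordv_pow[of "yy i" j k] t.y0[of i] by simp

lemma transform_le: assumes "w \<in> R i" "w \<noteq> 0" shows "v (Suc i) (w / yy i ^ nat (v i w)) \<le> v i w"
proof -
  have "v (Suc i) w \<le> v i w * (v (Suc i) (yy i) + 1)"
    by (rule t.ordv_transform[OF t.qchart_axioms assms])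
  then show ?thesis using v_div[OF assms(2), of "Suc i" i "nat (v i w)"] R_v[OF assms] by (simp add: algebra_simps)
qed

text \<open>Dividing numerator and denominator of \<open>z\<close> at each stage by the largest common power of the
  exceptional parameter, the minimum of the two orders never increases; once it is constant the sign cannot change back.\<close>
lemma sign_stable: assumes "z \<noteq> 0"
  shows "(\<exists>n. \<forall>i\<ge>n. 0 \<le> v i z) \<or> (\<exists>n. \<forall>i\<ge>n. v i z \<le> 0)"
proof -
  obtain a b where ab: "a \<in> R 0" "b \<in> R 0" "a \<noteq> 0" "b \<noteq> 0" "z = a / b" using t.frac[OF assms] .
  \<comment> \<open>\<open>c i\<close> is the product of the common powers divided out before stage
    \<open>i\<close>; \<open>e i\<close> is the smaller of the two remaining orders.\<close>
  define c where "c = rec_nat (1::'a) (\<lambda>i c. c * yy i ^ nat (min (v i (a / c)) (v i (b / c))))"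
  have c0: "c 0 = 1" and cS: "c (Suc i) = c i * yy i ^ nat (min (v i (a / c i)) (v i (b / c i)))" for i
    by (simp_all add: c_def)
  define e where "e i = min (v i (a / c i)) (v i (b / c i))" for i
  have inv: "c i \<noteq> 0 \<and> a / c i \<in> R i \<and> b / c i \<in> R i" for i
  proof (induction i)
    case 0 then show ?case using ab c0 by simp
  next
    case (Suc i)
    then have nz: "a / c i \<noteq> 0" "b / c i \<noteq> 0" using ab by auto
    have "0 \<le> e i" using R_v Suc nz by (simp add: e_def)
    then have "int (nat (e i)) \<le> v i (a / c i)" "int (nat (e i)) \<le> v i (b / c i)" by (auto simp: e_def)
    then have "(a / c i) / yy i ^ nat (e i) \<in> R (Suc i)" "(b / c i) / yy i ^ nat (e i) \<in> R (Suc i)"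
      using div_next nz Suc by blast+
    then show ?case using Suc t.y0[of i] by (simp add: cS e_def)
  qed
  have nz: "a / c i \<noteq> 0" "b / c i \<noteq> 0" for i using inv[of i] ab by auto
  have epos: "0 \<le> e i" for i using R_v inv nz by (simp add: e_def)
  have sa: "a / c (Suc i) = (a / c i) / yy i ^ nat (e i)" and sb: "b / c (Suc i) = (b / c i) / yy i ^ nat (e i)" for i
    by (simp_all add: cS e_def)
  have stepa: "v (Suc i) (a / c (Suc i)) \<le> e i" if "v i (a / c i) = e i" for i
    using transform_le[of "a / c i" i] inv[of i] nz(1)[of i] that unfolding sa by simp
  have stepb: "v (Suc i) (b / c (Suc i)) \<le> e i" if "v i (b / c i) = e i" for i
    using transform_le[of "b / c i" i] inv[of i] nz(2)[of i] that unfolding sb by simp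
  have edec: "e (Suc i) \<le> e i" for i
  proof -
    have "v i (a / c i) = e i \<or> v i (b / c i) = e i" by (auto simp: e_def min_def)
    then show ?thesis using stepa[of i] stepb[of i] by (auto simp: e_def[of "Suc i"])
  qed
  have eanti: "i \<le> j \<Longrightarrow> e j \<le> e i" for i j by (rule lift_Suc_antimono_le[of e]) (use edec in auto)
  obtain n where n: "\<And>i. nat (e n) \<le> nat (e i)" using ex_has_least_nat[of "\<lambda>_. True" 0 "\<lambda>i. nat (e i)"] by auto
  have const: "e i = e n" if "i \<ge> n" for i using n[of i] eanti[OF that] epos[of i] epos[of n] by linarith
  have vz: "v i z = v i (a / c i) - v i (b / c i)" for i
    using t.ordv_divide[OF nz(1)[of i] nz(2)[of i], of i] inv[of i] ab by simp
  show ?thesis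
  \<comment> \<open>After stage \<open>n\<close> the minimum is constant and an element attaining it
    cannot rise above it. If the numerator attains it once, it does so from then on and
    \<open>z\<close> has order at most 0; otherwise the denominator always attains it.\<close>
  proof (cases "\<exists>k\<ge>n. v k (a / c k) = e k")
    case True
    then obtain k where k: "k \<ge> n" "v k (a / c k) = e k" by blast
    have "v i (a / c i) = e i" if "i \<ge> k" for i using that
    proof (induction i rule: dec_induct)
      case base then show ?case by (rule k)
    next
      case (step i)
      have "e (Suc i) = e i" using const[of i] const[of "Suc i"] k step by simp
      moreover have "e (Suc i) \<le> v (Suc i) (a / c (Suc i))" by (simp add: e_def)
      ultimately show ?case using stepa[OF step.IH] by simp
    qed
    then have "\<forall>i\<ge>k. v i z \<le> 0" unfolding vz by (simp add: e_def min_def) (metis linorder_le_cases)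
    then show ?thesis by blast
  next
    case False
    have "0 \<le> v i z" if "i \<ge> n" for i
    proof -
      have "v i (a / c i) \<noteq> e i" using False that by blast
      then show ?thesis unfolding vz by (simp add: e_def min_def split: if_splits)
    qed
    then show ?thesis by blast
  qed
qed

lemma V_total: assumes "z \<noteq> 0" shows "z \<in> V \<or> inverse z \<in> V"
proof -
  have "v i (inverse z) = - v i z" for i using t.ordv_mult[of z "inverse z" i] t.ordv_one[of i] assms by simp
  then show ?thesis using sign_stable[OF assms] unfolding V_iff by auto
qed

text \<open>Each prime on the right must divide the cofactor \<open>c\<close>, so all of them cancel
  and leave \<open>w * c = 1\<close>.\<close>

lemma unit_of_prime_factorization:
  assumes B: "subring B" and w: "w \<in> B" "w \<noteq> 0"
    and ps: "\<And>p. p \<in> set ps \<Longrightarrow> p \<in> B \<and> p \<noteq> 0 \<and> sr_prime B (prin B p) \<and> w \<notin> prin B p"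
    and c: "c \<in> B" "w * c = prod_list ps"
  shows "inverse w \<in> B"
  using ps c
proof (induction ps arbitrary: c)
  case Nil
  then have "w * c = 1" by simp
  then have "inverse w = c" by (rule inverse_unique)
  then show ?case using Nil(2) by simp
next
  case (Cons p ps)
  have p: "p \<in> B" "p \<noteq> 0" "sr_prime B (prin B p)" "w \<notin> prin B p" using Cons.prems(1)[of p] by auto
  have psB: "prod_list qs \<in> B" if "set qs \<subseteq> set ps" for qs
    using that Cons.prems(1) by (induction qs) (auto intro: subring_1[OF B] subring_mult[OF B])
  have "w * c \<in> prin B p" using Cons.prems(3) psB prin_mult(1)[of "prod_list ps" B p] by simp
  then have "c \<in> prin B p" using primeD[OF p(3) w(1) Cons.prems(2)] p(4) by blast
  then obtain d where d: "c = p * d" "d \<in> B" by (auto simp: prin_def)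
  have "p * (w * d) = p * prod_list ps" using Cons.prems(3) d(1) by (simp add: ac_simps)
  then have "w * d = prod_list ps" using p by simp
  then show ?case using Cons.IH[of d] Cons.prems(1) d(2) by auto
qed

text \<open>A certificate that \<open>a\<close> and \<open>w\<close> have no common prime factor: if
  \<open>w\<close> also divides \<open>a\<close>, then \<open>w\<close> is a unit
  (\<open>good_fact_dvd_unit\<close>).\<close>

definition good_fact :: "'a set \<Rightarrow> 'a \<Rightarrow> 'a \<Rightarrow> bool" where
  "good_fact B w a \<longleftrightarrow> (\<exists>u ps. u \<in> B \<and> u \<noteq> 0 \<and> inverse u \<in> B \<and> a = u * prod_list ps \<and>
     (\<forall>p\<in>set ps. p \<in> B \<and> p \<noteq> 0 \<and> sr_prime B (prin B p) \<and> w \<notin> prin B p))"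

lemma good_fact_mult: assumes "subring B" "good_fact B w a" "good_fact B w b" shows "good_fact B w (a * b)"
proof -
  obtain u ps where 1: "u \<in> B" "u \<noteq> 0" "inverse u \<in> B" "a = u * prod_list ps"
    "\<forall>p\<in>set ps. p \<in> B \<and> p \<noteq> 0 \<and> sr_prime B (prin B p) \<and> w \<notin> prin B p" using assms(2) by (auto simp: good_fact_def)
  obtain u' ps' where 2: "u' \<in> B" "u' \<noteq> 0" "inverse u' \<in> B" "b = u' * prod_list ps'"
    "\<forall>p\<in>set ps'. p \<in> B \<and> p \<noteq> 0 \<and> sr_prime B (prin B p) \<and> w \<notin> prin B p" using assms(3) by (auto simp: good_fact_def)
  have "a * b = (u * u') * prod_list (ps @ ps')" using 1 2 by (simp add: ac_simps)
  moreover have "u * u' \<in> B" "inverse (u * u') \<in> B" "u * u' \<noteq> 0" using 1 2 subring_mult[OF assms(1)] by auto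
  ultimately show ?thesis unfolding good_fact_def using 1(5) 2(5) by (intro exI[of _ "u * u'"] exI[of _ "ps @ ps'"]) auto
qed

lemma good_fact_unit: "u \<in> B \<Longrightarrow> u \<noteq> 0 \<Longrightarrow> inverse u \<in> B \<Longrightarrow> good_fact B w u"
  unfolding good_fact_def by (intro exI[of _ u] exI[of _ "[]"]) auto

lemma good_fact_prime: "subring B \<Longrightarrow> p \<in> B \<Longrightarrow> p \<noteq> 0 \<Longrightarrow> sr_prime B (prin B p) \<Longrightarrow> w \<notin> prin B p \<Longrightarrow> good_fact B w p"
  unfolding good_fact_def by (intro exI[of _ 1] exI[of _ "[p]"]) (auto intro: subring_1)

lemma good_fact_pow: "subring B \<Longrightarrow> good_fact B w a \<Longrightarrow> good_fact B w (a ^ n)"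
  using good_fact_unit[of 1 B w] subring_1[of B] by (induction n) (auto intro: good_fact_mult)

lemma good_fact_dvd_unit:
  assumes B: "subring B" and w: "w \<in> B" "w \<noteq> 0" and g: "good_fact B w a" and c: "c \<in> B" "w * c = a"
  shows "inverse w \<in> B"
proof -
  obtain u ps where 1: "u \<in> B" "u \<noteq> 0" "inverse u \<in> B" "a = u * prod_list ps"
    "\<And>p. p\<in>set ps \<Longrightarrow> p \<in> B \<and> p \<noteq> 0 \<and> sr_prime B (prin B p) \<and> w \<notin> prin B p" using g by (auto simp: good_fact_def)
  have "w * (inverse u * c) = inverse u * a" using c by (simp add: ac_simps)
  also have "\<dots> = prod_list ps" using 1 by simp
  finally show ?thesis using unit_of_prime_factorization[OF B w 1(5) subring_mult[OF B 1(3) c(1)]] by blast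
qed

text \<open>After division by its full power of \<open>yy i\<close> the element has order 0 at stage
  \<open>i\<close>, so the prime \<open>yy i\<close> no longer divides it.\<close>

lemma good_fact_y:
  assumes "w \<in> R i" "w \<noteq> 0"
  shows "good_fact (R (Suc i)) (w / yy i ^ nat (v i w)) (yy i)"
proof (rule good_fact_prime[OF t.sB t.yB t.y0 t.y_prime_B])
  let ?w = "w / yy i ^ nat (v i w)"
  have "?w \<in> R (Suc i)" using R_v[OF assms] by (intro div_next assms) auto
  moreover have "v i ?w = 0" using v_div[OF assms(2), of i i] t.ordv_y[of i] R_v[OF assms] by simp
  ultimately show "?w \<notin> prin (R (Suc i)) (yy i)" using t.B_ordv_pos[of ?w i] assms t.y0[of i] by auto
qed

text \<open>Each prime factor \<open>p\<close> becomes a power of \<open>yy i\<close> times its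
  proper transform, which is a unit or again prime. In the latter case, dividing the new
  \<open>w\<close> would mean, after contraction, that \<open>p\<close> divides the old one.\<close>

lemma good_fact_step:
  assumes w: "w \<in> R i" "w \<noteq> 0" and g: "good_fact (R i) w a"
  shows "good_fact (R (Suc i)) (w / yy i ^ nat (v i w)) a"
proof -
  let ?w = "w / yy i ^ nat (v i w)"
  obtain u ps where 1: "u \<in> R i" "u \<noteq> 0" "inverse u \<in> R i" "a = u * prod_list ps"
    "\<And>p. p\<in>set ps \<Longrightarrow> p \<in> R i \<and> p \<noteq> 0 \<and> sr_prime (R i) (prin (R i) p) \<and> w \<notin> prin (R i) p" using g by (auto simp: good_fact_def)
  have ww: "w = yy i ^ nat (v i w) * ?w" using t.y0[of i] by simp
  have one: "good_fact (R (Suc i)) ?w p" if p: "p \<in> R i" "p \<noteq> 0" "sr_prime (R i) (prin (R i) p)" "w \<notin> prin (R i) p" for p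
  proof -
    let ?o = "ordn (R i) p" let ?p = "p / yy i ^ ?o"
    have pE: "?p \<in> R (Suc i)" using t.ordn_unit[OF p(1,2)] t.EB by blast
    have p0: "?p \<noteq> 0" using p t.y0[of i] by simp
    have "good_fact (R (Suc i)) ?w ?p"
    proof (cases "?p \<in> max_ideal (R (Suc i))")
      case True
      note pt = t.prime_transform[OF p(1-3) True]
      have "?w \<notin> prin (R (Suc i)) ?p"
      proof
        assume "?w \<in> prin (R (Suc i)) ?p"
        then have "yy i ^ nat (v i w) * ?w \<in> prin (R (Suc i)) ?p"
          by (rule ideal_mult[OF ideal_prin[OF t.sB pE] subring_power[OF t.sB t.yB]])
        then have "w \<in> prin (R (Suc i)) ?p" using ww by metis
        then show False using pt(2)[OF w(1)] p(4) by blast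
      qed
      then show ?thesis using good_fact_prime[OF t.sB pE p0 pt(1)] by blast
    next
      case False then show ?thesis using nonmax_unit[OF pE False] by (intro good_fact_unit pE) auto
    qed
    then have "good_fact (R (Suc i)) ?w (?p * yy i ^ ?o)"
      by (intro good_fact_mult[OF t.sB] good_fact_pow[OF t.sB] good_fact_y[OF w])
    then show ?thesis using t.y0[of i] by simp
  qed
  have "good_fact (R (Suc i)) ?w (prod_list qs)" if "set qs \<subseteq> set ps" for qs using that
  proof (induction qs)
    case Nil then show ?case using subring_1[OF t.sB] by (auto intro: good_fact_unit)
  next
    case (Cons p qs)
    then show ?case using 1(5)[of p] one[of p] by (auto intro: good_fact_mult[OF t.sB])
  qed
  then have "good_fact (R (Suc i)) ?w (prod_list ps)" by blast
  moreover have "good_fact (R (Suc i)) ?w u" using 1(1-3) t.AB[of i] by (intro good_fact_unit) auto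
  ultimately show ?thesis unfolding 1(4) by (intro good_fact_mult[OF t.sB])
qed

text \<open>Since \<open>b\<close> divides a power of \<open>yy n\<close>, its proper transforms eventually become units.\<close>
lemma quotient_in_S:
  assumes a: "a \<in> R n" "a \<noteq> 0" and b: "b \<in> R n" "b \<noteq> 0" and r: "r \<in> S" "yy n ^ K = b * r"
    and pos: "\<And>i. i \<ge> n \<Longrightarrow> 0 \<le> v i (a / b)"
  shows "a / b \<in> S"
proof -
  \<comment> \<open>\<open>c k\<close> gathers the full powers of the exceptional parameters removed
    from \<open>b\<close>; since \<open>a / b\<close> has nonnegative order, the same powers divide
    \<open>a\<close>.\<close>
  define c where "c = rec_nat (1::'a) (\<lambda>k c. c * yy (n + k) ^ nat (v (n + k) (b / c)))"
  have c0: "c 0 = 1" and cS: "c (Suc k) = c k * yy (n + k) ^ nat (v (n + k) (b / c k))" for k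
    by (simp_all add: c_def)
  have inv: "c k \<noteq> 0 \<and> a / c k \<in> R (n + k) \<and> b / c k \<in> R (n + k) \<and> c k \<in> R (n + k)" for k
  proof (induction k)
    case 0 then show ?case using a b c0 subring_1[OF t.sA] by simp
  next
    case (Suc k)
    then have nz: "a / c k \<noteq> 0" "b / c k \<noteq> 0" using a b by auto
    let ?e = "v (n + k) (b / c k)"
    have e: "0 \<le> ?e" using R_v Suc nz by simp
    have "v (n + k) (a / c k) - ?e = v (n + k) (a / b)"
      using t.ordv_divide[OF nz, of "n + k"] Suc a b by simp
    then have "?e \<le> v (n + k) (a / c k)" using pos[of "n + k"] by simp
    then have "int (nat ?e) \<le> v (n + k) (a / c k)" "int (nat ?e) \<le> v (n + k) (b / c k)" using e by auto
    then have "(a / c k) / yy (n + k) ^ nat ?e \<in> R (Suc (n + k))" "(b / c k) / yy (n + k) ^ nat ?e \<in> R (Suc (n + k))"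
      using div_next nz Suc by blast+
    moreover have "c (Suc k) \<in> R (Suc (n + k))" unfolding cS using Suc t.AB t.yB by (intro subring_mult[OF t.sB] subring_power[OF t.sB]) auto
    ultimately show ?case using Suc t.y0 by (simp add: cS)
  qed
  have nz: "b / c k \<noteq> 0" for k using inv[of k] b by simp
  have sb: "b / c (Suc k) = (b / c k) / yy (n + k) ^ nat (v (n + k) (b / c k))" for k by (simp add: cS)
  have gf: "good_fact (R (n + Suc k)) (b / c (Suc k)) (yy n)" for k
  proof (induction k)
    case 0
    show ?case using good_fact_y[of "b / c 0" "n + 0"] inv[of 0] nz[of 0] unfolding sb by simp
  next
    case (Suc k)
    have "good_fact (R (Suc (n + Suc k))) (b / c (Suc k) / yy (n + Suc k) ^ nat (v (n + Suc k) (b / c (Suc k)))) (yy n)"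
      by (rule good_fact_step[OF _ nz Suc]) (use inv in blast)
    then show ?case unfolding sb[of "Suc k"] by simp
  qed
  obtain j where j: "r \<in> R j" using r by (auto simp: S_def)
  \<comment> \<open>Large enough for \<open>r\<close> to lie in \<open>R (n + k)\<close>, and
    positive because \<open>gf\<close> starts one stage after \<open>n\<close>.\<close>
  define k where "k = Suc j"
  have rk: "r \<in> R (n + k)" using R_mono[of j "n + k"] j by (auto simp: k_def)
  have "good_fact (R (n + k)) (b / c k) (yy n ^ K)" unfolding k_def by (rule good_fact_pow[OF t.sA gf])
  moreover have "(b / c k) * (c k * r) = yy n ^ K" using inv[of k] r by simp
  moreover have "c k * r \<in> R (n + k)" using inv[of k] rk subring_mult[OF t.sA] by auto
  ultimately have "inverse (b / c k) \<in> R (n + k)" using good_fact_dvd_unit[OF t.sA _ nz] inv by blast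
  then have "(a / c k) * inverse (b / c k) \<in> R (n + k)" using inv subring_mult[OF t.sA] by blast
  moreover have "(a / c k) * inverse (b / c k) = a / b" using inv[of k] by simp
  ultimately show ?thesis by (auto simp: S_def)
qed

end

locale qseqx = qseq +
  fixes x :: 'a and n0 :: nat
  assumes x: "x \<in> max_ideal (R n0)" "x \<noteq> 0" and rad: "\<And>s. s \<in> N \<Longrightarrow> \<exists>k. s ^ k \<in> prin S x"
begin

lemma xS: "x \<in> S" using x max_sub by (auto simp: S_def)
lemma xN: "x \<in> N" using x by (auto simp: N_def)

text \<open>\<open>quotient_in_S\<close> applies with denominator \<open>x ^ k\<close>, because some
  power of the exceptional parameter \<open>yy n\<close> is divisible by \<open>x\<close> in
  \<open>S\<close>.\<close>

lemma V_Int_T: assumes "z \<in> V" "z * x ^ k \<in> S" shows "z \<in> S"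
proof (cases "z = 0")
  case True then show ?thesis using subring_0[OF sS] by simp
next
  case False
  obtain n1 where n1: "\<forall>i\<ge>n1. 0 \<le> v i z" using assms(1) False unfolding V_iff by auto
  obtain n2 where n2: "z * x ^ k \<in> R n2" using assms(2) by (auto simp: S_def)
  define n where "n = max n0 (max n1 n2)"
  have xn: "x \<in> R n" using x max_sub R_mono[of n0 n] by (auto simp: n_def)
  have an: "z * x ^ k \<in> R n" using n2 R_mono[of n2 n] unfolding n_def by (meson max.cobounded2 max.coboundedI2 subsetD)
  have "yy n \<in> N" using t.y_m by (auto simp: N_def)
  then obtain j s where s: "yy n ^ j = x * s" "s \<in> S" using rad by (force simp: prin_def)
  have "(z * x ^ k) / x ^ k \<in> S"
  proof (rule quotient_in_S[OF an _ subring_power[OF t.sA xn]])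
    show "yy n ^ (j * k) = x ^ k * s ^ k" by (simp add: power_mult s power_mult_distrib)
    show "s ^ k \<in> S" by (rule subring_power[OF sS s(2)])
    show "0 \<le> v i (z * x ^ k / x ^ k)" if "n \<le> i" for i using n1 that x by (simp add: n_def)
  qed (use False x in auto)
  then show ?thesis using x by simp
qed

text \<open>The ring \<open>S[1/x]\<close>.\<close>

definition "T = {z. \<exists>k. z * x ^ k \<in> S}"

lemma T_mult: assumes "a \<in> T" "b \<in> T" shows "a * b \<in> T"
proof -
  obtain k l where "a * x ^ k \<in> S" "b * x ^ l \<in> S" using assms by (auto simp: T_def)
  then have "(a * x ^ k) * (b * x ^ l) \<in> S" by (rule subring_mult[OF sS])
  then have "(a * b) * x ^ (k + l) \<in> S" by (simp add: power_add ac_simps)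
  then show ?thesis unfolding T_def by blast
qed

lemma ST: "S \<subseteq> T" unfolding T_def by (auto intro!: exI[of _ 0])

lemma T_diff: assumes "a \<in> T" "b \<in> T" shows "a - b \<in> T"
proof -
  obtain k l where kl: "a * x ^ k \<in> S" "b * x ^ l \<in> S" using assms by (auto simp: T_def)
  have "(a * x ^ k) * x ^ l - (b * x ^ l) * x ^ k \<in> S"
    by (intro subring_diff[OF sS] subring_mult[OF sS] subring_power[OF sS xS] kl)
  then have "(a - b) * x ^ (k + l) \<in> S" by (simp add: power_add algebra_simps)
  then show ?thesis unfolding T_def by blast
qed

text \<open>The elements of \<open>R n0\<close> that are invertible in \<open>S[1/x]\<close>. The
  localization \<open>L\<close> at them is trapped between \<open>S\<close> and \<open>T\<close> by
  \<open>SL\<close> and \<open>L_T\<close>.\<close>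

definition "M = {b \<in> R n0. b \<noteq> 0 \<and> inverse b \<in> T}"
definition "L = {a / b | a b. a \<in> R n0 \<and> b \<in> M}"

lemma M_one: "1 \<in> M" using subring_1[OF t.sA] ST subring_1[OF sS] by (auto simp: M_def)
lemma M_mult: "a \<in> M \<Longrightarrow> b \<in> M \<Longrightarrow> a * b \<in> M" using T_mult subring_mult[OF t.sA] by (auto simp: M_def)
lemma R0_L: "R n0 \<subseteq> L" using M_one by (force simp: L_def)

lemma sL: "subring L"
  unfolding subring_def
proof (intro conjI ballI)
  show "0 \<in> L" "1 \<in> L" using R0_L subring_0[OF t.sA] subring_1[OF t.sA] by auto
  fix w z assume "w \<in> L" "z \<in> L"
  then obtain a b c d where 1: "w = a / b" "a \<in> R n0" "b \<in> M" "z = c / d" "c \<in> R n0" "d \<in> M" by (auto simp: L_def)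
  have bd: "b * d \<in> M" using M_mult 1 by auto
  have R: "b \<in> R n0" "d \<in> R n0" "b \<noteq> 0" "d \<noteq> 0" using 1 by (auto simp: M_def)
  have "w + z = (a * d + c * b) / (b * d)" "w - z = (a * d - c * b) / (b * d)" "w * z = (a * c) / (b * d)"
    using 1 R by (auto simp: field_simps)
  moreover have "a * d + c * b \<in> R n0" "a * d - c * b \<in> R n0" "a * c \<in> R n0" using 1 R t.sA by (auto intro!: subring_intros)
  ultimately show "w + z \<in> L" "w - z \<in> L" "w * z \<in> L" using bd unfolding L_def by blast+
qed

lemma L_inverse: assumes "w \<in> L" "w \<noteq> 0" "inverse w \<in> T" shows "inverse w \<in> L"
proof -
  obtain a b where 1: "w = a / b" "a \<in> R n0" "b \<in> M" using assms by (auto simp: L_def)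
  have b: "b \<in> R n0" "b \<noteq> 0" "inverse b \<in> T" using 1 by (auto simp: M_def)
  have a0: "a \<noteq> 0" using assms 1 by auto
  have "inverse w * inverse b \<in> T" by (rule T_mult[OF assms(3) b(3)])
  then have "inverse a \<in> T" using 1 b by (simp add: field_simps)
  then have "a \<in> M" using a0 1 by (simp add: M_def)
  moreover have "inverse w = b / a" using 1 by simp
  ultimately show ?thesis using b unfolding L_def by blast
qed

text \<open>Since \<open>x / yy j\<close> is in the next ring, \<open>yy j\<close> is invertible in
  \<open>S[1/x]\<close>, so the chart stays in \<open>L\<close>. The denominators from outside the
  prime are units of the next ring, and \<open>L_inverse\<close> puts their inverses into
  \<open>L\<close>.\<close>

lemma SL: "S \<subseteq> L"
proof -
  have "R (n0 + k) \<subseteq> L" for k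
  proof (induction k)
    case 0 then show ?case using R0_L by simp
  next
    case (Suc k)
    let ?j = "n0 + k"
    have "x \<in> max_ideal (R ?j)" using x m_mono[of n0 ?j] by auto
    then have "x / yy ?j \<in> R (Suc ?j)" by (rule t.divB)
    then have "inverse (yy ?j) * x ^ 1 \<in> S" by (auto simp: S_def field_simps)
    then have "inverse (yy ?j) \<in> T" unfolding T_def by blast
    then have yi: "inverse (yy ?j) \<in> L" using L_inverse[of "yy ?j"] Suc t.yA t.y0 by blast
    have "t.E ?j \<subseteq> L" unfolding t.E_def
    proof (rule ring_adj_least[OF sL])
      show "R ?j \<union> {a / yy ?j |a. a \<in> max_ideal (R ?j)} \<subseteq> L"
        using Suc subring_mult[OF sL _ yi] max_sub[of _ "R ?j"] by (auto simp: divide_inverse)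
    qed
    then have EL: "\<And>e. e \<in> t.E ?j \<Longrightarrow> e \<in> L" by blast
    show ?case
    proof
      fix b assume "b \<in> R (n0 + Suc k)"
      then have "b \<in> R (Suc ?j)" by simp
      then obtain e g where g: "b = e / g" "e \<in> t.E ?j" "g \<in> t.E ?j" "g \<notin> qq ?j" "g \<noteq> 0" by (rule t.B_rep)
      have "1 / g \<in> R (Suc ?j)" unfolding t.B_eq using g subring_1[OF t.sE] by (intro loc_atI)
      then have "inverse g \<in> T" using ST by (auto simp: S_def inverse_eq_divide)
      then have "inverse g \<in> L" using L_inverse[OF EL[OF g(3)] g(5)] by blast
      then have "e * inverse g \<in> L" using subring_mult[OF sL EL[OF g(2)]] by blast
      then show "b \<in> L" using g by (simp add: divide_inverse)
    qed
  qed
  moreover have "R i \<subseteq> R (n0 + i)" for i by (rule R_mono) simp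
  ultimately show ?thesis unfolding S_def by blast
qed

lemma L_T: "L \<subseteq> T"
  using T_mult ST by (force simp: L_def M_def S_def divide_inverse)

text \<open>\<open>S[1/x]\<close> is a localization of the Noetherian completely integrally closed domain \<open>R n0\<close>.\<close>
lemma cic_T: assumes "\<theta> \<in> complete_int_closure S" shows "\<theta> \<in> T"
proof -
  let ?A = "R n0"
  obtain d where d: "d \<in> S" "d \<noteq> 0" "\<And>z. z \<in> ring_adj S {\<theta>} \<Longrightarrow> d * z \<in> S"
    using assms by (auto simp: complete_int_closure_def)
  have th: "\<theta> ^ k \<in> ring_adj S {\<theta>}" for k
    using subring_power[OF ring_adj_subring[OF sS]] ring_adj_incl[of S "{\<theta>}"] by blast
  obtain d0 d1 where d01: "d = d0 / d1" "d0 \<in> ?A" "d1 \<in> M" using d(1) SL by (auto simp: L_def)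
  have d1: "d1 \<noteq> 0" "d1 \<in> ?A" using d01 by (auto simp: M_def)
  have d00: "d0 \<noteq> 0" using d d01 by auto
  have "d0 * \<theta> ^ k \<in> L" for k
  proof -
    have "d1 * (d * \<theta> ^ k) \<in> L" using d(3)[OF th] SL R0_L d1 subring_mult[OF sL] by blast
    then show ?thesis using d01 d1 by simp
  qed
  then have "\<forall>k. \<exists>a b. d0 * \<theta> ^ k = a / b \<and> a \<in> ?A \<and> b \<in> M" by (simp add: L_def)
  then obtain a b where ab: "\<And>k. d0 * \<theta> ^ k = a k / b k" "\<And>k. a k \<in> ?A" "\<And>k. b k \<in> M" by metis
  have b: "b k \<in> ?A" "b k \<noteq> 0" for k using ab(3)[of k] by (auto simp: M_def)
  \<comment> \<open>The Noetherian property, applied to the numerators of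
    \<open>d0 * \<theta> ^ k\<close>, expresses the one of index \<open>Suc K\<close> through its
    predecessors.\<close>
  have "\<exists>K. \<forall>n\<ge>K. gen_ideal ?A (a ` {..n}) = gen_ideal ?A (a ` {..K})"
  proof (rule noeth_chain[OF t.A(2)])
    show "sr_ideal ?A (gen_ideal ?A (a ` {..n}))" for n by (rule ideal_gen[OF t.sA]) (use ab in auto)
    show "gen_ideal ?A (a ` {..n}) \<subseteq> gen_ideal ?A (a ` {..Suc n})" for n
      by (rule gen_ideal_mono[OF t.sA]) (use ab in auto)
  qed
  then obtain K where K: "gen_ideal ?A (a ` {..Suc K}) = gen_ideal ?A (a ` {..K})" by (meson le_SucI order_refl)
  \<comment> \<open>\<open>gen_ideal\<close> sums over a set of elements; this form indexes the
    coefficients by exponents, even if some \<open>a i\<close> coincide.\<close>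
  define J where "J = {(\<Sum>i\<le>K. r i * a i) | r. \<forall>i. r i \<in> ?A}"
  have J: "sr_ideal ?A J" unfolding sr_ideal_def
  proof (intro conjI ballI)
    show "J \<subseteq> ?A" unfolding J_def using ab by (auto intro!: subring_sum[OF t.sA] subring_mult[OF t.sA])
    show "0 \<in> J" unfolding J_def using subring_0[OF t.sA] by (intro CollectI exI[of _ "\<lambda>_. 0"]) auto
    fix w assume "w \<in> J"
    then obtain r where r: "w = (\<Sum>i\<le>K. r i * a i)" "\<forall>i. r i \<in> ?A" unfolding J_def by blast
    { fix z assume "z \<in> J"
      then obtain s where s: "z = (\<Sum>i\<le>K. s i * a i)" "\<forall>i. s i \<in> ?A" unfolding J_def by blast
      have "w + z = (\<Sum>i\<le>K. (r i + s i) * a i)" using r s by (simp add: sum.distrib algebra_simps)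
      then show "w + z \<in> J" unfolding J_def using r s subring_add[OF t.sA] by (intro CollectI exI[of _ "\<lambda>i. r i + s i"]) auto }
    { fix z assume z: "z \<in> ?A"
      have "z * w = (\<Sum>i\<le>K. (z * r i) * a i)" using r by (simp add: sum_distrib_left mult.assoc)
      then show "z * w \<in> J" unfolding J_def using r z subring_mult[OF t.sA] by (intro CollectI exI[of _ "\<lambda>i. z * r i"]) auto }
  qed
  have aJ: "a i \<in> J" if "i \<le> K" for i
  proof -
    have "(\<Sum>j\<le>K. (if j = i then 1 else 0) * a j) = (\<Sum>j\<le>K. if j = i then a j else 0)" by (rule sum.cong) auto
    then have "a i = (\<Sum>j\<le>K. (if j = i then 1 else 0) * a j)" using that by simp
    then show ?thesis unfolding J_def using subring_0[OF t.sA] subring_1[OF t.sA]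
      by (intro CollectI exI[of _ "\<lambda>j. if j = i then 1 else 0"]) auto
  qed
  have "a (Suc K) \<in> gen_ideal ?A (a ` {..K})" using gen_ideal_incl[OF t.sA, of "a ` {..Suc K}"] K by auto
  then have "a (Suc K) \<in> J" using gen_ideal_least[OF J, of "a ` {..K}"] aJ by auto
  then obtain r where r: "a (Suc K) = (\<Sum>i\<le>K. r i * a i)" "\<And>i. r i \<in> ?A" unfolding J_def by blast
  define \<beta> where "\<beta> = b (Suc K)"
  have \<beta>: "\<beta> \<in> M" "\<beta> \<in> ?A" "\<beta> \<noteq> 0" using ab b by (auto simp: \<beta>_def)
  have ai: "a i = d0 * \<theta> ^ i * b i" for i using ab(1)[of i] b by (simp add: field_simps)
  have "d0 * (\<theta> ^ Suc K * \<beta>) = d0 * (\<Sum>i\<le>K. r i * b i * \<theta> ^ i)"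
    using r(1) unfolding ai sum_distrib_left \<beta>_def by (simp add: ac_simps)
  then have rel: "\<theta> ^ Suc K * \<beta> = (\<Sum>i\<le>K. r i * b i * \<theta> ^ i)" using d00 by simp
  \<comment> \<open>Multiplying \<open>\<theta>\<close> by the leading denominator
    \<open>\<beta>\<close> turns the relation into a monic one over \<open>R n0\<close>.\<close>
  define \<phi> where "\<phi> = \<beta> * \<theta>"
  define s where "s i = r i * b i * \<beta> ^ (K - i)" for i
  have sA: "s i \<in> ?A" for i unfolding s_def using r b \<beta> by (intro subring_mult[OF t.sA] subring_power[OF t.sA])
  have "\<phi> ^ Suc K = \<beta> ^ K * (\<theta> ^ Suc K * \<beta>)" by (simp add: \<phi>_def power_mult_distrib)
  also have "\<dots> = (\<Sum>i\<le>K. s i * \<phi> ^ i)" unfolding rel sum_distrib_left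
  proof (rule sum.cong[OF refl])
    fix i assume "i \<in> {..K}"
    then have "\<beta> ^ K = \<beta> ^ (K - i) * \<beta> ^ i" by (simp add: power_add[symmetric])
    then show "\<beta> ^ K * (r i * b i * \<theta> ^ i) = s i * \<phi> ^ i" by (simp add: s_def \<phi>_def power_mult_distrib ac_simps)
  qed
  finally have int: "\<phi> ^ Suc K = (\<Sum>i\<le>K. s i * \<phi> ^ i)" .
  obtain p w where pw: "p \<in> ?A" "w \<in> ?A" "w \<noteq> 0" "\<phi> = p / w" using t.quot[of n0] unfolding has_quotient_field_def by blast
  \<comment> \<open>By the monic relation the powers beyond \<open>K\<close> reduce to lower ones,
    so the single denominator \<open>w ^ K\<close> serves all powers of
    \<open>\<phi>\<close>.\<close>
  have almost: "w ^ K * \<phi> ^ k \<in> ?A" for k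
  proof (induction k rule: less_induct)
    case (less k)
    show ?case
    proof (cases "k \<le> K")
      case True
      have "w ^ K = w ^ (K - k) * w ^ k" using True by (simp add: power_add[symmetric])
      then have "w ^ K * \<phi> ^ k = w ^ (K - k) * p ^ k" using pw by (simp add: power_divide)
      then show ?thesis using pw by (auto intro: subring_mult[OF t.sA] subring_power[OF t.sA])
    next
      case False
      define l where "l = k - Suc K"
      have k: "k = l + Suc K" using False by (simp add: l_def)
      have "w ^ K * \<phi> ^ k = w ^ K * (\<phi> ^ l * \<phi> ^ Suc K)" unfolding k power_add by simp
      also have "\<dots> = (\<Sum>i\<le>K. s i * (w ^ K * \<phi> ^ (l + i)))" unfolding int by (simp add: sum_distrib_left power_add ac_simps)
      also have "\<dots> \<in> ?A"
      proof (rule subring_sum[OF t.sA])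
        fix i assume "i \<in> {..K}"
        then have "l + i < k" by (simp add: k)
        then show "s i * (w ^ K * \<phi> ^ (l + i)) \<in> ?A" using subring_mult[OF t.sA sA less] by blast
      qed
      finally show ?thesis .
    qed
  qed
  have "\<phi> \<in> ?A"
    by (rule regular_completely_integrally_closed[OF regR t.quot subring_power[OF t.sA pw(2)] _ almost]) (use pw in simp)
  then have "\<phi> / \<beta> \<in> L" using \<beta> unfolding L_def by blast
  then show ?thesis using L_T \<beta> by (auto simp: \<phi>_def)
qed

end

section \<open>The complete integral closure and the boundary valuation ring\<close>

lemma valuation_local: assumes V: "subring V" and tot: "\<And>z. z \<noteq> 0 \<Longrightarrow> z \<in> V \<or> inverse z \<in> V"
  shows "local_ring V"
proof -
  have mul: "a * z \<in> max_ideal V" if a: "a \<in> V" and z: "z \<in> max_ideal V" for a z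
  proof -
    have "inverse (a * z) \<notin> V" if nz: "a * z \<noteq> 0"
    proof
      assume "inverse (a * z) \<in> V"
      then have "a * inverse (a * z) \<in> V" by (rule subring_mult[OF V a])
      then show False using z nz by (auto simp: max_ideal_def field_simps)
    qed
    then show ?thesis using subring_mult[OF V a max_sub[OF z]] by (auto simp: max_ideal_def)
  qed
  have add: "a + b \<in> max_ideal V" if a: "a \<in> max_ideal V" and b: "b \<in> max_ideal V" for a b
  proof (cases "a = 0 \<or> b = 0")
    case True then show ?thesis using a b by auto
  next
    case False
    then consider "a / b \<in> V" | "b / a \<in> V" using tot[of "a / b"] by auto
    then show ?thesis
    proof cases
      case 1
      then have "(1 + a / b) * b \<in> max_ideal V" using b by (intro mul subring_add[OF V subring_1[OF V]])
      then show ?thesis using False by (simp add: field_simps)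
    next
      case 2
      then have "(1 + b / a) * a \<in> max_ideal V" using a by (intro mul subring_add[OF V subring_1[OF V]])
      then show ?thesis using False by (simp add: field_simps)
    qed
  qed
  show ?thesis unfolding local_ring_def sr_ideal_def
    using V mul add by (auto simp: max_ideal_def intro: subring_0)
qed

context qseqx
begin

lemma S_quotient: assumes "z \<noteq> 0" obtains a b where "a \<in> S" "b \<in> S" "a \<noteq> 0" "b \<noteq> 0" "z = a / b"
proof -
  obtain a b where "a \<in> R 0" "b \<in> R 0" "a \<noteq> 0" "b \<noteq> 0" "z = a / b" using t.frac[OF assms] .
  then show ?thesis using that[of a b] by (auto simp: S_def)
qed

text \<open>If \<open>z = a / b\<close> were divisible by all powers of \<open>x\<close> in
  \<open>V\<close>, each \<open>a / x ^ k\<close> would lie in \<open>V\<close> and in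
  \<open>S[1/x]\<close>, hence in \<open>S\<close>, and the archimedean property would give
  \<open>a = 0\<close>.\<close>

lemma x_power_bound: assumes "archimedean_dom S" "z \<noteq> 0" shows "\<exists>k. z / x ^ k \<notin> V"
proof (rule ccontr)
  assume no: "\<not> ?thesis"
  obtain a b where ab: "a \<in> S" "b \<in> S" "a \<noteq> 0" "b \<noteq> 0" "z = a / b" using S_quotient[OF assms(2)] .
  have "a \<in> {x ^ k * s | s. s \<in> S}" for k
  proof -
    have "z / x ^ k \<in> V" using no by blast
    then have "z / x ^ k * b \<in> V" using ab SV subring_mult[OF sV] by blast
    then have "a / x ^ k \<in> V" using ab by simp
    then have "a / x ^ k \<in> S" using V_Int_T[of "a / x ^ k" k] ab x by simp
    moreover have "a = x ^ k * (a / x ^ k)" using x by simp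
    ultimately show ?thesis by blast
  qed
  then have "a \<in> (\<Inter>n\<in>{0<..}. {x ^ n * s | s. s \<in> S})" by blast
  moreover have "x \<in> max_ideal S" using xN N_max by simp
  ultimately have "a = 0" using assms(1) unfolding archimedean_dom_def by auto
  then show False using ab by simp
qed

context
  fixes P :: "'a set" and \<theta> :: 'a
  assumes arch: "archimedean_dom S" and P: "height_one_prime V P"
    and \<theta>: "\<theta> \<in> complete_int_closure S" "\<theta> \<notin> S"
    and loc: "loc_at (ring_adj S {\<theta>}) N = loc_at V P"
begin

lemma pP: "sr_prime V P" using P by (simp add: height_one_prime_def)
lemma iP: "sr_ideal V P" by (rule prime_ideal[OF pP])
lemma PV: "p \<in> P \<Longrightarrow> p \<in> V" using ideal_memD[OF iP] .

text \<open>For a nonzero \<open>p\<close> in \<open>P\<close> some \<open>p / x ^ k\<close> is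
  outside the valuation ring \<open>V\<close>, so \<open>p\<close> divides \<open>x ^ k\<close> in
  \<open>V\<close>.\<close>

lemma xP: "x \<in> P"
proof -
  obtain p where p: "p \<in> P" "p \<noteq> 0" using P prime_0[OF pP] by (auto simp: height_one_prime_def)
  obtain k where k: "p / x ^ k \<notin> V" using x_power_bound[OF arch p(2)] by blast
  have "inverse (p / x ^ k) \<in> V" using V_total[of "p / x ^ k"] k p x by simp
  then have "inverse (p / x ^ k) * p \<in> P" using p by (intro ideal_mult[OF iP])
  then have "x ^ k \<in> P" using p by simp
  then show ?thesis using prime_powD[OF sV pP] xS SV by blast
qed

lemma NP: "N \<subseteq> P"
proof
  fix s assume s: "s \<in> N"
  then obtain k s' where "s ^ k = x * s'" "s' \<in> S" using rad by (force simp: prin_def)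
  then have "s ^ k \<in> P" using ideal_multr[OF iP _ xP] SV by auto
  moreover have "s \<in> V" using s SV N_max max_sub by blast
  ultimately show "s \<in> P" using prime_powD[OF sV pP] by blast
qed

abbreviation "W \<equiv> loc_at V P"

text \<open>Division by some \<open>b\<close> outside \<open>P\<close> keeps \<open>P\<close> in
  itself: otherwise \<open>b / p\<close> would be in \<open>V\<close> and \<open>b\<close> in
  \<open>P\<close>.\<close>

lemma PW: assumes "p \<in> P" "w \<in> W" shows "p * w \<in> P"
proof -
  obtain a b where ab: "w = a / b" "a \<in> V" "b \<in> V" "b \<notin> P" using loc_atE[OF assms(2)] .
  have b0: "b \<noteq> 0" using ab prime_0[OF pP] by auto
  have "p / b \<in> P"
  proof (cases "p = 0")
    case True then show ?thesis using prime_0[OF pP] by simp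
  next
    case False
    have "inverse (p / b) \<notin> V"
    proof
      assume "inverse (p / b) \<in> V"
      then have "inverse (p / b) * p \<in> P" by (rule ideal_mult[OF iP _ assms(1)])
      then show False using False ab by simp
    qed
    then have "p / b \<in> V" using V_total[of "p / b"] False b0 by auto
    moreover have "b * (p / b) \<in> P" using assms b0 by simp
    ultimately show ?thesis using primeD[OF pP ab(3)] ab(4) by blast
  qed
  then have "a * (p / b) \<in> P" using ab by (intro ideal_mult[OF iP])
  then show ?thesis using ab by (simp add: mult.commute)
qed

text \<open>\<open>W\<close> has rank one: \<open>\<Inter>n. u ^ n V\<close> is a prime strictly inside \<open>P\<close> when \<open>u \<in> P\<close>.\<close>
lemma cic_W: assumes z: "z \<in> complete_int_closure S" shows "z \<in> W"
proof (rule ccontr)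
  assume zW: "z \<notin> W"
  have VW: "V \<subseteq> W" by (rule loc_incl[OF sV pP])
  have zV: "z \<notin> V" and z0: "z \<noteq> 0" using zW VW subring_0[OF sV] by auto
  define u where "u = inverse z"
  have u0: "u \<noteq> 0" and uV: "u \<in> V" using V_total[OF z0] zV z0 by (auto simp: u_def)
  have "1 / u = z" by (simp add: u_def divide_inverse)
  then have uP: "u \<in> P" using loc_atI[OF subring_1[OF sV] uV, of P] zW by auto
  obtain d where d: "d \<in> S" "d \<noteq> 0" "\<And>z'. z' \<in> ring_adj S {z} \<Longrightarrow> d * z' \<in> S"
    using z by (auto simp: complete_int_closure_def)
  define Q where "Q = {w \<in> V. \<forall>k. w / u ^ k \<in> V}"
  have "d / u ^ k \<in> V" for k
  proof -
    have "z ^ k \<in> ring_adj S {z}" using subring_power[OF ring_adj_subring[OF sS]] ring_adj_incl[of S "{z}"] by blast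
    then have "d * z ^ k \<in> V" using d(3) SV by blast
    then show ?thesis by (simp add: u_def field_simps)
  qed
  then have dQ: "d \<in> Q" using d SV by (auto simp: Q_def)
  have "sr_prime V Q"
  proof (rule primeI[OF sV])
    show "sr_ideal V Q" unfolding sr_ideal_def Q_def
      using subring_0[OF sV] subring_add[OF sV] subring_mult[OF sV] by (auto simp: add_divide_distrib times_divide_eq_right[symmetric] simp del: times_divide_eq_right)
    show "1 \<notin> Q"
    proof
      assume "1 \<in> Q"
      then have "1 / u ^ 1 \<in> V" unfolding Q_def by blast
      then show False using zV \<open>1 / u = z\<close> by simp
    qed
    fix a b assume ab: "a \<in> V" "b \<in> V" "a * b \<in> Q"
    show "a \<in> Q \<or> b \<in> Q"
    proof (rule ccontr)
      assume "\<not> ?thesis"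
      then obtain k l where kl: "a / u ^ k \<notin> V" "b / u ^ l \<notin> V" using ab by (auto simp: Q_def)
      then have nz: "a \<noteq> 0" "b \<noteq> 0" using subring_0[OF sV] by auto
      have "inverse (a / u ^ k) \<in> V" "inverse (b / u ^ l) \<in> V"
        using V_total[of "a / u ^ k"] V_total[of "b / u ^ l"] kl nz u0 by auto
      \<comment> \<open>One power more than the two failures account for: the surplus factor
        \<open>1 / u = z\<close> would land in \<open>V\<close>.\<close>
      moreover have "(a * b) / u ^ (k + l + 1) \<in> V" using ab(3) unfolding Q_def by blast
      ultimately have "inverse (a / u ^ k) * inverse (b / u ^ l) * ((a * b) / u ^ (k + l + 1)) \<in> V"
        by (intro subring_mult[OF sV])
      moreover have "inverse (a / u ^ k) * inverse (b / u ^ l) * ((a * b) / u ^ (k + l + 1)) = z"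
        using nz u0 z0 by (simp add: power_add u_def field_simps)
      ultimately show False using zV by simp
    qed
  qed
  moreover have "{0} \<subset> Q" using dQ d prime_0[OF \<open>sr_prime V Q\<close>] by auto
  moreover have "Q \<subset> P"
  proof
    show "Q \<subseteq> P"
    proof
      fix w assume "w \<in> Q"
      then have "w / u ^ 1 \<in> V" unfolding Q_def by blast
      then have "w / u ^ 1 * u \<in> P" by (rule ideal_mult[OF iP _ uP])
      then show "w \<in> P" using u0 by simp
    qed
    have "u \<notin> Q"
    proof
      assume "u \<in> Q"
      then have "u / u ^ 2 \<in> V" unfolding Q_def by blast
      then show False using zV u0 by (simp add: u_def power2_eq_square field_simps)
    qed
    then show "Q \<noteq> P" using uP by blast
  qed
  ultimately show False using P unfolding height_one_prime_def by blast
qed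

section \<open>The rings \<open>S[\<theta>]\<close> and \<open>S[1/\<theta>]\<close> and the place
  at infinity\<close>

abbreviation "A' \<equiv> ring_adj S {\<theta>}"

lemma sA': "subring A'" by (rule ring_adj_subring[OF sS])
lemma SA': "S \<subseteq> A'" and thA': "\<theta> \<in> A'" using ring_adj_incl[of S "{\<theta>}"] by auto

lemma A'_cic: assumes "z \<in> A'" shows "z \<in> complete_int_closure S"
proof -
  have "ring_adj S {z} \<subseteq> A'" using assms SA' by (intro ring_adj_least[OF sA']) auto
  then show ?thesis using \<theta>(1) unfolding complete_int_closure_def by blast
qed

lemma A'_T: "z \<in> A' \<Longrightarrow> z \<in> T" using A'_cic cic_T by blast

lemma TV_S: "z \<in> T \<Longrightarrow> z \<in> V \<Longrightarrow> z \<in> S" using V_Int_T by (auto simp: T_def)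

text \<open>The product lies in \<open>P\<close>, hence in \<open>V\<close>, and also in
  \<open>S[1/x]\<close>, hence in \<open>S\<close>; a unit of \<open>S\<close> cannot lie in
  \<open>P\<close>.\<close>

lemma NA': assumes n: "n \<in> N" and z: "z \<in> A'" shows "n * z \<in> N"
proof -
  have nzP: "n * z \<in> P" using PW cic_W[OF A'_cic[OF z]] NP n by blast
  have "n \<in> S" using n N_max max_sub by blast
  then have "n * z \<in> T" using T_mult ST A'_T[OF z] by blast
  then have nzS: "n * z \<in> S" using TV_S PV[OF nzP] by blast
  show ?thesis
  proof (rule ccontr)
    assume "n * z \<notin> N"
    then have "n * z \<noteq> 0" "inverse (n * z) \<in> S" using nonmax_unit[OF nzS] N_max by auto
    then have "inverse (n * z) * (n * z) \<in> P" using ideal_mult[OF iP _ nzP] SV by blast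
    then show False using prime_one[OF pP] \<open>n * z \<noteq> 0\<close> by (simp del: inverse_mult_distrib)
  qed
qed

lemma NS: "n \<in> N \<Longrightarrow> n \<in> S" using N_max max_sub by blast

abbreviation "\<eta> \<equiv> inverse \<theta>"
abbreviation "B' \<equiv> ring_adj S {\<eta>}"

lemma thV: "\<theta> \<notin> V" using TV_S A'_T[OF thA'] \<theta>(2) by blast
lemma th0: "\<theta> \<noteq> 0" using thV subring_0[OF sV] by auto
lemma etaV: "\<eta> \<in> V" using V_total[OF th0] thV by blast
lemma lV: "local_ring V" by (rule valuation_local[OF sV V_total])
lemma eta_max: "\<eta> \<in> max_ideal V" using etaV thV by (simp add: max_ideal_def)
lemma sB': "subring B'" by (rule ring_adj_subring[OF sS])
lemma SB': "S \<subseteq> B'" and etaB': "\<eta> \<in> B'" using ring_adj_incl[of S "{\<eta>}"] by auto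
lemma B'V: "B' \<subseteq> V" using SV etaV by (intro ring_adj_least[OF sV]) auto

lemma unit_V: assumes b: "b \<in> S" "b \<notin> N" and e: "e \<in> V" shows "b + \<eta> * e \<noteq> 0" "inverse (b + \<eta> * e) \<in> V"
proof -
  have b': "inverse b \<in> V" "b \<noteq> 0" using nonmax_unit[OF b(1)] b N_max SV by auto
  have bV: "b \<in> V" using b SV by auto
  have ee: "\<eta> * e \<in> max_ideal V" using ideal_multr[OF local_max[OF lV] e eta_max] .
  have "b + \<eta> * e \<notin> max_ideal V"
  proof
    assume "b + \<eta> * e \<in> max_ideal V"
    then have "(b + \<eta> * e) - \<eta> * e \<in> max_ideal V" by (rule ideal_diff[OF sV local_max[OF lV] _ ee])
    then show False using b' bV by (simp add: max_ideal_def)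
  qed
  then show "b + \<eta> * e \<noteq> 0" "inverse (b + \<eta> * e) \<in> V"
    using nonmax_unit[of "b + \<eta> * e" V] subring_add[OF sV bV max_sub[OF ee]] by auto
qed

text \<open>Elements with a unit of \<open>S\<close> as constant term in \<open>\<eta>\<close>. They
  are exactly the elements of \<open>B'\<close> outside \<open>\<eta> B'\<close>, and they are units
  of \<open>V\<close>.\<close>

definition "uform e \<longleftrightarrow> (\<exists>b e'. b \<in> S \<and> b \<notin> N \<and> e' \<in> B' \<and> e = b + \<eta> * e')"

lemma uform_B': "uform e \<Longrightarrow> e \<in> B'"
  using SB' etaB' by (auto simp: uform_def intro!: subring_add[OF sB'] subring_mult[OF sB'])
lemma uform_unit: assumes "uform e" shows "e \<noteq> 0" "inverse e \<in> V"
proof -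
  obtain b e' where "b \<in> S" "b \<notin> N" "e' \<in> V" "e = b + \<eta> * e'" using assms B'V by (auto simp: uform_def)
  then show "e \<noteq> 0" "inverse e \<in> V" using unit_V by auto
qed

text \<open>A polynomial in \<open>\<theta>\<close> outside \<open>N\<close> is, after absorbing leading coefficients from \<open>N\<close> into the
  constant term, a power of \<open>\<theta>\<close> times a polynomial in \<open>1/\<theta>\<close> with unit constant term.\<close>
lemma normal_form: assumes "h \<in> A'" "h \<notin> N" shows "\<exists>n e. h = \<theta> ^ n * e \<and> uform e"
proof -
  obtain p where p: "h = poly p \<theta>" "\<And>i. coeff p i \<in> S" using assms(1) unfolding ring_adj_single[OF sS] by (meson padjE)
  have "\<exists>n e. poly p \<theta> = \<theta> ^ n * e \<and> uform e" if "degree p \<le> m" "\<And>i. coeff p i \<in> S" "poly p \<theta> \<notin> N" for m and p :: "'a poly"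
    using that
  proof (induction m arbitrary: p)
    case 0
    then obtain c where c: "p = [:c:]" using degree_0_id[of p] by (metis le_zero_eq)
    then have "c \<in> S" "c \<notin> N" using 0(2)[of 0] 0(3) by auto
    then have "uform c" unfolding uform_def using subring_0[OF sB'] by (intro exI[of _ c] exI[of _ 0]) auto
    then show ?case using c by (intro exI[of _ 0] exI[of _ c]) auto
  next
    case (Suc m)
    let ?c = "coeff p (Suc m)"
    show ?case
    proof (cases "?c \<in> N")
      case True
      \<comment> \<open>\<open>NA'\<close> puts the whole leading term into \<open>S\<close>, so it
        may join the constant coefficient.\<close>
      define n0 where "n0 = ?c * \<theta> ^ Suc m"
      have n0: "n0 \<in> S" unfolding n0_def using NS[OF NA'[OF True subring_power[OF sA' thA']]] .
      define p' where "p' = p - monom ?c (Suc m) + [:n0:]"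
      have cp': "coeff p' i = (if i = Suc m then 0 else coeff p i) + (if i = 0 then n0 else 0)" for i
        by (cases i) (auto simp: p'_def coeff_monom)
      have "degree p' \<le> m" by (rule degree_le) (use Suc.prems(1) in \<open>auto simp: cp' coeff_eq_0\<close>)
      moreover have "coeff p' i \<in> S" for i using Suc.prems(2) n0 by (auto simp: cp' intro: subring_intros sS)
      moreover have "poly p' \<theta> = poly p \<theta>" by (simp add: p'_def poly_monom n0_def)
      ultimately show ?thesis using Suc.IH[of p'] Suc.prems(3) by simp
    next
      case False
      \<comment> \<open>The lower part read backwards: extracting \<open>\<theta> ^ Suc m\<close>
        makes the leading coefficient the constant term in \<open>\<eta>\<close>.\<close>
      define e' where "e' = (\<Sum>i\<le>m. coeff p i * \<eta> ^ (m - i))"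
      have e'B: "e' \<in> B'" unfolding e'_def using Suc.prems(2) SB'
        by (intro subring_sum[OF sB'] subring_mult[OF sB'] subring_power[OF sB' etaB']) auto
      have tm: "\<theta> ^ Suc m * (\<eta> * (coeff p i * \<eta> ^ (m - i))) = coeff p i * \<theta> ^ i" if "i \<le> m" for i
      proof -
        have "\<theta> ^ Suc m = \<theta> * (\<theta> ^ i * \<theta> ^ (m - i))" using that by (simp add: power_add[symmetric])
        then have "\<theta> ^ Suc m * (\<eta> * (coeff p i * \<eta> ^ (m - i))) = (\<theta> * \<eta>) * (\<theta> ^ (m - i) * \<eta> ^ (m - i)) * (coeff p i * \<theta> ^ i)"
          by (simp only: ac_simps)
        also have "\<theta> ^ (m - i) * \<eta> ^ (m - i) = 1" using th0 by (simp add: power_mult_distrib[symmetric])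
        finally show ?thesis using th0 by simp
      qed
      have "\<theta> ^ Suc m * (?c + \<eta> * e') = ?c * \<theta> ^ Suc m + (\<Sum>i\<le>m. \<theta> ^ Suc m * (\<eta> * (coeff p i * \<eta> ^ (m - i))))"
        unfolding e'_def distrib_left sum_distrib_left by (simp only: mult.commute)
      also have "\<dots> = ?c * \<theta> ^ Suc m + (\<Sum>i\<le>m. coeff p i * \<theta> ^ i)" using sum.cong[OF refl tm, of "{..m}"] by simp
      also have "\<dots> = poly p \<theta>" using poly_altdef_le[OF Suc.prems(1), of \<theta>] by simp
      finally have "poly p \<theta> = \<theta> ^ Suc m * (?c + \<eta> * e')" by simp
      moreover have "uform (?c + \<eta> * e')" unfolding uform_def using False Suc.prems(2) e'B by blast
      ultimately show ?thesis by blast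
    qed
  qed
  from this[OF order_refl p(2)] p(1) assms(2) show ?thesis by simp
qed

lemma B'_split: assumes "g \<in> B'" shows "\<exists>s\<in>S. \<exists>g'\<in>B'. g = s + \<eta> * g'"
proof -
  obtain p where p: "g = poly p \<eta>" "\<And>i. coeff p i \<in> S" using assms unfolding ring_adj_single[OF sS] by (meson padjE)
  obtain a p' where ap: "p = pCons a p'" by (cases p) auto
  have "a \<in> S" using p(2)[of 0] ap by simp
  moreover have "poly p' \<eta> \<in> B'" using p(2)[of "Suc _"] ap unfolding ring_adj_single[OF sS] by (intro padjI) simp
  ultimately show ?thesis using p ap by auto
qed

abbreviation "I \<equiv> {\<eta> * s | s. s \<in> B'}"

lemma I_prin: "I = prin B' \<eta>" by (simp add: prin_def)
lemma iI: "sr_ideal B' I" unfolding I_prin by (rule ideal_prin[OF sB' etaB'])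
lemma I_max: "I \<subseteq> max_ideal V" using ideal_multr[OF local_max[OF lV] _ eta_max] B'V by auto

text \<open>A constant term \<open>s\<close> in \<open>N\<close> satisfies
  \<open>s * \<theta> \<in> S\<close>, so \<open>s = \<eta> * (s * \<theta>)\<close> would be
  absorbed into \<open>I\<close>.\<close>

lemma B'_not_I: assumes "g \<in> B'" "g \<notin> I" shows "uform g"
proof -
  obtain s g' where g: "s \<in> S" "g' \<in> B'" "g = s + \<eta> * g'" using B'_split[OF assms(1)] by blast
  have "s \<notin> N"
  proof
    assume "s \<in> N"
    then have "s * \<theta> \<in> S" using NS NA' thA' by blast
    then have "s * \<theta> + g' \<in> B'" using SB' g by (intro subring_add[OF sB']) auto
    moreover have "g = \<eta> * (s * \<theta> + g')" using g th0 by (simp add: field_simps)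
    ultimately show False using assms(2) by blast
  qed
  then show ?thesis using g unfolding uform_def by blast
qed

lemma uform_not_I: "uform e \<Longrightarrow> e \<notin> I"
  using I_max uform_unit[of e] by (auto simp: max_ideal_def)

text \<open>The denominator is outside \<open>N\<close> and always has a normal form; a numerator
  inside \<open>N\<close> needs none, since it already lies in \<open>S\<close>.\<close>

lemma W_form: assumes "z \<in> W" shows "\<exists>n e. uform e \<and> (\<exists>f\<in>A'. z = f / (\<theta> ^ n * e) \<and> (f \<in> N \<or> (\<exists>m e'. uform e' \<and> f = \<theta> ^ m * e')))"
proof -
  obtain f g where fg: "z = f / g" "f \<in> A'" "g \<in> A'" "g \<notin> N" using assms unfolding loc[symmetric] by (rule loc_atE)
  then show ?thesis using normal_form[of g] normal_form[of f] by metis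
qed

lemma max_I: "sr_maximal B' I"
  unfolding sr_maximal_def
proof (intro conjI allI impI iI)
  have "1 \<notin> I" using I_max one_notin_max[OF sV] by auto
  then show "I \<noteq> B'" using subring_1[OF sB'] by blast
  fix J assume J: "sr_ideal B' J \<and> I \<subseteq> J"
  show "J = I \<or> J = B'"
  proof (rule disjCI)
    assume "J \<noteq> B'"
    show "J = I"
    proof (rule ccontr)
      assume "J \<noteq> I"
      then obtain g where g: "g \<in> J" "g \<notin> I" using J by blast
      then have "uform g" using B'_not_I ideal_memD[of B' J] J by blast
      then obtain b e' where b: "b \<in> S" "b \<notin> N" "e' \<in> B'" "g = b + \<eta> * e'" by (auto simp: uform_def)
      have "\<eta> * e' \<in> J" using b J by blast
      then have "g - \<eta> * e' \<in> J" using ideal_diff[OF sB' _ g(1)] J by blast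
      then have "b \<in> J" using b by simp
      moreover have "b \<noteq> 0" "inverse b \<in> S" using nonmax_unit[OF b(1)] b N_max by auto
      ultimately have "inverse b * b \<in> J" using ideal_mult[of B' J] J SB' by blast
      then have "J = B'" using ideal_one[of B' J] J \<open>b \<noteq> 0\<close> by simp
      then show False using \<open>J \<noteq> B'\<close> by simp
    qed
  qed
qed

text \<open>In the fraction given by \<open>W_form\<close>, an excess of \<open>\<theta>\<close> in
  the numerator over units of \<open>V\<close> would put \<open>\<theta>\<close> into
  \<open>V\<close>.\<close>

lemma V_loc: "V = loc_at B' I"
proof
  show "loc_at B' I \<subseteq> V"
  proof
    fix z assume "z \<in> loc_at B' I"
    then obtain f g where fg: "z = f / g" "f \<in> B'" "g \<in> B'" "g \<notin> I" by (rule loc_atE)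
    then have "inverse g \<in> V" using uform_unit[OF B'_not_I] by blast
    then show "z \<in> V" using fg B'V subring_mult[OF sV, of f "inverse g"] by (auto simp: divide_inverse)
  qed
  show "V \<subseteq> loc_at B' I"
  proof
    fix z assume z: "z \<in> V"
    then have "z \<in> W" using loc_incl[OF sV pP] by blast
    then obtain n e f where e: "uform e" and f: "f \<in> A'" "z = f / (\<theta> ^ n * e)" and
      cs: "f \<in> N \<or> (\<exists>m e'. uform e' \<and> f = \<theta> ^ m * e')" using W_form by blast
    have eB: "e \<in> B'" "e \<notin> I" "e \<noteq> 0" using uform_B' uform_not_I uform_unit e by auto
    from cs show "z \<in> loc_at B' I"
    proof
      assume "f \<in> N"
      then have "f * \<eta> ^ n \<in> B'" using NS SB' by (intro subring_mult[OF sB'] subring_power[OF sB' etaB']) auto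
      then have "(f * \<eta> ^ n) / e \<in> loc_at B' I" using eB by (intro loc_atI)
      moreover have "(f * \<eta> ^ n) / e = z" using f th0 by (simp add: field_simps)
      ultimately show ?thesis by simp
    next
      assume "\<exists>m e'. uform e' \<and> f = \<theta> ^ m * e'"
      then obtain m e' where e': "uform e'" "f = \<theta> ^ m * e'" by blast
      have e'B: "e' \<in> B'" "e' \<noteq> 0" "inverse e' \<in> V" using uform_B' uform_unit e' by auto
      show ?thesis
      proof (cases "m \<le> n")
        case True
        have "\<theta> ^ n = \<theta> ^ m * \<theta> ^ (n - m)" using True by (simp add: power_add[symmetric])
        then have "z = (\<eta> ^ (n - m) * e') / e" using f e' th0 by (simp add: field_simps)
        moreover have "\<eta> ^ (n - m) * e' \<in> B'" using e'B by (intro subring_mult[OF sB'] subring_power[OF sB' etaB'])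
        ultimately show ?thesis using eB by (auto intro: loc_atI)
      next
        case False
        define k where "k = m - n - 1"
        have "\<theta> ^ m = \<theta> ^ n * \<theta> ^ k * \<theta>" using False unfolding power_add[symmetric] power_Suc2[symmetric] by (simp add: k_def)
        then have "z = \<theta> ^ k * \<theta> * e' / e" using f e' th0 by simp
        then have "\<theta> = z * e * inverse e' * \<eta> ^ k" using eB e'B th0 by (simp add: field_simps)
        moreover have "z * e * inverse e' * \<eta> ^ k \<in> V"
          using z eB e'B B'V by (intro subring_mult[OF sV] subring_power[OF sV etaV]) auto
        ultimately show ?thesis using thV by simp
      qed
    qed
  qed
qed

text \<open>The residue field of \<open>V\<close> is that of \<open>S\<close>: modulo
  \<open>\<eta>\<close> the fraction \<open>f / g\<close> equals the quotient \<open>c\<close> of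
  the constant terms.\<close>

lemma V_split: assumes "w \<in> V" shows "\<exists>c\<in>S. \<exists>w'\<in>V. w = c + \<eta> * w'"
proof -
  obtain f g where fg: "w = f / g" "f \<in> B'" "g \<in> B'" "g \<notin> I" using assms unfolding V_loc by (rule loc_atE)
  have g: "uform g" by (rule B'_not_I[OF fg(3,4)])
  obtain b g' where b: "b \<in> S" "b \<notin> N" "g' \<in> B'" "g = b + \<eta> * g'" using g by (auto simp: uform_def)
  obtain s f' where s: "s \<in> S" "f' \<in> B'" "f = s + \<eta> * f'" using B'_split[OF fg(2)] by blast
  have bi: "b \<noteq> 0" "inverse b \<in> S" using nonmax_unit[OF b(1)] b N_max by auto
  have gi: "g \<noteq> 0" "inverse g \<in> V" using uform_unit[OF g] by auto
  define c where "c = s * inverse b"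
  define w' where "w' = (f' - c * g') * inverse g"
  have cS: "c \<in> S" unfolding c_def using s bi by (intro subring_mult[OF sS])
  have "w' \<in> V" unfolding w'_def using s b cS gi B'V SV by (intro subring_mult[OF sV] subring_diff[OF sV]) auto
  moreover have "f - c * g = \<eta> * (f' - c * g')" unfolding s(3) b(4) c_def using bi by (simp add: algebra_simps)
  then have "f = c * g + \<eta> * (f' - c * g')" by (simp add: algebra_simps)
  then have "f / g = c + \<eta> * w'" using gi(1) unfolding w'_def by (simp add: divide_inverse distrib_right mult.assoc)
  then have "w = c + \<eta> * w'" using fg(1) by simp
  ultimately show ?thesis using cS by blast
qed

text \<open>\<open>V_split\<close> provides the coefficient \<open>c\<close> of the leading pole.
  Without a pole the element lies in \<open>V\<close> and \<open>S[1/x]\<close>, hence in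
  \<open>S\<close>.\<close>

lemma pole_bound: "z \<in> T \<Longrightarrow> z * \<eta> ^ r \<in> V \<Longrightarrow> z \<in> A'"
proof (induction r arbitrary: z)
  case 0 then show ?case using TV_S SA' by auto
next
  case (Suc r)
  obtain c w where c: "c \<in> S" "w \<in> V" "z * \<eta> ^ Suc r = c + \<eta> * w" using V_split[OF Suc.prems(2)] by blast
  have ct: "c * \<theta> ^ Suc r \<in> A'" using c SA' by (intro subring_mult[OF sA'] subring_power[OF sA' thA']) auto
  have one: "\<theta> ^ Suc r * \<eta> ^ Suc r = 1" using th0 by (simp only: power_mult_distrib[symmetric]) simp
  have "(z - c * \<theta> ^ Suc r) * \<eta> ^ Suc r = z * \<eta> ^ Suc r - c * (\<theta> ^ Suc r * \<eta> ^ Suc r)" by (simp only: left_diff_distrib mult.assoc)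
  also have "\<dots> = \<eta> * w" unfolding one c(3) by simp
  finally have "\<eta> * ((z - c * \<theta> ^ Suc r) * \<eta> ^ r) = \<eta> * w" by (simp add: ac_simps)
  then have "(z - c * \<theta> ^ Suc r) * \<eta> ^ r = w" using th0 by simp
  moreover have "z - c * \<theta> ^ Suc r \<in> T" using T_diff[OF Suc.prems(1) A'_T[OF ct]] .
  ultimately have "z - c * \<theta> ^ Suc r \<in> A'" using Suc.IH c by blast
  then have "(z - c * \<theta> ^ Suc r) + c * \<theta> ^ Suc r \<in> A'" by (rule subring_add[OF sA' _ ct])
  then show ?case by simp
qed

text \<open>The exponent of \<open>\<theta>\<close> in the numerator of \<open>W_form\<close> bounds
  the pole, as \<open>pole_bound\<close> requires.\<close>

lemma cic_eq: "complete_int_closure S = A'"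
proof
  show "A' \<subseteq> complete_int_closure S" using A'_cic by blast
  show "complete_int_closure S \<subseteq> A'"
  proof
    fix z assume z: "z \<in> complete_int_closure S"
    obtain n e f where e: "uform e" and f: "f \<in> A'" "z = f / (\<theta> ^ n * e)" and
      cs: "f \<in> N \<or> (\<exists>m e'. uform e' \<and> f = \<theta> ^ m * e')" using W_form[OF cic_W[OF z]] by blast
    have ei: "e \<noteq> 0" "inverse e \<in> V" using uform_unit[OF e] by auto
    have "\<exists>r. z * \<eta> ^ r \<in> V" using cs
    proof
      assume "f \<in> N"
      then have "f * \<eta> ^ n * inverse e \<in> V" using NS SV ei by (intro subring_mult[OF sV] subring_power[OF sV etaV]) auto
      moreover have "z * \<eta> ^ 0 = f * \<eta> ^ n * inverse e" using f th0 by (simp add: field_simps)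
      ultimately show ?thesis by metis
    next
      assume "\<exists>m e'. uform e' \<and> f = \<theta> ^ m * e'"
      then obtain m e' where e': "uform e'" "f = \<theta> ^ m * e'" by blast
      have "e' * \<eta> ^ n * inverse e \<in> V" using uform_B'[OF e'(1)] B'V ei by (intro subring_mult[OF sV] subring_power[OF sV etaV]) auto
      moreover have "z * \<eta> ^ m = e' * \<eta> ^ n * inverse e" using f e' th0 by (simp add: field_simps)
      ultimately show ?thesis by metis
    qed
    then show "z \<in> A'" using pole_bound[OF cic_T[OF z]] by blast
  qed
qed

end

end

theorem theorem7p3:
  fixes R :: "nat \<Rightarrow> 'a::field set" and x \<theta> :: 'a and P S N V W :: "'a set"
  assumes quot: "has_quotient_field (R 0)"
    and reg: "\<And>i. regular_local (R i)"
    and dim2: "\<And>i. has_prime_chain (R i) 2"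
    and strict: "\<And>i. R i \<subset> R (Suc i)"
    and qt: "\<And>i. quad_transform (R i) (R (Suc i))"
    and S_def: "S = (\<Union>i. R i)"
    and N_def: "N = (\<Union>i. max_ideal (R i))"
    and x: "x \<in> S" and xprim: "primary_ideal S {x * s | s. s \<in> S}"
    and xrad: "radical S {x * s | s. s \<in> S} = N"
    and T_loc: "\<exists>M. mult_closed (R 0) M \<and> noetherian_hull S = frac_loc (R 0) M"
    and V_def: "V = boundary_valring R"
    and P: "height_one_prime V P"
    and W_def: "W = loc_at V P"
    and arch: "archimedean_dom S"
    and notDVR: "\<not> DVR S"
    and \<theta>: "\<theta> \<in> complete_int_closure S - S"
    and loc: "loc_at (ring_adj S {\<theta>}) N = W"
  shows "complete_int_closure S = ring_adj S {\<theta>}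
    \<and> sr_maximal (ring_adj S {inverse \<theta>}) {inverse \<theta> * s | s. s \<in> ring_adj S {inverse \<theta>}}
    \<and> V = loc_at (ring_adj S {inverse \<theta>}) {inverse \<theta> * s | s. s \<in> ring_adj S {inverse \<theta>}}"
proof -
  have RR: "R 0 \<subseteq> R i" for i by (rule lift_Suc_mono_le[of R]) (use strict in auto)
  have quotR: "has_quotient_field (R i)" for i
    unfolding has_quotient_field_def
  proof
    fix z
    obtain a b where "a \<in> R 0" "b \<in> R 0" "b \<noteq> 0" "z = a / b" using quot unfolding has_quotient_field_def by blast
    then show "\<exists>a\<in>R i. \<exists>b\<in>R i. b \<noteq> 0 \<and> z = a / b" using RR[of i] by blast
  qed
  have "\<exists>y us q. qtrans (R i) y us q (R (Suc i))" for i
  proof -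
    have lR: "local_ring (R i)" using reg[of i] by (simp add: regular_local_def)
    note sR = local_subring[OF lR] and iR = local_max[OF lR]
    let ?m = "max_ideal (R i)"
    obtain y q where y: "y \<in> ?m" "y \<notin> ideal_pow (R i) ?m 2" and
      q: "sr_prime (ring_adj (R i) {a / y | a. a \<in> ?m}) q" "?m \<subseteq> q" "R (Suc i) = loc_at (ring_adj (R i) {a / y | a. a \<in> ?m}) q"
      using qt[of i] unfolding quad_transform_def by blast
    have "ideal_pow (R i) ?m 2 = iprod (R i) ?m ?m"
      unfolding numeral_2_eq_2 ideal_pow_Suc_iprod[of _ _ "Suc 0"] ideal_pow_1[OF sR iR] ..
    \<comment> \<open>\<open>y\<close> is outside the square of the maximal ideal, so it can be
      exchanged into a regular system of parameters; this turns the transform into a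
      \<open>chart\<close>.\<close>
    then obtain us where us: "regsys (R i) (y # us)"
      using regular_regsys[OF reg[of i]] regsys_exchange[of "R i" _ y] y by auto
    interpret c: chart "R i" y us by unfold_locales (rule us)
    have "qtrans (R i) y us q (R (Suc i))"
      by unfold_locales (use q quotR in \<open>auto simp: c.E_def\<close>)
    then show ?thesis by blast
  qed
  then obtain yy us qq where q: "\<And>i. qtrans (R i) (yy i) (us i) (qq i) (R (Suc i))" by metis
  interpret s: qseq R yy us qq by (rule qseq.intro) (fact q reg)+
  have SS: "S = s.S" and NN: "N = s.N" and VV: "V = s.V" by (simp_all add: S_def N_def V_def s.S_def s.N_def s.V_def)
  have rad: "\<exists>k. n ^ k \<in> prin s.S x" if "n \<in> s.N" for n
    using that xrad unfolding radical_def NN SS prin_def by blast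
  have "x \<in> radical S {x * s | s. s \<in> S}" unfolding radical_def
    using x subring_1[OF s.sS] SS by (auto intro!: exI[of _ 1])
  then have "x \<in> N" using xrad by simp
  then obtain n0 where n0: "x \<in> max_ideal (R n0)" by (auto simp: N_def)
  \<comment> \<open>For \<open>x = 0\<close> the radical of \<open>xS\<close> would be zero, but
    \<open>N\<close> contains the nonzero exceptional parameter \<open>yy 0\<close>.\<close>
  have x0: "x \<noteq> 0"
  proof
    assume "x = 0"
    have "yy 0 \<in> s.N" using s.t.y_m[of 0] by (auto simp: s.N_def)
    then obtain k where "yy 0 ^ k \<in> prin s.S x" using rad by blast
    then have "yy 0 ^ k = 0" using \<open>x = 0\<close> by (auto simp: prin_def)
    then show False using s.t.y0[of 0] by simp
  qed
  interpret sx: qseqx R yy us qq x n0 by unfold_locales (use n0 x0 rad in auto)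
  have h: "archimedean_dom s.S" "height_one_prime s.V P" "\<theta> \<in> complete_int_closure s.S" "\<theta> \<notin> s.S"
    "loc_at (ring_adj s.S {\<theta>}) s.N = loc_at s.V P"
    using arch P \<theta> loc W_def SS NN VV by auto
  show ?thesis unfolding SS VV using sx.cic_eq[OF h] sx.max_I[OF h] sx.V_loc[OF h] by blast
qed

end
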